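(* Let $d\in\{2,3\}$, assume (A1), (A2), (A3), $f\in L^2(D)$, fix data $\delta$ and $\ell\in V^*$. Choose $J_l:=2^{\lceil l/q\rceil}$, $L'(l):=L-l$ and $M_{ll'}:=2^{2(L-l-l')}$ for $0\le l\le L$, $0\le l'\le L-l$, and let each sample average $E^{\rho_l}_{M_{ll'}}[h]$ (resp. $E^{\rho_{l-1}}_{M_{ll'}}[h]$) in the MLMCMC estimator be $\frac{1}{M_{ll'}}\sum_{k=1}^{M_{ll'}}h(u^{(k)})$ along an independence sampler chain with potential $\Phi_l$ (resp. $\Phi_{l-1}$) started at $u^{(0)}\sim\rho$. Let $\mathbf E_L$ denote expectation over the joint law of all these chains. Then there is $C(\delta)>0$ independent of $L$ such that for all $L\ge1$, $$\mathbf E_L\big[\,|\mathbb E^{\rho^\delta}[\ell(P)]-E^{MLMCMC}_L[\ell(P)]|\,\big]\le C(\delta)\,L^2\,2^{-L}.$$ Moreover, the total number of degrees of freedom $\sum_{l=0}^L\sum_{l'=0}^{L-l}M_{ll'}(2^{dl}+2^{dl'})$ is $O(L\,2^{2L})$ for $d=2$ and $O(2^{3L})$ for $d=3$, and the work measure $\sum_{l=0}^L\sum_{l'=0}^{L-l}M_{ll'}\big(l^{d-1}2^{dl}J_l+l'^{d-1}2^{dl'}J_{l'}\big)$ (the paper's bound on the number of floating point operations assuming linear-complexity solvers) is $O(L^{d-1}2^{(d+1/q)L})$.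
   Context: Setting: $D\subset\mathbb R^d$ bounded convex polyhedral domain with plane sides; $V:=H^1_0(D)$ with norm $\|\nabla\cdot\|_{L^2}$, $W:=H^2(D)\cap H^1_0(D)$; $U:=[-1,1]^{\mathbb N}$ with product $\sigma$-algebra and product uniform probability measure $\rho:=\bigotimes_{j\ge1}\frac{du_j}{2}$. $K(x,u):=\bar K(x)+\sum_{j\ge1}u_j\psi_j(x)$, $\bar K,\psi_j\in L^\infty(D)$. $P(\cdot,u)\in V$ is the weak solution of $-\nabla\cdot(K(\cdot,u)\nabla P)=f$, $P=0$ on $\partial D$. Assumption (A1): $\bar K_{\min}:=\operatorname{ess\,inf}\bar K>0$ and $\sum_j\|\psi_j\|_{L^\infty}\le\frac{\kappa}{1+\kappa}\bar K_{\min}$ for some $\kappa>0$. Assumption (A2): $\bar K,\psi_j\in W^{1,\infty}(D)$, $\sum_j\|\psi_j\|_{W^{1,\infty}(D)}<\infty$, and $\sum_{j>J}\|\psi_j\|_{L^\infty(D)}\le CJ^{-q}$ for all $J$, with constants $C,q>0$. Truncation/discretization: $K^J:=\bar K+\sum_{j\le J}u_j\psi_j$, $P^J(\cdot,u)$ the corresponding weak solution; $V^l$ is the continuous piecewise-linear finite element space on the mesh obtained from a regular simplicial triangulation $\mathcal T^0$ of $D$ by $l$ recursive subdivisions of each simplex into $2^d$ subsimplices; $P^{J,l}(\cdot,u)\in V^l$ is the Galerkin solution $\int_DK^J\nabla P^{J,l}\cdot\nabla\phi=\int_Df\phi$ for all $\phi\in V^l$. Assumption (A3): $\sup_{J,u}\|P^J(\cdot,u)\|_W<\infty$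 and $\|P^J(\cdot,u)-P^{J,l}(\cdot,u)\|_V\le C2^{-l}\|P^J(\cdot,u)\|_W$ for all $J,l,u$. Bayesian setting: observations $\mathcal O_1,\dots,\mathcal O_k\in V^*$, SPD covariance $\Sigma$, $|y|_\Sigma:=|\Sigma^{-1/2}y|$, data $\delta\in\mathbb R^k$; $\Phi(u;\delta):=\frac12|\delta-(\mathcal O_i(P(\cdot,u)))_i|_\Sigma^2$ and $\rho^\delta$ has $\rho$-density $\propto e^{-\Phi}$; $\Phi^{J,l}(u;\delta):=\frac12|\delta-(\mathcal O_i(P^{J,l}(\cdot,u)))_i|_\Sigma^2$ and $\rho^{J,l,\delta}$ has $\rho$-density $\propto e^{-\Phi^{J,l}}$. Multilevel notation: $\rho_l:=\rho^{J_l,l,\delta}$, $\Phi_l:=\Phi^{J_l,l}(\cdot;\delta)$, $P_{l'}:=P^{J_{l'},l'}$, $Q_{l'}:=\ell(P_{l'})-\ell(P_{l'-1})$, $D_l:=\exp(\Phi_l-\Phi_{l-1})$, with conventions $P_{-1}:=0$, $D_0:=0$, and all expectations and sample averages with respect to $\rho_{-1}$ equal to $0$. The MLMCMC estimator is $$E^{MLMCMC}_L[\ell(P)]:=\sum_{l=0}^L\sum_{l'=0}^{L'(l)}\Big(E^{\rho_l}_{M_{ll'}}\big[(1-D_l)Q_{l'}\big]+E^{\rho_l}_{M_{ll'}}[D_l-1]\cdot E^{\rho_{l-1}}_{M_{ll'}}[Q_{l'}]\Big).$$ Independence sampler for a measurable potential $\Psi:U\to[0,\infty)$: given $u^{(k)}$,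 draw $v^{(k)}\sim\rho$ and $w^{(k)}\sim\mathcal U[0,1]$ independently of each other and of the past; set $u^{(k+1)}:=v^{(k)}$ if $\min\{1,\exp(\Psi(u^{(k)})-\Psi(v^{(k)}))\}\ge w^{(k)}$, else $u^{(k+1)}:=u^{(k)}$. *)

theory Defs
  imports "HOL-Analysis.Analysis" "HOL-Probability.Probability" "HOL-Library.Landau_Symbols"
begin

definition L2fun :: "(real^'n) set \<Rightarrow> (real^'n \<Rightarrow> real) \<Rightarrow> bool" where
  "L2fun D g \<longleftrightarrow> g \<in> borel_measurable (lebesgue_on D) \<and> integrable (lebesgue_on D) (\<lambda>x. (g x)^2)"

definition Linf :: "(real^'n) set \<Rightarrow> (real^'n \<Rightarrow> real) \<Rightarrow> bool" where
  "Linf D g \<longleftrightarrow> g \<in> borel_measurable (lebesgue_on D) \<and> (\<exists>C. AE x in lebesgue_on D. \<bar>g x\<bar> \<le> C)"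

definition Linf_norm :: "(real^'n) set \<Rightarrow> (real^'n \<Rightarrow> real) \<Rightarrow> real" where
  "Linf_norm D g = real_of_ereal (esssup (lebesgue_on D) (\<lambda>x. ereal \<bar>g x\<bar>))"

definition ess_inf :: "(real^'n) set \<Rightarrow> (real^'n \<Rightarrow> real) \<Rightarrow> ereal" where
  "ess_inf D g = - esssup (lebesgue_on D) (\<lambda>x. - ereal (g x))"

definition L1loc :: "(real^'n) set \<Rightarrow> (real^'n \<Rightarrow> real) \<Rightarrow> bool" where
  "L1loc D g \<longleftrightarrow> g \<in> borel_measurable (lebesgue_on D) \<and>
     (\<forall>K. compact K \<and> K \<subseteq> D \<longrightarrow> integrable (lebesgue_on K) g)"

fun iter_pd :: "(real^'n \<Rightarrow> real) \<Rightarrow> 'n list \<Rightarrow> (real^'n \<Rightarrow> real)" where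
  "iter_pd \<phi> [] = \<phi>"
| "iter_pd \<phi> (i # is) = (\<lambda>x. frechet_derivative (iter_pd \<phi> is) (at x) (axis i 1))"

definition smooth_fun :: "(real^'n \<Rightarrow> real) \<Rightarrow> bool" where
  "smooth_fun \<phi> \<longleftrightarrow> (\<forall>is x. iter_pd \<phi> is differentiable (at x))"

definition test_fun :: "(real^'n) set \<Rightarrow> (real^'n \<Rightarrow> real) \<Rightarrow> bool" where
  "test_fun D \<phi> \<longleftrightarrow> smooth_fun \<phi> \<and> compact (closure {x. \<phi> x \<noteq> 0}) \<and> closure {x. \<phi> x \<noteq> 0} \<subseteq> D"

definition has_weak_partial :: "(real^'n) set \<Rightarrow> (real^'n \<Rightarrow> real) \<Rightarrow> 'n \<Rightarrow> (real^'n \<Rightarrow> real) \<Rightarrow> bool" where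
  "has_weak_partial D u i g \<longleftrightarrow> L1loc D u \<and> L1loc D g \<and>
     (\<forall>\<phi>. test_fun D \<phi> \<longrightarrow>
        (\<integral>x. u x * iter_pd \<phi> [i] x \<partial>lebesgue_on D) = - (\<integral>x. g x * \<phi> x \<partial>lebesgue_on D))"

definition wpd :: "(real^'n) set \<Rightarrow> (real^'n \<Rightarrow> real) \<Rightarrow> 'n \<Rightarrow> (real^'n \<Rightarrow> real)" where
  "wpd D u i = (SOME g. has_weak_partial D u i g)"

definition H1 :: "(real^'n) set \<Rightarrow> (real^'n \<Rightarrow> real) \<Rightarrow> bool" where
  "H1 D u \<longleftrightarrow> L2fun D u \<and> (\<forall>i. \<exists>g. has_weak_partial D u i g \<and> L2fun D g)"

definition H2 :: "(real^'n) set \<Rightarrow> (real^'n \<Rightarrow> real) \<Rightarrow> bool" where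
  "H2 D u \<longleftrightarrow> H1 D u \<and> (\<forall>i j. \<exists>g. has_weak_partial D (wpd D u i) j g \<and> L2fun D g)"

definition H1_norm :: "(real^'n) set \<Rightarrow> (real^'n \<Rightarrow> real) \<Rightarrow> real" where
  "H1_norm D u = sqrt ((\<integral>x. (u x)^2 \<partial>lebesgue_on D) + (\<Sum>i\<in>UNIV. \<integral>x. (wpd D u i x)^2 \<partial>lebesgue_on D))"

definition H2_norm :: "(real^'n) set \<Rightarrow> (real^'n \<Rightarrow> real) \<Rightarrow> real" where
  "H2_norm D u = sqrt ((H1_norm D u)^2 +
      (\<Sum>i\<in>UNIV. \<Sum>j\<in>UNIV. \<integral>x. (wpd D (wpd D u i) j x)^2 \<partial>lebesgue_on D))"

definition H10 :: "(real^'n) set \<Rightarrow> (real^'n \<Rightarrow> real) \<Rightarrow> bool" where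
  "H10 D u \<longleftrightarrow> H1 D u \<and>
     (\<exists>\<phi>. (\<forall>k. test_fun D (\<phi> k)) \<and> (\<lambda>k. H1_norm D (\<lambda>x. u x - \<phi> k x)) \<longlonglongrightarrow> 0)"

definition V_norm :: "(real^'n) set \<Rightarrow> (real^'n \<Rightarrow> real) \<Rightarrow> real" where
  "V_norm D u = sqrt (\<integral>x. (\<Sum>i\<in>UNIV. (wpd D u i x)^2) \<partial>lebesgue_on D)"

definition W_space :: "(real^'n) set \<Rightarrow> (real^'n \<Rightarrow> real) \<Rightarrow> bool" where
  "W_space D u \<longleftrightarrow> H2 D u \<and> H10 D u"

abbreviation W_norm :: "(real^'n) set \<Rightarrow> (real^'n \<Rightarrow> real) \<Rightarrow> real" where
  "W_norm \<equiv> H2_norm"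

definition W1inf :: "(real^'n) set \<Rightarrow> (real^'n \<Rightarrow> real) \<Rightarrow> bool" where
  "W1inf D g \<longleftrightarrow> Linf D g \<and> (\<forall>i. \<exists>h. has_weak_partial D g i h \<and> Linf D h)"

definition W1inf_norm :: "(real^'n) set \<Rightarrow> (real^'n \<Rightarrow> real) \<Rightarrow> real" where
  "W1inf_norm D g = Linf_norm D g + (\<Sum>i\<in>UNIV. Linf_norm D (wpd D g i))"

definition V_dual :: "(real^'n) set \<Rightarrow> ((real^'n \<Rightarrow> real) \<Rightarrow> real) \<Rightarrow> bool" where
  "V_dual D F \<longleftrightarrow>
     (\<forall>v w. H10 D v \<longrightarrow> H10 D w \<longrightarrow> F (\<lambda>x. v x + w x) = F v + F w) \<and>
     (\<forall>c v. H10 D v \<longrightarrow> F (\<lambda>x. c * v x) = c * F v) \<and>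
     (\<exists>C. \<forall>v. H10 D v \<longrightarrow> \<bar>F v\<bar> \<le> C * V_norm D v)"

definition a_form :: "(real^'n) set \<Rightarrow> (real^'n \<Rightarrow> real) \<Rightarrow> (real^'n \<Rightarrow> real) \<Rightarrow> (real^'n \<Rightarrow> real) \<Rightarrow> real" where
  "a_form D K p \<phi> = (\<integral>x. K x * (\<Sum>i\<in>UNIV. wpd D p i x * wpd D \<phi> i x) \<partial>lebesgue_on D)"

text \<open>weak solution in V of  -div(K grad p) = f, p = 0 on the boundary\<close>
definition weak_solution :: "(real^'n) set \<Rightarrow> (real^'n \<Rightarrow> real) \<Rightarrow> (real^'n \<Rightarrow> real) \<Rightarrow> (real^'n \<Rightarrow> real) \<Rightarrow> bool" where
  "weak_solution D K f p \<longleftrightarrow> H10 D p \<and>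
     (\<forall>\<phi>. H10 D \<phi> \<longrightarrow> a_form D K p \<phi> = (\<integral>x. f x * \<phi> x \<partial>lebesgue_on D))"

definition polyhedral_domain :: "(real^'n) set \<Rightarrow> bool" where
  "polyhedral_domain D \<longleftrightarrow> open D \<and> D \<noteq> {} \<and> bounded D \<and> convex D \<and> polytope (closure D)"

text \<open>A simplicial triangulation: a finite set of simplices, each given by its d+1 affinely
  independent vertices, covering the closure of D and conforming (two simplices meet in
  their common face).\<close>
definition triangulation :: "(real^'n) set \<Rightarrow> (real^'n) set set \<Rightarrow> bool" where
  "triangulation D T \<longleftrightarrow> finite T \<and> T \<noteq> {} \<and>
     (\<forall>S\<in>T. card S = CARD('n) + 1 \<and> \<not> affine_dependent S) \<and>
     (\<Union>S\<in>T. convex hull S) = closure D \<and>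
     (\<forall>S\<in>T. \<forall>S'\<in>T. convex hull S \<inter> convex hull S' = convex hull (S \<inter> S'))"

definition subdivision :: "(real^'n) set set \<Rightarrow> (real^'n) set set \<Rightarrow> bool" where
  "subdivision T T' \<longleftrightarrow> (\<exists>Ch. T' = (\<Union>S\<in>T. Ch S) \<and>
     (\<forall>S\<in>T. card (Ch S) = 2 ^ CARD('n) \<and>
        (\<Union>C\<in>Ch S. convex hull C) = convex hull S \<and>
        (\<forall>C\<in>Ch S. C \<subseteq> {midpoint a b | a b. a \<in> S \<and> b \<in> S})))"

definition mesh_hierarchy :: "(real^'n) set \<Rightarrow> (nat \<Rightarrow> (real^'n) set set) \<Rightarrow> bool" where
  "mesh_hierarchy D T \<longleftrightarrow> (\<forall>l. triangulation D (T l)) \<and> (\<forall>l. subdivision (T l) (T (Suc l)))"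

definition FE_space :: "(real^'n) set \<Rightarrow> (real^'n) set set \<Rightarrow> (real^'n \<Rightarrow> real) set" where
  "FE_space D T = {v. continuous_on (closure D) v \<and>
     (\<forall>S\<in>T. \<exists>a b. \<forall>x\<in>convex hull S. v x = a \<bullet> x + b) \<and> (\<forall>x\<in>frontier D. v x = 0)}"

definition galerkin_solution :: "(real^'n) set \<Rightarrow> (real^'n) set set \<Rightarrow> (real^'n \<Rightarrow> real) \<Rightarrow> (real^'n \<Rightarrow> real) \<Rightarrow> (real^'n \<Rightarrow> real) \<Rightarrow> bool" where
  "galerkin_solution D T K f p \<longleftrightarrow> p \<in> FE_space D T \<and>
     (\<forall>\<phi>\<in>FE_space D T. a_form D K p \<phi> = (\<integral>x. f x * \<phi> x \<partial>lebesgue_on D))"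

text \<open>Parameters u :: nat => real; index j (from 0) corresponds to the paper's j+1.\<close>
definition Ucube :: "(nat \<Rightarrow> real) set" where
  "Ucube = {u. \<forall>j. u j \<in> {-1..1}}"

definition Kfield :: "(real^'n \<Rightarrow> real) \<Rightarrow> (nat \<Rightarrow> real^'n \<Rightarrow> real) \<Rightarrow> (nat \<Rightarrow> real) \<Rightarrow> real^'n \<Rightarrow> real" where
  "Kfield Kbar \<psi> u x = Kbar x + (\<Sum>j. u j * \<psi> j x)"

definition KJ :: "(real^'n \<Rightarrow> real) \<Rightarrow> (nat \<Rightarrow> real^'n \<Rightarrow> real) \<Rightarrow> nat \<Rightarrow> (nat \<Rightarrow> real) \<Rightarrow> real^'n \<Rightarrow> real" where
  "KJ Kbar \<psi> J u x = Kbar x + (\<Sum>j<J. u j * \<psi> j x)"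

definition rho1 :: "real measure" where
  "rho1 = density (restrict_space lborel {-1..1}) (\<lambda>_. ennreal (1/2))"

definition unif01 :: "real measure" where
  "unif01 = restrict_space lborel {0..1}"

definition rho :: "(nat \<Rightarrow> real) measure" where
  "rho = PiM UNIV (\<lambda>_. rho1)"

definition SPD :: "real^'k^'k \<Rightarrow> bool" where
  "SPD S \<longleftrightarrow> transpose S = S \<and> (\<forall>x. x \<noteq> 0 \<longrightarrow> 0 < x \<bullet> (S *v x))"

definition misfit :: "real^'k^'k \<Rightarrow> real^'k \<Rightarrow> real^'k \<Rightarrow> real" where
  "misfit S \<delta> y = (1/2) * ((\<delta> - y) \<bullet> (matrix_inv S *v (\<delta> - y)))"

definition post_mean :: "((nat \<Rightarrow> real) \<Rightarrow> real) \<Rightarrow> ((nat \<Rightarrow> real) \<Rightarrow> real) \<Rightarrow> real" where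
  "post_mean Phi g = (\<integral>u. g u * exp (- Phi u) \<partial>rho) / (\<integral>u. exp (- Phi u) \<partial>rho)"

primrec isampler :: "((nat \<Rightarrow> real) \<Rightarrow> real) \<Rightarrow> (nat \<Rightarrow> real) \<Rightarrow> (nat \<Rightarrow> (nat \<Rightarrow> real) \<times> real) \<Rightarrow> nat \<Rightarrow> (nat \<Rightarrow> real)" where
  "isampler Psi u0 vw 0 = u0"
| "isampler Psi u0 vw (Suc k) =
     (let x = isampler Psi u0 vw k
      in if min 1 (exp (Psi x - Psi (fst (vw k)))) \<ge> snd (vw k) then fst (vw k) else x)"

text \<open>On probability space M: u0 ~ rho, (v_k, w_k) ~ rho x U[0,1], and u0, (v_0,w_0), (v_1,w_1), ...
  mutually independent (u0 is paired with the constant 0 only so that all variables share one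
  codomain type for indep_vars).\<close>
definition isampler_setup :: "'w measure \<Rightarrow> ('w \<Rightarrow> nat \<Rightarrow> real) \<Rightarrow> (nat \<Rightarrow> 'w \<Rightarrow> (nat \<Rightarrow> real) \<times> real) \<Rightarrow> bool" where
  "isampler_setup M u0 vw \<longleftrightarrow>
     u0 \<in> measurable M rho \<and> distr M rho u0 = rho \<and>
     (\<forall>k. vw k \<in> measurable M (rho \<Otimes>\<^sub>M unif01) \<and> distr M (rho \<Otimes>\<^sub>M unif01) (vw k) = rho \<Otimes>\<^sub>M unif01) \<and>
     prob_space.indep_vars M (\<lambda>_. rho \<Otimes>\<^sub>M unif01)
       (\<lambda>i. case i of None \<Rightarrow> (\<lambda>\<omega>. (u0 \<omega>, 0)) | Some k \<Rightarrow> vw k) UNIV"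

definition chain_avg :: "((nat \<Rightarrow> real) \<Rightarrow> real) \<Rightarrow> nat \<Rightarrow> (nat \<Rightarrow> real) \<Rightarrow> (nat \<Rightarrow> (nat \<Rightarrow> real) \<times> real) \<Rightarrow> ((nat \<Rightarrow> real) \<Rightarrow> real) \<Rightarrow> real" where
  "chain_avg Psi Mn u0 vw h = (\<Sum>k=1..Mn. h (isampler Psi u0 vw k)) / real Mn"

definition Jlev :: "real \<Rightarrow> nat \<Rightarrow> nat" where
  "Jlev q l = 2 ^ nat \<lceil>real l / q\<rceil>"

definition Mlev :: "nat \<Rightarrow> nat \<Rightarrow> nat \<Rightarrow> nat" where
  "Mlev L l l' = 2 ^ (2 * (L - l - l'))"

definition Dfac :: "(nat \<Rightarrow> (nat \<Rightarrow> real) \<Rightarrow> real) \<Rightarrow> nat \<Rightarrow> (nat \<Rightarrow> real) \<Rightarrow> real" where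
  "Dfac Phi l u = (if l = 0 then 0 else exp (Phi l u - Phi (l - 1) u))"

text \<open>Q_l = G_l - G_{l-1} with G_{-1} = 0\<close>
definition Qdiff :: "(nat \<Rightarrow> (nat \<Rightarrow> real) \<Rightarrow> real) \<Rightarrow> nat \<Rightarrow> (nat \<Rightarrow> real) \<Rightarrow> real" where
  "Qdiff G l u = (if l = 0 then G 0 u else G l u - G (l - 1) u)"

text \<open>The MLMCMC estimator. Chain (l,l',0) samples rho_l for the (1-D_l)Q_{l'} average,
  chain (l,l',1) samples rho_l for the D_l - 1 average, chain (l,l',2) samples rho_{l-1}
  for the Q_{l'} average (unused when l = 0).\<close>
definition mlmcmc_est :: "nat \<Rightarrow> (nat \<Rightarrow> (nat \<Rightarrow> real) \<Rightarrow> real) \<Rightarrow> (nat \<Rightarrow> (nat \<Rightarrow> real) \<Rightarrow> real)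
   \<Rightarrow> (nat \<Rightarrow> nat \<Rightarrow> nat \<Rightarrow> nat \<Rightarrow> real) \<Rightarrow> (nat \<Rightarrow> nat \<Rightarrow> nat \<Rightarrow> nat \<Rightarrow> (nat \<Rightarrow> real) \<times> real) \<Rightarrow> real" where
  "mlmcmc_est L Phi G u0 vw =
     (\<Sum>l\<le>L. \<Sum>l'\<le>L - l.
        chain_avg (Phi l) (Mlev L l l') (u0 l l' 0) (vw l l' 0) (\<lambda>u. (1 - Dfac Phi l u) * Qdiff G l' u)
      + chain_avg (Phi l) (Mlev L l l') (u0 l l' 1) (vw l l' 1) (\<lambda>u. Dfac Phi l u - 1)
        * (if l = 0 then 0 else chain_avg (Phi (l - 1)) (Mlev L l l') (u0 l l' 2) (vw l l' 2) (Qdiff G l')))"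

end

theory Submission
  imports Defs
begin

text \<open>
  Replacing the diffusion coefficient by its truncation, and then the weak solution by the Galerkin
  solution, changes every bounded functional of the solution by at most a multiple of \<open>2 ^ (- l)\<close> on
  level \<open>l\<close>, uniformly in the parameter: Galerkin orthogonality and Young's inequality control the
  change of coefficient, and the finite element error is a hypothesis. Since functionals are only
  bounded on \<open>H10\<close>, one must know that finite element functions lie in \<open>H10\<close>; a piecewise affine
  function is extended by zero, dilated about an interior point and mollified, and its gradient is
  reproduced exactly wherever it is locally affine.

  The independence sampler has a bounded potential, so a Doeblin minorisation contracts centred
  functions by a fixed factor and a chain of length \<open>M\<close> has mean error of order \<open>M powr (- 1/2)\<close> times
  the sup norm of the observable. The identity
  \<open>\<pi>\<^sub>l h - \<pi>\<^sub>l\<^sub>-\<^sub>1 h = \<pi>\<^sub>l ((1 - D\<^sub>l) h) + \<pi>\<^sub>l (D\<^sub>l - 1) * \<pi>\<^sub>l\<^sub>-\<^sub>1 h\<close> makes the expectation of the estimator telescope up to a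
  bias of order \<open>L * 2 ^ (- L)\<close>, and each of the roughly \<open>L\<^sup>2\<close> sample averages contributes an error of order
  \<open>2 ^ (- l) * 2 ^ (- l') * 2 ^ (- (L - l - l')) = 2 ^ (- L)\<close>.
\<close>

section \<open>Degrees of freedom and work\<close>

text \<open>Its constant depends on the potential only through a sup bound, which the uniform
  solution estimates supply for all levels at once. A product of two sample averages is handled by
  bounding one factor by its sup norm, so that only the mean error of each chain taken alone enters.
  Measurability in the parameter is proved rather than assumed: a Galerkin value depends
  continuously on the parameter, and the value at the exact solution is a pointwise limit of
  Galerkin values. Weak derivatives are picked by choice, so identities between gradients hold only
  almost everywhere, and the fundamental lemma of the calculus of variations must be in place before
  any energy estimate. Energy bounds on the truncated solutions come from the uniform
  \<open>W_norm\<close> bound.\<close>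

lemma Jlev_ge: "q > 0 \<Longrightarrow> 2 powr (real l / q) \<le> real (Jlev q l)"
proof -
  assume "q > 0"
  then have "real l / q \<le> real (nat \<lceil>real l / q\<rceil>)" by linarith
  then have "2 powr (real l / q) \<le> 2 powr real (nat \<lceil>real l / q\<rceil>)" by simp
  then show ?thesis by (simp add: Jlev_def powr_realpow)
qed

text \<open>Rounding the exponent up at most doubles the number of terms. The lower bound
  \<open>Jlev_ge\<close> serves to push the truncation error below \<open>2 powr (- real l)\<close>,
  the upper bound serves the work estimate.\<close>

lemma Jlev_le: "q > 0 \<Longrightarrow> real (Jlev q l) \<le> 2 * 2 powr (real l / q)"
proof -
  assume q: "q > 0"
  then have "0 \<le> real l / q" by simp
  then have "real (nat \<lceil>real l / q\<rceil>) \<le> real l / q + 1" by linarith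
  then have "2 powr real (nat \<lceil>real l / q\<rceil>) \<le> 2 powr (real l / q + 1)" by simp
  then show ?thesis by (simp add: Jlev_def powr_realpow powr_add)
qed

text \<open>In product form the sum over \<open>l'\<close> becomes a geometric series. The
  hypothesis keeps the truncated subtraction in \<open>Mlev\<close> exact.\<close>

lemma Mlev_real: "l + l' \<le> L \<Longrightarrow> real (Mlev L l l') = 4 ^ L * (1/4) ^ l * (1/4) ^ l'"
proof -
  assume "l + l' \<le> L"
  then obtain k where "L = l + l' + k" using le_Suc_ex by blast
  then show ?thesis
    by (simp add: Mlev_def power_mult power_add power_divide)
qed

lemma sum_quarter: "(\<Sum>l\<le>N. (1/4::real) ^ l) \<le> 4/3"
proof -
  have "(\<Sum>l\<le>N. (1/4::real) ^ l) = (1 - (1/4) ^ Suc N) / (1 - 1/4)"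
    by (subst sum_gp0) simp
  also have "\<dots> \<le> 1 / (1 - 1/4)" by (intro divide_right_mono) auto
  finally show ?thesis by simp
qed

lemma sum_geometric_le:
  assumes "r > (1::real)"
  shows "(\<Sum>l\<le>L. r ^ l) \<le> r / (r - 1) * r ^ L"
proof -
  have "(\<Sum>l\<le>L. r ^ l) = (r ^ Suc L - 1) / (r - 1)"
    using assms by (subst sum_gp0) (auto simp: divide_simps algebra_simps)
  also have "\<dots> \<le> r ^ Suc L / (r - 1)" using assms by (intro divide_right_mono) auto
  finally show ?thesis by simp
qed

text \<open>Both sides sum over the pairs with \<open>l + l' \<le> L\<close>, a region that is
  symmetric in its two coordinates.\<close>

lemma triangle_sum_swap:
  fixes f :: "nat \<Rightarrow> nat \<Rightarrow> 'a::comm_monoid_add"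
  shows "(\<Sum>l\<le>L. \<Sum>l'\<le>L - l. f l l') = (\<Sum>l\<le>L. \<Sum>l'\<le>L - l. f l' l)"
proof -
  have *: "(\<Sum>l\<le>L. \<Sum>l'\<le>L - l. g l l') = (\<Sum>(l,l')\<in>{(l,l'). l + l' \<le> L}. g l l')"
    for g :: "nat \<Rightarrow> nat \<Rightarrow> 'a"
  proof -
    have "(\<Sum>l\<le>L. \<Sum>l'\<le>L - l. g l l') = (\<Sum>(l,l')\<in>(SIGMA l:{..L}. {..L - l}). g l l')"
      by (simp add: sum.Sigma)
    also have "(SIGMA l:{..L}. {..L - l}) = {(l,l'). l + l' \<le> L}" by auto
    finally show ?thesis .
  qed
  show ?thesis unfolding *
    by (rule sum.reindex_bij_witness[where i = prod.swap and j = prod.swap]) auto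
qed

text \<open>\<open>Mlev\<close> is symmetric in its levels, so the two summands of the cost
  contribute equally, and the geometric series in \<open>l'\<close> is at most 4/3; hence the
  constant 8/3. The factor \<open>4 ^ l\<close> split off the weight cancels the decay of the sample
  size in \<open>l\<close>, and \<open>r\<close> is the growth that remains.\<close>

lemma weighted_level_sum_le:
  fixes w :: "nat \<Rightarrow> nat"
  assumes w: "\<And>l. l \<le> L \<Longrightarrow> real (w l) \<le> c * 4 ^ l * r ^ l" and c: "0 \<le> c" and r: "r > 0"
  shows "real (\<Sum>l\<le>L. \<Sum>l'\<le>L - l. Mlev L l l' * (w l + w l')) \<le> 8/3 * c * 4 ^ L * (\<Sum>l\<le>L. r ^ l)"
proof -
  have "real (\<Sum>l\<le>L. \<Sum>l'\<le>L - l. Mlev L l l' * (w l + w l')) =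
      (\<Sum>l\<le>L. \<Sum>l'\<le>L - l. real (Mlev L l l') * real (w l)) +
      (\<Sum>l\<le>L. \<Sum>l'\<le>L - l. real (Mlev L l l') * real (w l'))"
    by (simp add: sum.distrib[symmetric] distrib_left)
  also have "(\<Sum>l\<le>L. \<Sum>l'\<le>L - l. real (Mlev L l l') * real (w l')) =
      (\<Sum>l\<le>L. \<Sum>l'\<le>L - l. real (Mlev L l' l) * real (w l))"
    by (rule triangle_sum_swap)
  also have "\<dots> = (\<Sum>l\<le>L. \<Sum>l'\<le>L - l. real (Mlev L l l') * real (w l))"
    by (simp add: Mlev_def add.commute)
  finally have eq: "real (\<Sum>l\<le>L. \<Sum>l'\<le>L - l. Mlev L l l' * (w l + w l')) =
      2 * (\<Sum>l\<le>L. \<Sum>l'\<le>L - l. real (Mlev L l l') * real (w l))" by simp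
  have "(\<Sum>l'\<le>L - l. real (Mlev L l l') * real (w l)) \<le> c * 4 ^ L * r ^ l * (4/3)" if l: "l \<le> L" for l
  proof -
    have "(\<Sum>l'\<le>L - l. real (Mlev L l l') * real (w l)) \<le>
        (\<Sum>l'\<le>L - l. (4 ^ L * (1/4) ^ l * (1/4) ^ l') * (c * 4 ^ l * r ^ l))"
    proof (rule sum_mono)
      fix l' assume "l' \<in> {..L - l}"
      then have "real (Mlev L l l') = 4 ^ L * (1/4) ^ l * (1/4) ^ l'" using l by (intro Mlev_real) auto
      then show "real (Mlev L l l') * real (w l) \<le> (4 ^ L * (1/4) ^ l * (1/4) ^ l') * (c * 4 ^ l * r ^ l)"
        using w[OF l] by (simp add: mult_left_mono)
    qed
    also have "\<dots> = c * 4 ^ L * r ^ l * (\<Sum>l'\<le>L - l. (1/4) ^ l')"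
      by (simp add: sum_distrib_left power_divide mult_ac)
    also have "\<dots> \<le> c * 4 ^ L * r ^ l * (4/3)"
      using sum_quarter c r by (intro mult_left_mono) auto
    finally show ?thesis .
  qed
  then have "(\<Sum>l\<le>L. \<Sum>l'\<le>L - l. real (Mlev L l l') * real (w l)) \<le> (\<Sum>l\<le>L. c * 4 ^ L * r ^ l * (4/3))"
    by (intro sum_mono) auto
  also have "\<dots> = 4/3 * c * 4 ^ L * (\<Sum>l\<le>L. r ^ l)" unfolding sum_distrib_left by (simp add: mult_ac)
  finally show ?thesis unfolding eq by linarith
qed

text \<open>In two dimensions the cost per sample grows exactly as fast as the sample size decays,
  so \<open>r = 1\<close> and all \<open>L + 1\<close> levels cost the same; this is the origin of
  the factor \<open>L\<close>.\<close>

lemma dof_bigo_2: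
  "(\<lambda>L. real (\<Sum>l\<le>L. \<Sum>l'\<le>L - l. Mlev L l l' * (2 ^ (2 * l) + 2 ^ (2 * l')))) \<in> O(\<lambda>L. real L * 2 ^ (2 * L))"
proof (rule bigoI[of _ "16/3"], rule eventually_sequentiallyI[of 1])
  fix L :: nat assume L: "1 \<le> L"
  have "real (\<Sum>l\<le>L. \<Sum>l'\<le>L - l. Mlev L l l' * (2 ^ (2 * l) + 2 ^ (2 * l'))) \<le> 8/3 * 1 * 4 ^ L * (\<Sum>l\<le>L. 1 ^ l)"
    by (rule weighted_level_sum_le[where w = "\<lambda>l. 2 ^ (2 * l)"]) (auto simp: power_mult)
  also have "\<dots> \<le> 8/3 * 4 ^ L * (2 * real L)" using L by simp
  finally show "norm (real (\<Sum>l\<le>L. \<Sum>l'\<le>L - l. Mlev L l l' * (2 ^ (2 * l) + 2 ^ (2 * l'))))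
      \<le> 16/3 * norm (real L * 2 ^ (2 * L))"
    by (simp add: power_mult mult.commute[of "real L"] del: of_nat_sum)
qed

lemma dof_bigo_3:
  "(\<lambda>L. real (\<Sum>l\<le>L. \<Sum>l'\<le>L - l. Mlev L l l' * (2 ^ (3 * l) + 2 ^ (3 * l')))) \<in> O(\<lambda>L. 2 ^ (3 * L))"
proof (rule bigoI[of _ "16/3"], rule eventually_sequentiallyI[of 1])
  fix L :: nat assume L: "1 \<le> L"
  have 8: "(8::real) ^ l = 4 ^ l * 2 ^ l" for l :: nat by (simp flip: power_mult_distrib)
  have "real (\<Sum>l\<le>L. \<Sum>l'\<le>L - l. Mlev L l l' * (2 ^ (3 * l) + 2 ^ (3 * l'))) \<le> 8/3 * 1 * 4 ^ L * (\<Sum>l\<le>L. 2 ^ l)"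
    by (rule weighted_level_sum_le[where w = "\<lambda>l. 2 ^ (3 * l)"]) (auto simp: power_mult 8)
  also have "\<dots> \<le> 8/3 * 4 ^ L * (2 * 2 ^ L)" using sum_geometric_le[of 2 L] by simp
  also have "\<dots> = 16/3 * 2 ^ (3 * L)" by (simp add: power_mult 8)
  finally show "norm (real (\<Sum>l\<le>L. \<Sum>l'\<le>L - l. Mlev L l l' * (2 ^ (3 * l) + 2 ^ (3 * l'))))
      \<le> 16/3 * norm ((2::real) ^ (3 * L))"
    by (simp del: of_nat_sum)
qed

lemma work_bigo:
  assumes q: "q > 0" and d: "d \<ge> 2"
  shows "(\<lambda>L. real (\<Sum>l\<le>L. \<Sum>l'\<le>L - l. Mlev L l l' *
            (l ^ (d - 1) * 2 ^ (d * l) * Jlev q l + l' ^ (d - 1) * 2 ^ (d * l') * Jlev q l')))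
        \<in> O(\<lambda>L. real L ^ (d - 1) * 2 powr ((real d + 1 / q) * real L))"
proof -
  \<comment> \<open>Up to the polynomial and rounding factors, \<open>4 * r\<close> is the growth
    per level of the cost of one sample. Since \<open>d \<ge> 2\<close> and
    \<open>1 / q > 0\<close>, it exceeds 4, so the finest level dominates the geometric sum and no
    further power of \<open>L\<close> appears.\<close>
  define r where "r = 2 powr (real d + 1 / q - 2)"
  have "1 / q > 0" using q by simp
  then have "real d + 1 / q - 2 > 0" using d by linarith
  then have r: "r > 1" unfolding r_def by (simp add: less_powr_iff)
  have four: "4 ^ l * r ^ l = 2 powr ((real d + 1 / q) * real l)" for l :: nat
  proof -
    have "(4::real) ^ l = 2 powr (2 * real l)" by (simp add: powr_power[symmetric] powr_realpow[symmetric] powr_powr[symmetric])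
    moreover have "r ^ l = 2 powr ((real d + 1 / q - 2) * real l)"
      by (simp add: r_def powr_powr powr_realpow[symmetric])
    ultimately show ?thesis by (simp add: powr_add[symmetric] algebra_simps)
  qed
  show ?thesis
  proof (rule bigoI[of _ "16/3 * (r / (r - 1))"], rule eventually_sequentiallyI[of 1])
    fix L :: nat assume L: "1 \<le> L"
    have "real (\<Sum>l\<le>L. \<Sum>l'\<le>L - l. Mlev L l l' *
            (l ^ (d - 1) * 2 ^ (d * l) * Jlev q l + l' ^ (d - 1) * 2 ^ (d * l') * Jlev q l'))
        \<le> 8/3 * (2 * real L ^ (d - 1)) * 4 ^ L * (\<Sum>l\<le>L. r ^ l)"
    proof (rule weighted_level_sum_le[where w = "\<lambda>l. l ^ (d - 1) * 2 ^ (d * l) * Jlev q l"])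
      fix l assume l: "l \<le> L"
      have "real l ^ (d - 1) * (2 ^ (d * l) * real (Jlev q l)) \<le> real L ^ (d - 1) * (2 ^ (d * l) * (2 * 2 powr (real l / q)))"
        using l Jlev_le[OF q] by (intro mult_mono power_mono) auto
      also have "2 ^ (d * l) * (2 * 2 powr (real l / q)) = 2 * (4 ^ l * r ^ l)"
        unfolding four by (simp add: powr_realpow[symmetric] powr_add[symmetric] algebra_simps)
      finally show "real (l ^ (d - 1) * 2 ^ (d * l) * Jlev q l) \<le> 2 * real L ^ (d - 1) * 4 ^ l * r ^ l"
        by (simp add: mult_ac)
    qed (use r in auto)
    also have "\<dots> \<le> 8/3 * (2 * real L ^ (d - 1)) * 4 ^ L * (r / (r - 1) * r ^ L)"
      by (intro mult_left_mono sum_geometric_le r) auto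
    also have "\<dots> = 16/3 * (r / (r - 1)) * (real L ^ (d - 1) * (4 ^ L * r ^ L))" by simp
    finally show "norm (real (\<Sum>l\<le>L. \<Sum>l'\<le>L - l. Mlev L l l' *
            (l ^ (d - 1) * 2 ^ (d * l) * Jlev q l + l' ^ (d - 1) * 2 ^ (d * l') * Jlev q l')))
        \<le> 16/3 * (r / (r - 1)) * norm (real L ^ (d - 1) * 2 powr ((real d + 1 / q) * real L))"
      unfolding four by (simp del: of_nat_sum)
  qed
qed

section \<open>The independence sampler\<close>

lemma prob_space_rho1: "prob_space rho1"
proof
  have "emeasure rho1 (space rho1) = (\<integral>\<^sup>+x\<in>{-1..1::real}. ennreal (1/2) \<partial>restrict_space lborel {-1..1})"
    unfolding rho1_def by (subst emeasure_density) (auto simp: space_restrict_space sets_restrict_space)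
  also have "\<dots> = ennreal (1/2) * emeasure (restrict_space lborel {-1..1::real}) {-1..1}"
    by (subst nn_integral_cmult_indicator) (auto simp: sets_restrict_space)
  also have "emeasure (restrict_space lborel {-1..1::real}) {-1..1} = ennreal 2"
    by (subst emeasure_restrict_space) auto
  also have "ennreal (1/2) * ennreal 2 = 1" by (subst ennreal_mult[symmetric]) auto
  finally show "emeasure rho1 (space rho1) = 1" .
qed

lemma space_rho1: "space rho1 = {-1..1}"
  by (simp add: rho1_def space_restrict_space)

lemma sets_rho1: "sets rho1 = sets (restrict_space borel {-1..1})"
  by (simp add: rho1_def sets_restrict_space)

lemma prob_space_rho: "prob_space rho"
  unfolding rho_def by (intro prob_space_PiM prob_space_rho1)

lemma space_rho: "space rho = Ucube"
  by (auto simp: rho_def space_PiM space_rho1 Ucube_def PiE_def Pi_def)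

lemma prob_space_unif01: "prob_space unif01"
  by standard (simp add: unif01_def emeasure_restrict_space space_restrict_space)

lemma space_unif01: "space unif01 = {0..1}"
  by (simp add: unif01_def space_restrict_space)

lemma prob_space_proposal: "prob_space (rho \<Otimes>\<^sub>M unif01)"
proof -
  interpret r: prob_space rho by (rule prob_space_rho)
  interpret w: prob_space unif01 by (rule prob_space_unif01)
  interpret p: pair_prob_space rho unif01 ..
  show ?thesis by (rule p.prob_space_axioms)
qed

lemma measurable_unif01_borel [measurable]: "(\<lambda>w. w) \<in> borel_measurable unif01"
  by (simp add: unif01_def measurable_restrict_space1)

definition accept_prob :: "((nat \<Rightarrow> real) \<Rightarrow> real) \<Rightarrow> (nat \<Rightarrow> real) \<Rightarrow> (nat \<Rightarrow> real) \<Rightarrow> real" where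
  "accept_prob Psi x v = min 1 (exp (Psi x - Psi v))"

definition isampler_step :: "((nat \<Rightarrow> real) \<Rightarrow> real) \<Rightarrow> (nat \<Rightarrow> real) \<Rightarrow> (nat \<Rightarrow> real) \<times> real \<Rightarrow> nat \<Rightarrow> real" where
  "isampler_step Psi x z = (if accept_prob Psi x (fst z) \<ge> snd z then fst z else x)"

text \<open>The transition operator of the chain acting on observables: the conditional expectation
  of \<open>h\<close> at the next state, given the present state \<open>x\<close>.\<close>

definition isampler_op :: "((nat \<Rightarrow> real) \<Rightarrow> real) \<Rightarrow> ((nat \<Rightarrow> real) \<Rightarrow> real) \<Rightarrow> (nat \<Rightarrow> real) \<Rightarrow> real" where
  "isampler_op Psi h x = (\<integral>z. h (isampler_step Psi x z) \<partial>(rho \<Otimes>\<^sub>M unif01))"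

lemma isampler_Suc_step: "isampler Psi u0 vw (Suc k) = isampler_step Psi (isampler Psi u0 vw k) (vw k)"
  by (simp add: isampler_step_def accept_prob_def Let_def)

declare isampler.simps(2) [simp del]

text \<open>The state after \<open>n\<close> steps is a function of the start and the first
  \<open>n\<close> proposals alone. This is what separates it from the proposal of the next
  step.\<close>

lemma isampler_cong: "(\<And>k. k < n \<Longrightarrow> vw k = vw' k) \<Longrightarrow> isampler Psi u vw n = isampler Psi u vw' n"
  by (induction n) (auto simp: isampler_Suc_step)

lemma accept_prob_range: "0 \<le> accept_prob Psi x v" "accept_prob Psi x v \<le> 1"
  by (auto simp: accept_prob_def)

lemma integrable_bounded_prob:
  fixes f :: "'a \<Rightarrow> real"
  assumes "prob_space M" "f \<in> borel_measurable M" "\<And>x. x \<in> space M \<Longrightarrow> \<bar>f x\<bar> \<le> b"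
  shows "integrable M f"
proof -
  interpret prob_space M by fact
  show ?thesis using assms by (intro integrable_const_bound[where B = b]) auto
qed

lemma abs_integral_bounded_prob:
  fixes f :: "'a \<Rightarrow> real"
  assumes "prob_space M" "f \<in> borel_measurable M" "\<And>x. x \<in> space M \<Longrightarrow> \<bar>f x\<bar> \<le> b"
  shows "\<bar>\<integral>x. f x \<partial>M\<bar> \<le> b"
proof -
  interpret prob_space M by fact
  have i: "integrable M f" by (rule integrable_bounded_prob) fact+
  have "\<bar>\<integral>x. f x \<partial>M\<bar> \<le> (\<integral>x. \<bar>f x\<bar> \<partial>M)" by (rule integral_abs_bound)
  also have "\<dots> \<le> (\<integral>x. b \<partial>M)" using i assms by (intro integral_mono) auto
  finally show ?thesis by (simp add: prob_space)
qed

text \<open>The sup bound keeps acceptance probabilities away from zero. Every constant derived here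
  depends on the potential only through \<open>B\<close>, hence is the same on all levels once the
  potentials are uniformly bounded.\<close>

locale bounded_potential =
  fixes Psi :: "(nat \<Rightarrow> real) \<Rightarrow> real" and B :: real
  assumes Psi_meas [measurable]: "Psi \<in> borel_measurable rho"
    and Psi_bound: "\<And>u. u \<in> space rho \<Longrightarrow> \<bar>Psi u\<bar> \<le> B"
begin

sublocale rho: prob_space rho by (rule prob_space_rho)
sublocale unif: prob_space unif01 by (rule prob_space_unif01)
sublocale ru: pair_prob_space rho unif01 ..
sublocale rr: pair_prob_space rho rho ..

lemma accept_prob_measurable1 [measurable]:
  "x \<in> space rho \<Longrightarrow> (\<lambda>v. accept_prob Psi x v) \<in> borel_measurable rho"
  unfolding accept_prob_def by measurable

lemma isampler_step_measurable [measurable]: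
  "(\<lambda>p. isampler_step Psi (fst p) (snd p)) \<in> measurable (rho \<Otimes>\<^sub>M (rho \<Otimes>\<^sub>M unif01)) rho"
  unfolding isampler_step_def accept_prob_def by measurable

lemma isampler_step_measurable1 [measurable]:
  "x \<in> space rho \<Longrightarrow> isampler_step Psi x \<in> measurable (rho \<Otimes>\<^sub>M unif01) rho"
  unfolding isampler_step_def accept_prob_def by measurable

lemma exp_Psi_bounds: 
  "u \<in> space rho \<Longrightarrow> exp (- B) \<le> exp (- Psi u)" "u \<in> space rho \<Longrightarrow> exp (- Psi u) \<le> exp B"
  using Psi_bound[of u] by auto

lemma integrable_bounded: "h \<in> borel_measurable rho \<Longrightarrow> (\<And>u. u \<in> space rho \<Longrightarrow> \<bar>h u\<bar> \<le> b) \<Longrightarrow> integrable rho (h :: _ \<Rightarrow> real)"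
  by (rule integrable_bounded_prob[OF rho.prob_space_axioms])

lemma integrable_exp: "integrable rho (\<lambda>u. exp (- Psi u))"
  using exp_Psi_bounds by (intro integrable_bounded[where b = "exp B"]) auto

lemma norm_const_ge: "exp (- B) \<le> (\<integral>u. exp (- Psi u) \<partial>rho)"
proof -
  have "(\<integral>u. exp (- B) \<partial>rho) \<le> (\<integral>u. exp (- Psi u) \<partial>rho)"
    using exp_Psi_bounds by (intro integral_mono integrable_exp) auto
  then show ?thesis by (simp add: rho.prob_space)
qed

lemma norm_const_pos: "0 < (\<integral>u. exp (- Psi u) \<partial>rho)"
  using norm_const_ge exp_gt_zero[of "- B"] by linarith

lemma integrable_times_exp:
  assumes [measurable]: "h \<in> borel_measurable rho" and "\<And>u. u \<in> space rho \<Longrightarrow> \<bar>h u\<bar> \<le> b"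
  shows "integrable rho (\<lambda>u. h u * exp (- Psi u))"
  using exp_Psi_bounds assms(2)
  by (intro integrable_bounded[where b = "b * exp B"]) (auto simp: abs_mult intro!: mult_mono order_trans[OF abs_ge_zero assms(2)])

lemma post_mean_bound:
  assumes [measurable]: "h \<in> borel_measurable rho" and h: "\<And>u. u \<in> space rho \<Longrightarrow> \<bar>h u\<bar> \<le> b"
  shows "\<bar>post_mean Psi h\<bar> \<le> b"
proof -
  have "\<bar>\<integral>u. h u * exp (- Psi u) \<partial>rho\<bar> \<le> (\<integral>u. \<bar>h u * exp (- Psi u)\<bar> \<partial>rho)" by (rule integral_abs_bound)
  also have "\<dots> \<le> (\<integral>u. b * exp (- Psi u) \<partial>rho)"
    using h by (intro integral_mono integrable_abs integrable_times_exp[where b = b] integrable_mult_right integrable_exp)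
      (auto simp: abs_mult intro!: mult_right_mono)
  also have "\<dots> = b * (\<integral>u. exp (- Psi u) \<partial>rho)" by simp
  finally show ?thesis
    using norm_const_pos by (simp add: post_mean_def abs_div pos_divide_le_eq)
qed

lemma post_mean_diff:
  assumes "g \<in> borel_measurable rho" "\<And>u. u \<in> space rho \<Longrightarrow> \<bar>g u\<bar> \<le> a"
    and "h \<in> borel_measurable rho" "\<And>u. u \<in> space rho \<Longrightarrow> \<bar>h u\<bar> \<le> b"
  shows "post_mean Psi (\<lambda>u. g u - h u) = post_mean Psi g - post_mean Psi h"
  using integrable_times_exp[OF assms(1,2)] integrable_times_exp[OF assms(3,4)]
  by (simp add: post_mean_def left_diff_distrib diff_divide_distrib)

lemma post_mean_const: "post_mean Psi (\<lambda>u. c) = c"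
  using norm_const_pos by (simp add: post_mean_def)

text \<open>Fubini integrates out the uniform variable: acceptance means
  \<open>w \<in> {0..a}\<close> with \<open>a\<close> the acceptance probability, a set of measure
  \<open>a\<close>, and on the rest the old value \<open>h x\<close> is kept.\<close>

lemma isampler_op_eq:
  assumes x: "x \<in> space rho" and [measurable]: "h \<in> borel_measurable rho"
    and h: "\<And>u. u \<in> space rho \<Longrightarrow> \<bar>h u\<bar> \<le> b"
  shows "isampler_op Psi h x = (\<integral>v. accept_prob Psi x v * h v + (1 - accept_prob Psi x v) * h x \<partial>rho)"
proof -
  note [measurable] = x
  have m: "(\<lambda>z. h (isampler_step Psi x z)) \<in> borel_measurable (rho \<Otimes>\<^sub>M unif01)" by measurable
  have st: "isampler_step Psi x z \<in> space rho" if "z \<in> space (rho \<Otimes>\<^sub>M unif01)" for z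
    using measurable_space[OF isampler_step_measurable1[OF x] that] .
  have "integrable (rho \<Otimes>\<^sub>M unif01) (\<lambda>z. h (isampler_step Psi x z))"
    using h st by (intro integrable_bounded_prob[OF prob_space_proposal m, where b = b]) auto
  then have "isampler_op Psi h x = (\<integral>v. \<integral>w. h (isampler_step Psi x (v, w)) \<partial>unif01 \<partial>rho)"
    unfolding isampler_op_def by (subst ru.integral_fst'[symmetric]) auto
  also have "\<dots> = (\<integral>v. accept_prob Psi x v * h v + (1 - accept_prob Psi x v) * h x \<partial>rho)"
  proof (rule Bochner_Integration.integral_cong[OF refl])
    fix v assume v: "v \<in> space rho"
    let ?a = "accept_prob Psi x v"
    have a: "0 \<le> ?a" "?a \<le> 1" by (rule accept_prob_range)+
    have s: "{0..?a} \<in> sets unif01" using a by (auto simp: unif01_def sets_restrict_space_iff)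
    have "measure unif01 {0..?a} = ?a"
      using a by (simp add: unif01_def measure_restrict_space)
    then have ind: "(\<integral>w. indicator {0..?a} w \<partial>unif01) = ?a" using s by simp
    have "(\<integral>w. h (isampler_step Psi x (v, w)) \<partial>unif01) = (\<integral>w. indicator {0..?a} w * (h v - h x) + h x \<partial>unif01)"
      by (rule Bochner_Integration.integral_cong) (auto simp: isampler_step_def space_unif01 indicator_def)
    also have "\<dots> = ?a * (h v - h x) + h x"
    proof -
      have "integrable unif01 (\<lambda>w. indicator {0..?a} w * (h v - h x))"
        using s by (intro integrable_mult_left integrable_real_indicator) (auto simp: unif.emeasure_eq_measure)
      then show ?thesis using ind by (simp add: unif.prob_space)
    qed
    finally show "(\<integral>w. h (isampler_step Psi x (v, w)) \<partial>unif01) = ?a * h v + (1 - ?a) * h x"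
      by (simp add: algebra_simps)
  qed
  finally show ?thesis .
qed

lemma isampler_op_measurable [measurable]:
  assumes [measurable]: "h \<in> borel_measurable rho"
  shows "isampler_op Psi h \<in> borel_measurable rho"
proof -
  have "(\<lambda>x. \<integral>z. h (isampler_step Psi x z) \<partial>(rho \<Otimes>\<^sub>M unif01)) \<in> borel_measurable rho"
    by (rule ru.borel_measurable_lebesgue_integral) (simp add: split_beta')
  then show ?thesis by (simp add: isampler_op_def[abs_def])
qed

text \<open>Doeblin minorisation: the acceptance density dominates \<open>exp (- 4 * B)\<close> times the posterior density.\<close>
lemma isampler_op_contraction:
  assumes x: "x \<in> space rho" and [measurable]: "h \<in> borel_measurable rho"
    and h: "\<And>u. u \<in> space rho \<Longrightarrow> \<bar>h u\<bar> \<le> b" and h0: "post_mean Psi h = 0"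
  shows "\<bar>isampler_op Psi h x\<bar> \<le> (1 - exp (- 4 * B)) * b"
proof -
  note [measurable] = x
  define Z where "Z = (\<integral>u. exp (- Psi u) \<partial>rho)"
  define p where "p v = exp (- Psi v) / Z" for v
  define e where "e = exp (- 4 * B)"
  have Z: "exp (- B) \<le> Z" "0 < Z" unfolding Z_def using norm_const_ge norm_const_pos by auto
  have [measurable]: "p \<in> borel_measurable rho" unfolding p_def by measurable
  have ip: "integrable rho p" unfolding p_def using integrable_exp by simp
  have p1: "(\<integral>v. p v \<partial>rho) = 1" using Z by (simp add: p_def Z_def[symmetric])
  have ih: "integrable rho (\<lambda>v. p v * h v)"
    using integrable_times_exp[OF assms(2) h] by (simp add: p_def mult.commute)
  have ph: "(\<integral>v. p v * h v \<partial>rho) = 0"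
    using h0 by (simp add: p_def post_mean_def Z_def[symmetric] mult.commute)
  have b0: "0 \<le> b" using h[OF x] by linarith
  let ?a = "accept_prob Psi x"
  \<comment> \<open>The density satisfies \<open>p v \<le> exp (2 * B)\<close>, because the
    normalising constant is at least \<open>exp (- B)\<close>, while the acceptance probability is
    at least \<open>exp (- 2 * B)\<close>. The ratio of the two is the constant
    \<open>e\<close>.\<close>
  have dom: "e * p v \<le> ?a v" if v: "v \<in> space rho" for v
  proof -
    have "p v \<le> exp B / exp (- B)" unfolding p_def using exp_Psi_bounds(2)[OF v] Z by (intro frac_le) auto
    also have "\<dots> = exp (2 * B)" by (simp add: exp_minus field_simps flip: exp_add)
    finally have "e * p v \<le> e * exp (2 * B)" by (intro mult_left_mono) (auto simp: e_def)
    also have "\<dots> = exp (- 2 * B)" by (simp add: e_def flip: exp_add)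
    also have "\<dots> \<le> ?a v"
      using Psi_bound[OF x] Psi_bound[OF v] by (auto simp: accept_prob_def)
    finally show ?thesis .
  qed
  have ia: "integrable rho (\<lambda>v. ?a v * h v + (1 - ?a v) * h x)"
  proof (intro integrable_bounded[where b = "b + b"])
    fix v assume v: "v \<in> space rho"
    have "\<bar>?a v * h v\<bar> \<le> 1 * b" "\<bar>(1 - ?a v) * h x\<bar> \<le> 1 * b"
      unfolding abs_mult using h[OF v] h[OF x] accept_prob_range[of Psi x v] b0 by (intro mult_mono; auto)+
    then show "\<bar>?a v * h v + (1 - ?a v) * h x\<bar> \<le> b + b" by linarith
  qed measurable
  \<comment> \<open>Since \<open>h\<close> has posterior mean zero, the subtracted term integrates
    to zero. It lowers the weights \<open>?a v\<close> and \<open>1 - ?a v\<close>, which together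
    have mass one, by \<open>e * p v\<close>; they stay nonnegative and have total mass
    \<open>1 - e\<close>, the contraction factor.\<close>
  have eq: "isampler_op Psi h x = (\<integral>v. (?a v * h v + (1 - ?a v) * h x) - e * (p v * h v) \<partial>rho)"
    using ia ih ph by (simp add: isampler_op_eq[OF x assms(2) h])
  have "\<bar>isampler_op Psi h x\<bar> \<le> (\<integral>v. \<bar>(?a v * h v + (1 - ?a v) * h x) - e * (p v * h v)\<bar> \<partial>rho)"
    unfolding eq by (rule integral_abs_bound)
  also have "\<dots> \<le> (\<integral>v. b - e * b * p v \<partial>rho)"
  proof (rule integral_mono)
    fix v assume v: "v \<in> space rho"
    have "\<bar>(?a v * h v + (1 - ?a v) * h x) - e * (p v * h v)\<bar> = \<bar>(?a v - e * p v) * h v + (1 - ?a v) * h x\<bar>"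
      by (rule arg_cong[where f = abs]) (simp add: algebra_simps)
    also have "\<dots> \<le> \<bar>?a v - e * p v\<bar> * \<bar>h v\<bar> + \<bar>1 - ?a v\<bar> * \<bar>h x\<bar>"
      by (metis abs_mult abs_triangle_ineq)
    also have "\<dots> \<le> (?a v - e * p v) * b + (1 - ?a v) * b"
    proof -
      have a1: "\<bar>?a v - e * p v\<bar> = ?a v - e * p v" using dom[OF v] by linarith
      have a2: "\<bar>1 - ?a v\<bar> = 1 - ?a v" using accept_prob_range(2)[of Psi x v] by linarith
      have "0 \<le> ?a v - e * p v" "0 \<le> 1 - ?a v"
        using dom[OF v] accept_prob_range(2)[of Psi x v] by linarith+
      then show ?thesis
        unfolding a1 a2 by (intro add_mono mult_left_mono h v x)
    qed
    finally show "\<bar>(?a v * h v + (1 - ?a v) * h x) - e * (p v * h v)\<bar> \<le> b - e * b * p v"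
      by (simp add: algebra_simps)
  qed (use ia ih ip in auto)
  also have "\<dots> = (1 - e) * b" using ip p1 by (simp add: rho.prob_space algebra_simps)
  finally show ?thesis by (simp add: e_def)
qed

text \<open>Detailed balance: \<open>exp (- Psi x) * accept_prob Psi x v\<close> is symmetric in \<open>x\<close> and \<open>v\<close>.\<close>
lemma post_mean_isampler_op:
  assumes [measurable]: "h \<in> borel_measurable rho"
    and h: "\<And>u. u \<in> space rho \<Longrightarrow> \<bar>h u\<bar> \<le> b"
  shows "post_mean Psi (isampler_op Psi h) = post_mean Psi h"
proof -
  define m where "m x v = min (exp (- Psi x)) (exp (- Psi v))" for x v
  have [measurable]: "(\<lambda>z. m (fst z) (snd z)) \<in> borel_measurable (rho \<Otimes>\<^sub>M rho)"
    unfolding m_def by measurable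
  have macc: "exp (- Psi x) * accept_prob Psi x v = m x v" for x v
    unfolding m_def accept_prob_def by (subst min_mult_distrib_left) (simp flip: exp_add)
  let ?F = "\<lambda>x v. m x v * (h v - h x)"
  have Fint: "integrable (rho \<Otimes>\<^sub>M rho) (\<lambda>(x, v). ?F x v)"
  proof (rule integrable_bounded_prob[OF rr.prob_space_axioms, where b = "exp B * (b + b)"])
    show "(\<lambda>(x, v). ?F x v) \<in> borel_measurable (rho \<Otimes>\<^sub>M rho)" unfolding split_beta' by measurable
    fix z assume "z \<in> space (rho \<Otimes>\<^sub>M rho)"
    then obtain x v where z: "z = (x, v)" "x \<in> space rho" "v \<in> space rho" by (auto simp: space_pair_measure)
    have "\<bar>m x v\<bar> \<le> exp B" using exp_Psi_bounds(2)[OF z(2)] by (simp add: m_def min_def)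
    moreover have "\<bar>h v - h x\<bar> \<le> b + b" using h[OF z(2)] h[OF z(3)] by linarith
    ultimately have "\<bar>m x v\<bar> * \<bar>h v - h x\<bar> \<le> exp B * (b + b)" by (intro mult_mono) auto
    then show "\<bar>case z of (x, v) \<Rightarrow> ?F x v\<bar> \<le> exp B * (b + b)" by (simp add: z abs_mult)
  qed
  \<comment> \<open>The integrand is antisymmetric under exchange of \<open>x\<close> and
    \<open>v\<close>, so swapping the order of integration shows that the double integral equals its
    own negative.\<close>
  have "(\<integral>x. \<integral>v. ?F x v \<partial>rho \<partial>rho) = (\<integral>v. \<integral>x. ?F x v \<partial>rho \<partial>rho)"
    by (rule rr.Fubini_integral[OF Fint, symmetric])
  also have "\<dots> = (\<integral>v. \<integral>x. - ?F v x \<partial>rho \<partial>rho)"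
  proof (intro Bochner_Integration.integral_cong refl)
    fix v x show "?F x v = - ?F v x"
      unfolding m_def by (subst min.commute) (simp only: minus_mult_right minus_diff_eq)
  qed
  also have "\<dots> = - (\<integral>x. \<integral>v. ?F x v \<partial>rho \<partial>rho)" by simp
  finally have F0: "(\<integral>x. \<integral>v. ?F x v \<partial>rho \<partial>rho) = 0" by simp
  have iF: "integrable rho (\<lambda>x. \<integral>v. ?F x v \<partial>rho)"
    using rr.integrable_fst'[OF Fint] by simp
  have "(\<integral>x. isampler_op Psi h x * exp (- Psi x) \<partial>rho) = (\<integral>x. (\<integral>v. ?F x v \<partial>rho) + h x * exp (- Psi x) \<partial>rho)"
  proof (rule Bochner_Integration.integral_cong[OF refl])
    fix x assume x: "x \<in> space rho"
    note [measurable] = x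
    have i: "integrable rho (?F x)"
    proof (rule integrable_bounded[where b = "exp B * (b + b)"])
      show "?F x \<in> borel_measurable rho" unfolding m_def by measurable
      fix v assume v: "v \<in> space rho"
      have "\<bar>m x v\<bar> \<le> exp B" using exp_Psi_bounds(2)[OF x] by (simp add: m_def min_def)
      moreover have "\<bar>h v - h x\<bar> \<le> b + b" using h[OF x] h[OF v] by linarith
      ultimately have "\<bar>m x v\<bar> * \<bar>h v - h x\<bar> \<le> exp B * (b + b)" by (intro mult_mono) auto
      then show "\<bar>?F x v\<bar> \<le> exp B * (b + b)" by (simp add: abs_mult)
    qed
    have "isampler_op Psi h x * exp (- Psi x) =
        (\<integral>v. exp (- Psi x) * (accept_prob Psi x v * h v + (1 - accept_prob Psi x v) * h x) \<partial>rho)"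
      by (simp add: isampler_op_eq[OF x assms(1) h])
    also have "\<dots> = (\<integral>v. ?F x v + h x * exp (- Psi x) \<partial>rho)"
    proof (rule Bochner_Integration.integral_cong[OF refl])
      fix v show "exp (- Psi x) * (accept_prob Psi x v * h v + (1 - accept_prob Psi x v) * h x) = ?F x v + h x * exp (- Psi x)"
        unfolding macc[symmetric] by (simp add: algebra_simps)
    qed
    also have "\<dots> = (\<integral>v. ?F x v \<partial>rho) + h x * exp (- Psi x)"
      using i by (simp add: rho.prob_space)
    finally show "isampler_op Psi h x * exp (- Psi x) = (\<integral>v. ?F x v \<partial>rho) + h x * exp (- Psi x)" .
  qed
  also have "\<dots> = (\<integral>x. h x * exp (- Psi x) \<partial>rho)"
    using iF F0 integrable_times_exp[OF assms(1) h] by simp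
  finally show ?thesis by (simp add: post_mean_def)
qed

end

section \<open>Conditioning on the past and mean-square errors along the chain\<close>

context bounded_potential
begin

abbreviation proposal :: "((nat \<Rightarrow> real) \<times> real) measure" where
  "proposal \<equiv> rho \<Otimes>\<^sub>M unif01"

text \<open>\<open>None\<close> indexes the starting point and \<open>Some k\<close> the proposal of
  step \<open>k\<close>, so these are exactly the variables on which the first \<open>n\<close>
  states depend. An index type with an extra element puts the start and the proposals into one
  independent family.\<close>

abbreviation past :: "nat \<Rightarrow> nat option set" where
  "past n \<equiv> insert None (Some ` {..<n})"

abbreviation chain_fun :: "(nat option \<Rightarrow> (nat \<Rightarrow> real) \<times> real) \<Rightarrow> nat \<Rightarrow> nat \<Rightarrow> real" where
  "chain_fun z \<equiv> isampler Psi (fst (z None)) (\<lambda>k. z (Some k))"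

lemma chain_fun_measurable:
  "j \<le> n \<Longrightarrow> (\<lambda>z. chain_fun z j) \<in> measurable (PiM (past n) (\<lambda>_. proposal)) rho"
proof (induction j)
  case 0
  then show ?case by simp measurable
next
  case (Suc j)
  then have [measurable]: "(\<lambda>z. chain_fun z j) \<in> measurable (PiM (past n) (\<lambda>_. proposal)) rho" by simp
  have [measurable]: "(\<lambda>z. z (Some j)) \<in> measurable (PiM (past n) (\<lambda>_. proposal)) proposal"
    using Suc.prems by (intro measurable_component_singleton) auto
  have "(\<lambda>z. isampler_step Psi (fst (chain_fun z j, z (Some j))) (snd (chain_fun z j, z (Some j))))
      \<in> measurable (PiM (past n) (\<lambda>_. proposal)) rho"
    by (rule measurable_compose[OF _ isampler_step_measurable]) measurable
  then show ?case by (simp add: isampler_Suc_step)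
qed

text \<open>The proposal used in step \<open>n + 1\<close> is independent of the first \<open>n\<close> steps.\<close>
lemma markov_property:
  fixes M :: "'w measure"
  assumes M: "prob_space M" and su: "isampler_setup M u0 vw"
    and F [measurable]: "F \<in> borel_measurable (PiM (past n) (\<lambda>_. proposal))"
    and Fb: "\<And>z. z \<in> space (PiM (past n) (\<lambda>_. proposal)) \<Longrightarrow> \<bar>F z\<bar> \<le> c"
    and h [measurable]: "h \<in> borel_measurable rho" and hb: "\<And>u. u \<in> space rho \<Longrightarrow> \<bar>h u\<bar> \<le> b"
  defines "Y \<equiv> \<lambda>\<omega>. restrict (\<lambda>i. case i of None \<Rightarrow> (u0 \<omega>, 0) | Some k \<Rightarrow> vw k \<omega>) (past n)"
  shows "(\<integral>\<omega>. F (Y \<omega>) * h (isampler Psi (u0 \<omega>) (\<lambda>k. vw k \<omega>) (Suc n)) \<partial>M) =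
         (\<integral>\<omega>. F (Y \<omega>) * isampler_op Psi h (isampler Psi (u0 \<omega>) (\<lambda>k. vw k \<omega>) n) \<partial>M)"
proof -
  interpret M: prob_space M by fact
  let ?X = "\<lambda>i. case i of None \<Rightarrow> (\<lambda>\<omega>. (u0 \<omega>, 0)) | Some k \<Rightarrow> vw k"
  let ?N = "PiM (past n) (\<lambda>_. proposal)"
  let ?N1 = "PiM {Some n} (\<lambda>_. proposal)"
  define V where "V = (\<lambda>\<omega>. restrict (\<lambda>i. ?X i \<omega>) {Some n})"
  have iv: "M.indep_vars (\<lambda>_. proposal) ?X UNIV" and dv: "distr M proposal (vw n) = proposal"
    and [measurable]: "vw n \<in> measurable M proposal"
    using su by (auto simp: isampler_setup_def)
  have Yeq: "Y = (\<lambda>\<omega>. restrict (\<lambda>i. ?X i \<omega>) (past n))"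
    unfolding Y_def by (intro ext) (auto simp: restrict_def split: option.splits)
  \<comment> \<open>The index sets \<open>past n\<close> and \<open>{Some n}\<close> are disjoint,
    so the two subfamilies are independent and their joint law is a product, to which Fubini
    applies.\<close>
  have "M.indep_var ?N (\<lambda>\<omega>. restrict (\<lambda>i. ?X i \<omega>) (past n)) 
      (PiM {Some n} (\<lambda>_. proposal)) (\<lambda>\<omega>. restrict (\<lambda>i. ?X i \<omega>) {Some n})"
    by (rule M.indep_var_restrict[OF iv]) auto
  then have ind: "M.indep_var ?N Y ?N1 V" by (simp add: V_def Yeq)
  have [measurable]: "Y \<in> measurable M ?N" "V \<in> measurable M ?N1"
    using M.indep_var_rv1[OF ind] M.indep_var_rv2[OF ind] by auto
  interpret DY: prob_space "distr M ?N Y" by (rule M.prob_space_distr) measurable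
  interpret DV: prob_space "distr M ?N1 V" by (rule M.prob_space_distr) measurable
  interpret DYV: pair_prob_space "distr M ?N Y" "distr M ?N1 V" ..
  have joint: "distr M (?N \<Otimes>\<^sub>M ?N1) (\<lambda>\<omega>. (Y \<omega>, V \<omega>)) = distr M ?N Y \<Otimes>\<^sub>M distr M ?N1 V"
    using ind unfolding M.indep_var_distribution_eq by simp
  have chainY: "chain_fun (Y \<omega>) n = isampler Psi (u0 \<omega>) (\<lambda>k. vw k \<omega>) n" for \<omega>
    unfolding Y_def by (auto intro!: isampler_cong)
  have [measurable]: "(\<lambda>z. chain_fun z n) \<in> measurable ?N rho" by (rule chain_fun_measurable) simp
  have [measurable]: "(\<lambda>v. v (Some n)) \<in> measurable ?N1 proposal"
    by (rule measurable_component_singleton) simp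
  define G where "G = (\<lambda>p. F (fst p) * h (isampler_step Psi (chain_fun (fst p) n) (snd p (Some n))))"
  have stepm: "(\<lambda>p. isampler_step Psi (chain_fun (fst p) n) (snd p (Some n))) \<in> measurable (?N \<Otimes>\<^sub>M ?N1) rho"
    using measurable_compose[OF _ isampler_step_measurable, of "\<lambda>p. (chain_fun (fst p) n, snd p (Some n))" "?N \<Otimes>\<^sub>M ?N1"]
    by simp
  have [measurable]: "G \<in> borel_measurable (?N \<Otimes>\<^sub>M ?N1)"
    unfolding G_def using measurable_compose[OF stepm h] by measurable
  have Gm: "G \<in> borel_measurable (distr M ?N Y \<Otimes>\<^sub>M distr M ?N1 V)"
    by (subst measurable_cong_sets[OF sets_pair_measure_cong[OF sets_distr sets_distr] refl]) measurable
  have Gi: "integrable (distr M ?N Y \<Otimes>\<^sub>M distr M ?N1 V) G"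
  proof (rule integrable_bounded_prob[OF DYV.prob_space_axioms Gm, where b = "c * b"])
    fix p assume "p \<in> space (distr M ?N Y \<Otimes>\<^sub>M distr M ?N1 V)"
    then have p: "p \<in> space (?N \<Otimes>\<^sub>M ?N1)" by (simp add: space_pair_measure)
    then have "\<bar>F (fst p)\<bar> \<le> c" "\<bar>h (isampler_step Psi (chain_fun (fst p) n) (snd p (Some n)))\<bar> \<le> b"
      using Fb hb measurable_space[OF stepm p] by (auto simp: space_pair_measure)
    then show "\<bar>G p\<bar> \<le> c * b" unfolding G_def abs_mult by (intro mult_mono) auto
  qed
  \<comment> \<open>With the past frozen, the fresh proposal still has law
    \<open>rho \<Otimes>\<^sub>M unif01\<close>, so integrating it out gives the transition operator
    at the current state.\<close>
  have inner: "(\<integral>v. h (isampler_step Psi x (v (Some n))) \<partial>(distr M ?N1 V)) = isampler_op Psi h x"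
    if x: "x \<in> space rho" for x
  proof -
    have [measurable]: "isampler_step Psi x \<in> measurable proposal rho" by (rule isampler_step_measurable1[OF x])
    have "(\<integral>v. h (isampler_step Psi x (v (Some n))) \<partial>(distr M ?N1 V)) = (\<integral>\<omega>. h (isampler_step Psi x (V \<omega> (Some n))) \<partial>M)"
      by (rule integral_distr) measurable
    also have "\<dots> = (\<integral>\<omega>. h (isampler_step Psi x (vw n \<omega>)) \<partial>M)" by (simp add: V_def)
    also have "\<dots> = (\<integral>z. h (isampler_step Psi x z) \<partial>(distr M proposal (vw n)))"
      by (rule integral_distr[symmetric]) measurable
    finally show ?thesis by (simp add: dv isampler_op_def)
  qed
  have "(\<integral>\<omega>. F (Y \<omega>) * h (isampler Psi (u0 \<omega>) (\<lambda>k. vw k \<omega>) (Suc n)) \<partial>M) = (\<integral>\<omega>. G (Y \<omega>, V \<omega>) \<partial>M)"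
    by (simp add: G_def chainY isampler_Suc_step V_def)
  also have "\<dots> = (\<integral>p. G p \<partial>(distr M ?N Y \<Otimes>\<^sub>M distr M ?N1 V))"
    unfolding joint[symmetric] by (rule integral_distr[symmetric]) measurable
  also have "\<dots> = (\<integral>y. \<integral>z. G (y, z) \<partial>(distr M ?N1 V) \<partial>(distr M ?N Y))"
    using DYV.integral_fst'[OF Gi] by simp
  also have "\<dots> = (\<integral>y. F y * isampler_op Psi h (chain_fun y n) \<partial>(distr M ?N Y))"
    by (rule Bochner_Integration.integral_cong[OF refl])
      (simp add: G_def inner measurable_space[OF \<open>(\<lambda>z. chain_fun z n) \<in> measurable ?N rho\<close>])
  also have "\<dots> = (\<integral>\<omega>. F (Y \<omega>) * isampler_op Psi h (chain_fun (Y \<omega>) n) \<partial>M)"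
    by (rule integral_distr) measurable
  finally show ?thesis by (simp add: chainY)
qed

lemma isampler_measurable:
  assumes M: "prob_space M" and su: "isampler_setup M u0 vw"
  shows "(\<lambda>\<omega>. isampler Psi (u0 \<omega>) (\<lambda>k. vw k \<omega>) n) \<in> measurable M rho"
proof (induction n)
  case 0
  then show ?case using su by (simp add: isampler_setup_def)
next
  case (Suc n)
  have [measurable]: "vw n \<in> measurable M proposal" using su by (simp add: isampler_setup_def)
  from Suc show ?case
    using measurable_compose[OF _ isampler_step_measurable, of "\<lambda>\<omega>. (isampler Psi (u0 \<omega>) (\<lambda>k. vw k \<omega>) n, vw n \<omega>)" M]
    by (simp add: isampler_Suc_step)
qed

text \<open>An instance of \<open>markov_property\<close>: the functional of the past is the sum of
  \<open>g\<close> along the chain, which is bounded by \<open>n * s\<close>.\<close>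

lemma isampler_sum_step:
  fixes M :: "'w measure"
  assumes M: "prob_space M" and su: "isampler_setup M u0 vw"
    and g [measurable]: "g \<in> borel_measurable rho" and gb: "\<And>u. u \<in> space rho \<Longrightarrow> \<bar>g u\<bar> \<le> s"
    and h [measurable]: "h \<in> borel_measurable rho" and hb: "\<And>u. u \<in> space rho \<Longrightarrow> \<bar>h u\<bar> \<le> b"
  defines "X \<equiv> \<lambda>k \<omega>. isampler Psi (u0 \<omega>) (\<lambda>k. vw k \<omega>) k"
  shows "(\<integral>\<omega>. (\<Sum>k=1..n. g (X k \<omega>)) * h (X (Suc n) \<omega>) \<partial>M) =
         (\<integral>\<omega>. (\<Sum>k=1..n. g (X k \<omega>)) * isampler_op Psi h (X n \<omega>) \<partial>M)"
proof -
  let ?N = "PiM (past n) (\<lambda>_. proposal)"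
  let ?F = "\<lambda>z. \<Sum>k=1..n. g (chain_fun z k)"
  have m: "(\<lambda>z. chain_fun z k) \<in> measurable ?N rho" if "k \<in> {1..n}" for k
    using that by (intro chain_fun_measurable) auto
  have F: "?F \<in> borel_measurable ?N"
    by (intro borel_measurable_sum measurable_compose[OF m g])
  have Fb: "\<bar>?F z\<bar> \<le> real n * s" if z: "z \<in> space ?N" for z
  proof -
    have "\<bar>?F z\<bar> \<le> (\<Sum>k=1..n. \<bar>g (chain_fun z k)\<bar>)" by (rule sum_abs)
    also have "\<dots> \<le> (\<Sum>k=1..n. s)" by (intro sum_mono gb measurable_space[OF m z])
    finally show ?thesis by simp
  qed
  have *: "chain_fun (restrict (\<lambda>i. case i of None \<Rightarrow> (u0 \<omega>, 0) | Some k \<Rightarrow> vw k \<omega>) (past n)) k = X k \<omega>"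
    if "k \<in> {1..n}" for k \<omega>
    unfolding X_def using that by (auto intro!: isampler_cong)
  have *: "(\<Sum>k=1..n. g (chain_fun (restrict (\<lambda>i. case i of None \<Rightarrow> (u0 \<omega>, 0) | Some k \<Rightarrow> vw k \<omega>) (past n)) k))
      = (\<Sum>k=1..n. g (X k \<omega>))" for \<omega>
    by (rule sum.cong[OF refl]) (subst *, auto)
  have Xe: "isampler Psi (u0 \<omega>) (\<lambda>k. vw k \<omega>) k = X k \<omega>" for k \<omega> by (simp add: X_def)
  show ?thesis
    using markov_property[OF M su F Fb h hb] unfolding * Xe .
qed

text \<open>Conditioning on the past replaces \<open>h\<close> by \<open>isampler_op Psi h\<close>, whose sup norm is smaller by the factor
  \<open>1 - exp (- 4 * B)\<close>; the resulting recursion in \<open>n\<close> is closed by the bound \<open>s * b * exp (4 * B)\<close>.\<close>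
lemma isampler_cross_bound:
  fixes M :: "'w measure"
  assumes M: "prob_space M" and su: "isampler_setup M u0 vw"
    and g [measurable]: "g \<in> borel_measurable rho" and gb: "\<And>u. u \<in> space rho \<Longrightarrow> \<bar>g u\<bar> \<le> s"
    and "h \<in> borel_measurable rho" and "\<And>u. u \<in> space rho \<Longrightarrow> \<bar>h u\<bar> \<le> b"
    and "post_mean Psi h = 0" and "0 \<le> s" "0 \<le> b"
  defines "X \<equiv> \<lambda>k \<omega>. isampler Psi (u0 \<omega>) (\<lambda>k. vw k \<omega>) k"
  shows "\<bar>\<integral>\<omega>. (\<Sum>k=1..n. g (X k \<omega>)) * h (X (Suc n) \<omega>) \<partial>M\<bar> \<le> s * b * exp (4 * B)"
  using assms(5-9)
proof (induction n arbitrary: h b)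
  case 0
  then show ?case by simp
next
  case (Suc n)
  note h [measurable] = Suc.prems(1) and hb = Suc.prems(2)
  define e where "e = exp (- 4 * B)"
  have B0: "0 \<le> B"
    using Psi_bound rho.not_empty by (metis abs_ge_zero all_not_in_conv order_trans)
  have e: "0 < e" "e \<le> 1" using B0 by (auto simp: e_def)
  have inv_e: "exp (4 * B) = 1 / e" by (simp add: e_def exp_minus field_simps)
  let ?T = "isampler_op Psi h"
  have Xm [measurable]: "X k \<in> measurable M rho" for k
    unfolding X_def by (rule isampler_measurable[OF M su])
  have Xs: "\<omega> \<in> space M \<Longrightarrow> X k \<omega> \<in> space rho" for k \<omega> by (rule measurable_space[OF Xm])
  have Tb: "\<bar>?T u\<bar> \<le> (1 - e) * b" if "u \<in> space rho" for u
    unfolding e_def by (rule isampler_op_contraction[OF that h hb Suc.prems(3)])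
  have T0: "post_mean Psi ?T = 0" using post_mean_isampler_op[OF h hb] Suc.prems(3) by simp
  have b1: "0 \<le> (1 - e) * b" using e Suc.prems by simp
  have IH: "\<bar>\<integral>\<omega>. (\<Sum>k=1..n. g (X k \<omega>)) * ?T (X (Suc n) \<omega>) \<partial>M\<bar> \<le> s * ((1 - e) * b) * exp (4 * B)"
    by (rule Suc.IH[OF _ Tb T0 Suc.prems(4) b1]) measurable
  have gs: "\<bar>\<Sum>k=1..n. g (X k \<omega>)\<bar> \<le> real n * s" if "\<omega> \<in> space M" for \<omega>
  proof -
    have "\<bar>\<Sum>k=1..n. g (X k \<omega>)\<bar> \<le> (\<Sum>k=1..n. \<bar>g (X k \<omega>)\<bar>)" by (rule sum_abs)
    also have "\<dots> \<le> (\<Sum>k=1..n. s)" using that by (intro sum_mono gb Xs)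
    finally show ?thesis by simp
  qed
  have i1: "integrable M (\<lambda>\<omega>. (\<Sum>k=1..n. g (X k \<omega>)) * ?T (X (Suc n) \<omega>))"
    using gs Tb[OF Xs] b1 by (intro integrable_bounded_prob[OF M, where b = "real n * s * ((1 - e) * b)"])
      (auto simp: abs_mult intro!: mult_mono mult_nonneg_nonneg Suc.prems)
  have i2b: "\<bar>g (X (Suc n) \<omega>) * ?T (X (Suc n) \<omega>)\<bar> \<le> s * ((1 - e) * b)" if "\<omega> \<in> space M" for \<omega>
    unfolding abs_mult using gb[OF Xs[OF that]] Tb[OF Xs[OF that]] Suc.prems b1 by (intro mult_mono) auto
  have i2: "integrable M (\<lambda>\<omega>. g (X (Suc n) \<omega>) * ?T (X (Suc n) \<omega>))"
    by (rule integrable_bounded_prob[OF M _ i2b]) measurable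
  have "(\<integral>\<omega>. (\<Sum>k=1..Suc n. g (X k \<omega>)) * h (X (Suc (Suc n)) \<omega>) \<partial>M) =
      (\<integral>\<omega>. (\<Sum>k=1..Suc n. g (X k \<omega>)) * ?T (X (Suc n) \<omega>) \<partial>M)"
    using isampler_sum_step[OF M su g gb h hb, of "Suc n"] by (simp add: X_def)
  also have "\<dots> = (\<integral>\<omega>. (\<Sum>k=1..n. g (X k \<omega>)) * ?T (X (Suc n) \<omega>) + g (X (Suc n) \<omega>) * ?T (X (Suc n) \<omega>) \<partial>M)"
    by (simp add: distrib_right)
  also have "\<dots> = (\<integral>\<omega>. (\<Sum>k=1..n. g (X k \<omega>)) * ?T (X (Suc n) \<omega>) \<partial>M) + (\<integral>\<omega>. g (X (Suc n) \<omega>) * ?T (X (Suc n) \<omega>) \<partial>M)"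
    by (rule Bochner_Integration.integral_add[OF i1 i2])
  finally have eq: "(\<integral>\<omega>. (\<Sum>k=1..Suc n. g (X k \<omega>)) * h (X (Suc (Suc n)) \<omega>) \<partial>M) =
      (\<integral>\<omega>. (\<Sum>k=1..n. g (X k \<omega>)) * ?T (X (Suc n) \<omega>) \<partial>M) + (\<integral>\<omega>. g (X (Suc n) \<omega>) * ?T (X (Suc n) \<omega>) \<partial>M)" .
  have "\<bar>\<integral>\<omega>. g (X (Suc n) \<omega>) * ?T (X (Suc n) \<omega>) \<partial>M\<bar> \<le> s * ((1 - e) * b)"
    by (rule abs_integral_bounded_prob[OF M _ i2b]) measurable
  then have "\<bar>\<integral>\<omega>. (\<Sum>k=1..Suc n. g (X k \<omega>)) * h (X (Suc (Suc n)) \<omega>) \<partial>M\<bar>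
      \<le> s * ((1 - e) * b) * (1 / e) + s * ((1 - e) * b)"
    unfolding eq using IH by (simp add: inv_e)
  \<comment> \<open>The factor is \<open>(1 - e^2) / e\<close>, again at most \<open>1 / e\<close>.
    This is the value of the geometric series of the powers of \<open>1 - e\<close>, so the bound
    does not grow with \<open>n\<close>.\<close>
  also have "\<dots> = s * b * ((1 - e) * (1 + e) / e)" using e by (simp add: field_simps)
  also have "\<dots> \<le> s * b * (1 / e)"
    using e Suc.prems by (intro mult_left_mono divide_right_mono) (auto simp: algebra_simps)
  finally show ?case by (simp add: inv_e)
qed

text \<open>Extending the sum by one state adds the square of the new value, at most
  \<open>s^2\<close>, and twice its correlation with the past, which
  \<open>isampler_cross_bound\<close> controls uniformly in \<open>n\<close>. Hence the second
  moment grows linearly, as for independent samples.\<close>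

lemma isampler_second_moment:
  fixes M :: "'w measure"
  assumes M: "prob_space M" and su: "isampler_setup M u0 vw"
    and g [measurable]: "g \<in> borel_measurable rho" and gb: "\<And>u. u \<in> space rho \<Longrightarrow> \<bar>g u\<bar> \<le> s"
    and g0: "post_mean Psi g = 0" and s: "0 \<le> s"
  defines "X \<equiv> \<lambda>k \<omega>. isampler Psi (u0 \<omega>) (\<lambda>k. vw k \<omega>) k"
  shows "(\<integral>\<omega>. (\<Sum>k=1..n. g (X k \<omega>))\<^sup>2 \<partial>M) \<le> real n * (s\<^sup>2 * (1 + 2 * exp (4 * B)))"
proof (induction n)
  case 0
  then show ?case by simp
next
  case (Suc n)
  have Xm [measurable]: "X k \<in> measurable M rho" for k
    unfolding X_def by (rule isampler_measurable[OF M su])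
  have Xs: "\<omega> \<in> space M \<Longrightarrow> X k \<omega> \<in> space rho" for k \<omega> by (rule measurable_space[OF Xm])
  let ?S = "\<lambda>\<omega>. \<Sum>k=1..n. g (X k \<omega>)"
  let ?g = "\<lambda>\<omega>. g (X (Suc n) \<omega>)"
  have Sb: "\<bar>?S \<omega>\<bar> \<le> real n * s" if "\<omega> \<in> space M" for \<omega>
  proof -
    have "\<bar>?S \<omega>\<bar> \<le> (\<Sum>k=1..n. \<bar>g (X k \<omega>)\<bar>)" by (rule sum_abs)
    also have "\<dots> \<le> (\<Sum>k=1..n. s)" using that by (intro sum_mono gb Xs)
    finally show ?thesis by simp
  qed
  have gb': "\<bar>?g \<omega>\<bar> \<le> s" if "\<omega> \<in> space M" for \<omega> by (rule gb[OF Xs[OF that]])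
  have i1: "integrable M (\<lambda>\<omega>. (?S \<omega>)\<^sup>2)"
    by (rule integrable_bounded_prob[OF M, where b = "(real n * s)\<^sup>2"])
      (use power_mono[OF Sb, of _ 2] in \<open>auto simp: power_abs[symmetric]\<close>)
  have i2: "integrable M (\<lambda>\<omega>. ?S \<omega> * ?g \<omega>)"
    by (rule integrable_bounded_prob[OF M, where b = "real n * s * s"])
      (use Sb gb' s in \<open>auto simp: abs_mult intro!: mult_mono\<close>)
  have i3b: "\<bar>(?g \<omega>)\<^sup>2\<bar> \<le> s\<^sup>2" if "\<omega> \<in> space M" for \<omega>
    using power_mono[OF gb'[OF that], of 2] by simp
  have i3: "integrable M (\<lambda>\<omega>. (?g \<omega>)\<^sup>2)"
    by (rule integrable_bounded_prob[OF M _ i3b]) measurable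
  have "(\<integral>\<omega>. (\<Sum>k=1..Suc n. g (X k \<omega>))\<^sup>2 \<partial>M) = (\<integral>\<omega>. (?S \<omega>)\<^sup>2 + 2 * (?S \<omega> * ?g \<omega>) + (?g \<omega>)\<^sup>2 \<partial>M)"
    by (simp add: power2_sum algebra_simps)
  also have "\<dots> = (\<integral>\<omega>. (?S \<omega>)\<^sup>2 \<partial>M) + 2 * (\<integral>\<omega>. ?S \<omega> * ?g \<omega> \<partial>M) + (\<integral>\<omega>. (?g \<omega>)\<^sup>2 \<partial>M)"
    using i1 i2 i3 by simp
  finally have eq: "(\<integral>\<omega>. (\<Sum>k=1..Suc n. g (X k \<omega>))\<^sup>2 \<partial>M) =
      (\<integral>\<omega>. (?S \<omega>)\<^sup>2 \<partial>M) + 2 * (\<integral>\<omega>. ?S \<omega> * ?g \<omega> \<partial>M) + (\<integral>\<omega>. (?g \<omega>)\<^sup>2 \<partial>M)" .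
  have c: "\<bar>\<integral>\<omega>. ?S \<omega> * ?g \<omega> \<partial>M\<bar> \<le> s * s * exp (4 * B)"
    unfolding X_def by (rule isampler_cross_bound[OF M su g gb g gb g0 s s])
  have "\<bar>\<integral>\<omega>. (?g \<omega>)\<^sup>2 \<partial>M\<bar> \<le> s\<^sup>2"
    by (rule abs_integral_bounded_prob[OF M _ i3b]) measurable
  then have "(\<integral>\<omega>. (\<Sum>k=1..Suc n. g (X k \<omega>))\<^sup>2 \<partial>M) \<le>
      real n * (s\<^sup>2 * (1 + 2 * exp (4 * B))) + 2 * (s * s * exp (4 * B)) + s\<^sup>2"
    unfolding eq using c Suc.IH by linarith
  also have "\<dots> = real (Suc n) * (s\<^sup>2 * (1 + 2 * exp (4 * B)))"
    by (simp add: algebra_simps power2_eq_square)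
  finally show ?case .
qed

lemma chain_avg_measurable:
  assumes "prob_space M" "isampler_setup M u0 vw" and g [measurable]: "g \<in> borel_measurable rho"
  shows "(\<lambda>\<omega>. chain_avg Psi n (u0 \<omega>) (\<lambda>k. vw k \<omega>) g) \<in> borel_measurable M"
proof -
  have [measurable]: "(\<lambda>\<omega>. isampler Psi (u0 \<omega>) (\<lambda>k. vw k \<omega>) k) \<in> measurable M rho" for k
    by (rule isampler_measurable) fact+
  show ?thesis unfolding chain_avg_def by measurable
qed

lemma chain_avg_bound:
  assumes "prob_space M" "isampler_setup M u0 vw"
    and gb: "\<And>u. u \<in> space rho \<Longrightarrow> \<bar>g u\<bar> \<le> b" and "\<omega> \<in> space M" "n \<ge> 1"
  shows "\<bar>chain_avg Psi n (u0 \<omega>) (\<lambda>k. vw k \<omega>) g\<bar> \<le> b"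
proof -
  have "\<bar>\<Sum>k=1..n. g (isampler Psi (u0 \<omega>) (\<lambda>k. vw k \<omega>) k)\<bar> \<le> (\<Sum>k=1..n. \<bar>g (isampler Psi (u0 \<omega>) (\<lambda>k. vw k \<omega>) k)\<bar>)"
    by (rule sum_abs)
  also have "\<dots> \<le> (\<Sum>k=1..n. b)"
    using assms by (intro sum_mono gb measurable_space[OF isampler_measurable])
  finally show ?thesis using \<open>n \<ge> 1\<close> by (simp add: chain_avg_def field_simps)
qed

text \<open>Centring the observable at its posterior mean at most doubles its sup norm, whence the
  factor 2; the mean absolute error is then controlled by the root mean square.\<close>

lemma chain_avg_error:
  fixes M :: "'w measure"
  assumes M: "prob_space M" and su: "isampler_setup M u0 vw"
    and g [measurable]: "g \<in> borel_measurable rho" and gb: "\<And>u. u \<in> space rho \<Longrightarrow> \<bar>g u\<bar> \<le> b"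
    and b: "0 < b" and n: "n \<ge> 1"
  shows "(\<integral>\<omega>. \<bar>chain_avg Psi n (u0 \<omega>) (\<lambda>k. vw k \<omega>) g - post_mean Psi g\<bar> \<partial>M)
      \<le> 2 * sqrt (1 + 2 * exp (4 * B)) * b / sqrt (real n)"
proof -
  interpret M: prob_space M by fact
  define K where "K = 1 + 2 * exp (4 * B)"
  have K: "K > 0" by (simp add: K_def add_pos_pos)
  define X where "X = (\<lambda>k \<omega>. isampler Psi (u0 \<omega>) (\<lambda>k. vw k \<omega>) k)"
  define m where "m = post_mean Psi g"
  have mb: "\<bar>m\<bar> \<le> b" unfolding m_def by (rule post_mean_bound[OF g gb])
  define c where "c u = g u - m" for u
  have cm [measurable]: "c \<in> borel_measurable rho" unfolding c_def by measurable
  have cb: "\<bar>c u\<bar> \<le> 2 * b" if "u \<in> space rho" for u using gb[OF that] mb unfolding c_def by linarith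
  have c0: "post_mean Psi c = 0"
    unfolding c_def using post_mean_diff[OF g gb, of "\<lambda>_. m" "\<bar>m\<bar>"] by (simp add: post_mean_const m_def)
  define A where "A \<omega> = (\<Sum>k=1..n. c (X k \<omega>)) / real n" for \<omega>
  have Aeq: "chain_avg Psi n (u0 \<omega>) (\<lambda>k. vw k \<omega>) g - m = A \<omega>" for \<omega>
    using n by (simp add: chain_avg_def A_def X_def c_def sum_subtractf diff_divide_distrib)
  have [measurable]: "X k \<in> measurable M rho" for k unfolding X_def by (rule isampler_measurable[OF M su])
  have [measurable]: "A \<in> borel_measurable M" unfolding A_def by measurable
  have Ab: "\<bar>A \<omega>\<bar> \<le> 2 * b" if "\<omega> \<in> space M" for \<omega>
    using chain_avg_bound[OF M su cb that n] by (simp add: A_def X_def chain_avg_def)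
  have iA: "integrable M A" by (rule integrable_bounded_prob[OF M _ Ab]) measurable
  have iA2: "integrable M (\<lambda>\<omega>. (A \<omega>)\<^sup>2)"
    by (rule integrable_bounded_prob[OF M, where b = "(2 * b)\<^sup>2"])
      (use power_mono[OF Ab, of _ 2] in \<open>auto simp: power_abs[symmetric]\<close>)
  have "(\<integral>\<omega>. (\<Sum>k=1..n. c (X k \<omega>))\<^sup>2 \<partial>M) \<le> real n * ((2 * b)\<^sup>2 * K)"
    unfolding X_def K_def using b by (intro isampler_second_moment[OF M su cm cb c0]) auto
  then have EA2: "(\<integral>\<omega>. (A \<omega>)\<^sup>2 \<partial>M) \<le> (2 * b)\<^sup>2 * K / real n"
    using n by (simp add: A_def power_divide field_simps power2_eq_square)
  \<comment> \<open>\<open>t\<close> is the bound on the root mean square. The pointwise inequality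
    \<open>\<bar>a\<bar> \<le> a^2 / (2 * t) + t / 2\<close> plays the part of the Cauchy-Schwarz
    inequality; dividing by \<open>t\<close> is legitimate because \<open>b > 0\<close>.\<close>
  define t where "t = 2 * b * sqrt K / sqrt (real n)"
  have t: "t > 0" "t\<^sup>2 = (2 * b)\<^sup>2 * K / real n"
    using b K n by (auto simp: t_def power_mult_distrib power_divide)
  have "\<bar>a\<bar> \<le> a\<^sup>2 / (2 * t) + t / 2" for a
  proof -
    have "0 \<le> (\<bar>a\<bar> - t)\<^sup>2 / (2 * t)" using t by simp
    then show ?thesis using t by (simp add: power2_diff field_simps power2_eq_square)
  qed
  then have "(\<integral>\<omega>. \<bar>A \<omega>\<bar> \<partial>M) \<le> (\<integral>\<omega>. (A \<omega>)\<^sup>2 / (2 * t) + t / 2 \<partial>M)"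
    using iA iA2 by (intro integral_mono) auto
  also have "\<dots> = (\<integral>\<omega>. (A \<omega>)\<^sup>2 \<partial>M) / (2 * t) + t / 2" using iA2 by (simp add: M.prob_space)
  also have "\<dots> \<le> t\<^sup>2 / (2 * t) + t / 2" using EA2 t by (intro add_right_mono divide_right_mono) auto
  also have "\<dots> = t" using t(1) by (simp add: power2_eq_square)
  finally show ?thesis by (simp add: Aeq[symmetric] m_def t_def K_def mult_ac)
qed

end

section \<open>The multilevel estimator\<close>

lemma abs_exp_minus_one_le:
  fixes x :: real assumes "\<bar>x\<bar> \<le> a" shows "\<bar>exp x - 1\<bar> \<le> exp a * \<bar>x\<bar>"
proof (cases "x \<ge> 0")
  case True
  have "1 - x \<le> exp (- x)" using exp_ge_add_one_self[of "- x"] by simp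
  then have "exp x * (1 - x) \<le> exp x * exp (- x)" by (intro mult_left_mono) auto
  then have "exp x - 1 \<le> exp x * x" by (simp add: algebra_simps flip: exp_add)
  also have "\<dots> \<le> exp a * x" using True assms by (intro mult_right_mono) auto
  finally show ?thesis using True by simp
next
  case False
  have "1 + x \<le> exp x" by (rule exp_ge_add_one_self)
  then have "1 - exp x \<le> \<bar>x\<bar>" by linarith
  also have "\<dots> \<le> exp a * \<bar>x\<bar>" using assms order_trans[OF abs_ge_zero assms] by (simp add: mult_le_cancel_right1)
  finally show ?thesis using False by simp
qed

text \<open>The factor \<open>exp (Phi u - Psi u)\<close> turns the weight
  \<open>exp (- Phi u)\<close> into \<open>exp (- Psi u)\<close>. The unknown ratio of the
  normalising constants thus appears only as a mean under \<open>Phi\<close>, which a chain can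
  estimate.\<close>

lemma post_mean_change:
  assumes "bounded_potential Phi B" "bounded_potential Psi B"
    and h [measurable]: "h \<in> borel_measurable rho" and hb: "\<And>u. u \<in> space rho \<Longrightarrow> \<bar>h u\<bar> \<le> b"
  shows "post_mean Phi h - post_mean Psi h =
    post_mean Phi (\<lambda>u. (1 - exp (Phi u - Psi u)) * h u) + post_mean Phi (\<lambda>u. exp (Phi u - Psi u) - 1) * post_mean Psi h"
proof -
  interpret p: bounded_potential Phi B by fact
  interpret q: bounded_potential Psi B by fact
  have ph: "integrable rho (\<lambda>u. h u * exp (- Phi u))" by (rule p.integrable_times_exp[OF h hb])
  have qh: "integrable rho (\<lambda>u. h u * exp (- Psi u))" by (rule q.integrable_times_exp[OF h hb])
  have e: "exp (Phi u - Psi u) * exp (- Phi u) = exp (- Psi u)" for u by (simp flip: exp_add)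
  let ?Zp = "\<integral>u. exp (- Phi u) \<partial>rho" and ?Zq = "\<integral>u. exp (- Psi u) \<partial>rho"
  have "(1 - exp (Phi u - Psi u)) * h u * exp (- Phi u) = h u * exp (- Phi u) - h u * exp (- Psi u)" for u
    by (simp add: algebra_simps flip: e)
  then have 1: "post_mean Phi (\<lambda>u. (1 - exp (Phi u - Psi u)) * h u) =
      ((\<integral>u. h u * exp (- Phi u) \<partial>rho) - (\<integral>u. h u * exp (- Psi u) \<partial>rho)) / ?Zp"
    using ph qh by (simp add: post_mean_def)
  have "(exp (Phi u - Psi u) - 1) * exp (- Phi u) = exp (- Psi u) - exp (- Phi u)" for u
    by (simp add: algebra_simps flip: e)
  then have 2: "post_mean Phi (\<lambda>u. exp (Phi u - Psi u) - 1) = (?Zq - ?Zp) / ?Zp"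
    using p.integrable_exp q.integrable_exp by (simp add: post_mean_def)
  show ?thesis unfolding 1 2 unfolding post_mean_def using p.norm_const_pos q.norm_const_pos by (simp add: field_simps)
qed

text \<open>Each of the two terms on the right of \<open>post_mean_change\<close> is at most
  \<open>t * b\<close>, because posterior means do not exceed sup norms.\<close>

lemma post_mean_change_bound:
  assumes p: "bounded_potential Phi B" and q: "bounded_potential Psi B"
    and h [measurable]: "h \<in> borel_measurable rho" and hb: "\<And>u. u \<in> space rho \<Longrightarrow> \<bar>h u\<bar> \<le> b"
    and t: "\<And>u. u \<in> space rho \<Longrightarrow> \<bar>exp (Phi u - Psi u) - 1\<bar> \<le> t" and "0 \<le> b"
  shows "\<bar>post_mean Phi h - post_mean Psi h\<bar> \<le> 2 * t * b"
proof -
  interpret p: bounded_potential Phi B by fact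
  interpret q: bounded_potential Psi B by fact
  obtain u where "u \<in> space rho" using p.rho.not_empty by blast
  from t[OF this] have t0: "0 \<le> t" by linarith
  have 1: "\<bar>post_mean Phi (\<lambda>u. (1 - exp (Phi u - Psi u)) * h u)\<bar> \<le> t * b"
  proof (rule p.post_mean_bound)
    fix u assume "u \<in> space rho"
    then have "\<bar>1 - exp (Phi u - Psi u)\<bar> \<le> t" "\<bar>h u\<bar> \<le> b" using t hb by (auto simp: abs_minus_commute)
    then show "\<bar>(1 - exp (Phi u - Psi u)) * h u\<bar> \<le> t * b" unfolding abs_mult using t0 by (intro mult_mono) auto
  qed measurable
  have 2: "\<bar>post_mean Phi (\<lambda>u. exp (Phi u - Psi u) - 1)\<bar> \<le> t"
    by (rule p.post_mean_bound[OF _ t]) measurable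
  have 3: "\<bar>post_mean Psi h\<bar> \<le> b" by (rule q.post_mean_bound[OF h hb])
  have "\<bar>post_mean Phi (\<lambda>u. exp (Phi u - Psi u) - 1) * post_mean Psi h\<bar> \<le> t * b"
    unfolding abs_mult using 2 3 t0 by (intro mult_mono) auto
  then have "\<bar>post_mean Phi h - post_mean Psi h\<bar> \<le> t * b + t * b"
    using 1 post_mean_change[OF p q h hb] by linarith
  then show ?thesis by linarith
qed

text \<open>All that the estimator has to know about the differential equation: \<open>Phi'\<close>
  and \<open>G'\<close> are the exact potential and quantity of interest, and their level
  approximations are uniformly bounded and converge in the sup norm at the rate
  \<open>(1/2) ^ l\<close>.\<close>

locale multilevel_approximation =
  fixes Phi G :: "nat \<Rightarrow> (nat \<Rightarrow> real) \<Rightarrow> real" and Phi' G' :: "(nat \<Rightarrow> real) \<Rightarrow> real" and B c :: real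
  assumes meas [measurable]: "\<And>l. Phi l \<in> borel_measurable rho" "\<And>l. G l \<in> borel_measurable rho"
      "Phi' \<in> borel_measurable rho" "G' \<in> borel_measurable rho"
    and bnd: "\<And>l u. u \<in> space rho \<Longrightarrow> \<bar>Phi l u\<bar> \<le> B" "\<And>l u. u \<in> space rho \<Longrightarrow> \<bar>G l u\<bar> \<le> B"
      "\<And>u. u \<in> space rho \<Longrightarrow> \<bar>Phi' u\<bar> \<le> B" "\<And>u. u \<in> space rho \<Longrightarrow> \<bar>G' u\<bar> \<le> B"
    and approx: "\<And>l u. u \<in> space rho \<Longrightarrow> \<bar>Phi l u - Phi' u\<bar> \<le> c * (1/2) ^ l"
      "\<And>l u. u \<in> space rho \<Longrightarrow> \<bar>G l u - G' u\<bar> \<le> c * (1/2) ^ l"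
begin

lemma pot: "bounded_potential (Phi l) B" "bounded_potential Phi' B"
  by (unfold_locales; use bnd in auto)+

lemma B_nonneg: "0 \<le> B" and c_nonneg: "0 \<le> c"
proof -
  interpret r: prob_space rho by (rule prob_space_rho)
  obtain u where u: "u \<in> space rho" using r.not_empty by blast
  show "0 \<le> B" using bnd(4)[OF u] by linarith
  show "0 \<le> c" using approx(1)[OF u, of 0] by simp
qed

text \<open>\<open>E\<close> bounds \<open>D_l - 1\<close> and \<open>A\<close> bounds
  \<open>Q_l\<close>, both in units of \<open>(1/2) ^ l\<close>. The term with \<open>3 * c\<close>
  stems from the triangle inequality between neighbouring levels,
  \<open>c * (1/2) ^ l + c * (1/2) ^ (l - 1)\<close>. The other summands cover level 0, where
  \<open>D_0 = 0\<close> and \<open>Q_0\<close> is \<open>G 0\<close> itself, and make both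
  constants at least 1.\<close>

definition E where "E = 1 + 3 * c * exp (2 * B)"
definition A where "A = 1 + B + 3 * c"

lemma E_ge: "1 \<le> E" and A_ge: "1 \<le> A" using B_nonneg c_nonneg by (auto simp: E_def A_def)

lemma Qdiff_measurable [measurable]: "Qdiff G l \<in> borel_measurable rho"
  unfolding Qdiff_def by measurable

lemma Dfac_measurable [measurable]: "Dfac Phi l \<in> borel_measurable rho"
  unfolding Dfac_def by measurable

lemma Qdiff_bound: "u \<in> space rho \<Longrightarrow> \<bar>Qdiff G l u\<bar> \<le> A * (1/2) ^ l"
proof (cases l)
  case 0
  assume "u \<in> space rho"
  then show ?thesis using bnd(2)[of u 0] c_nonneg by (simp add: 0 Qdiff_def A_def)
next
  case (Suc k)
  assume u: "u \<in> space rho"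
  have "\<bar>Qdiff G l u\<bar> \<le> c * (1/2) ^ Suc k + c * (1/2) ^ k"
    using approx(2)[OF u, of "Suc k"] approx(2)[OF u, of k] unfolding Suc Qdiff_def
    by (simp del: power_Suc)
  also have "\<dots> = 3 * c * (1/2) ^ l" by (simp add: Suc)
  also have "\<dots> \<le> A * (1/2) ^ l" using B_nonneg by (intro mult_right_mono) (auto simp: A_def)
  finally show ?thesis .
qed

lemma Dfac_bound: "u \<in> space rho \<Longrightarrow> \<bar>Dfac Phi l u - 1\<bar> \<le> E * (1/2) ^ l"
proof (cases l)
  case 0
  then show ?thesis using E_ge by (simp add: Dfac_def)
next
  case (Suc k)
  assume u: "u \<in> space rho"
  let ?x = "Phi l u - Phi k u"
  have "\<bar>?x\<bar> \<le> c * (1/2) ^ Suc k + c * (1/2) ^ k"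
    using approx(1)[OF u, of "Suc k"] approx(1)[OF u, of k] unfolding Suc by linarith
  then have x: "\<bar>?x\<bar> \<le> 3 * c * (1/2) ^ l" by (simp add: Suc)
  have "\<bar>?x\<bar> \<le> 2 * B" using bnd(1)[OF u, of l] bnd(1)[OF u, of k] by linarith
  then have "\<bar>exp ?x - 1\<bar> \<le> exp (2 * B) * \<bar>?x\<bar>" by (rule abs_exp_minus_one_le)
  also have "\<dots> \<le> exp (2 * B) * (3 * c * (1/2) ^ l)" using x by (intro mult_left_mono) auto
  also have "\<dots> \<le> E * (1/2) ^ l" by (simp add: E_def algebra_simps)
  finally show ?thesis by (simp add: Dfac_def Suc)
qed

text \<open>The change of the posterior mean from level \<open>l - 1\<close> to level
  \<open>l\<close>, with the mean on level -1 read as zero. By \<open>incr_eq\<close> it is the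
  target of one summand of the estimator when \<open>h\<close> is \<open>Qdiff G l'\<close>.\<close>

definition incr :: "nat \<Rightarrow> ((nat \<Rightarrow> real) \<Rightarrow> real) \<Rightarrow> real" where
  "incr l h = post_mean (Phi l) h - (if l = 0 then 0 else post_mean (Phi (l - 1)) h)"

lemma incr_eq:
  assumes h [measurable]: "h \<in> borel_measurable rho" and hb: "\<And>u. u \<in> space rho \<Longrightarrow> \<bar>h u\<bar> \<le> b"
  shows "incr l h = post_mean (Phi l) (\<lambda>u. (1 - Dfac Phi l u) * h u) +
     post_mean (Phi l) (\<lambda>u. Dfac Phi l u - 1) * (if l = 0 then 0 else post_mean (Phi (l - 1)) h)"
  using post_mean_change[OF pot(1) pot(1) h hb, of l "l - 1"]
  by (cases "l = 0") (simp_all add: incr_def Dfac_def)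

lemma incr_bound:
  assumes h [measurable]: "h \<in> borel_measurable rho" and hb: "\<And>u. u \<in> space rho \<Longrightarrow> \<bar>h u\<bar> \<le> b" and b: "0 \<le> b"
  shows "\<bar>incr l h\<bar> \<le> 2 * (E * (1/2) ^ l) * b"
proof (cases "l = 0")
  case True
  have "\<bar>post_mean (Phi 0) h\<bar> \<le> 1 * b" using bounded_potential.post_mean_bound[OF pot(1) h hb] by simp
  also have "\<dots> \<le> 2 * E * b" using E_ge b by (intro mult_right_mono) auto
  finally show ?thesis using True by (simp add: incr_def)
next
  case False
  have "\<bar>post_mean (Phi l) h - post_mean (Phi (l - 1)) h\<bar> \<le> 2 * (E * (1/2) ^ l) * b"
    using Dfac_bound[of _ l] False
    by (intro post_mean_change_bound[OF pot(1) pot(1) h hb _ b]) (simp_all add: Dfac_def)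
  then show ?thesis using False by (simp add: incr_def)
qed

lemma incr_diff:
  assumes "g \<in> borel_measurable rho" "\<And>u. u \<in> space rho \<Longrightarrow> \<bar>g u\<bar> \<le> a"
    and "h \<in> borel_measurable rho" "\<And>u. u \<in> space rho \<Longrightarrow> \<bar>h u\<bar> \<le> b"
  shows "incr l (\<lambda>u. g u - h u) = incr l g - incr l h"
  using bounded_potential.post_mean_diff[OF pot(1) assms] by (simp add: incr_def)

lemma sum_incr_Qdiff: "(\<Sum>l'\<le>N. incr l (Qdiff G l')) = incr l (G N)"
proof (induction N)
  case 0
  then show ?case by (simp add: Qdiff_def[abs_def])
next
  case (Suc N)
  have "incr l (Qdiff G (Suc N)) = incr l (\<lambda>u. G (Suc N) u - G N u)" by (simp add: Qdiff_def[abs_def])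
  also have "\<dots> = incr l (G (Suc N)) - incr l (G N)"
    by (rule incr_diff[OF meas(2) bnd(2) meas(2) bnd(2)])
  finally show ?case using Suc by simp
qed

lemma sum_incr: "(\<Sum>l\<le>L. incr l h) = post_mean (Phi L) h"
  by (induction L) (simp_all add: incr_def)

text \<open>After summation over \<open>l'\<close>, level \<open>l\<close> misses the increment of
  \<open>G' - G (L - l)\<close>, of order \<open>(1/2) ^ l * (1/2) ^ (L - l)\<close>. Each of the
  \<open>L + 1\<close> levels thus loses the same amount, which causes the factor linear in
  \<open>L\<close>. The remaining term is the change from the exact posterior to the one on level
  \<open>L\<close>.\<close>

lemma bias_bound:
  "\<bar>post_mean Phi' G' - (\<Sum>l\<le>L. \<Sum>l'\<le>L - l. incr l (Qdiff G l'))\<bar> \<le> (2 * E * B + 2 * E * c * (real L + 1)) * (1/2) ^ L"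
proof -
  have "(\<Sum>l\<le>L. incr l (\<lambda>u. G' u - G (L - l) u)) = (\<Sum>l\<le>L. incr l G' - incr l (G (L - l)))"
    using incr_diff[OF meas(4) bnd(4) meas(2) bnd(2)] by simp
  also have "\<dots> = post_mean (Phi L) G' - (\<Sum>l\<le>L. incr l (G (L - l)))" by (simp add: sum_subtractf sum_incr)
  finally have eq: "post_mean Phi' G' - (\<Sum>l\<le>L. \<Sum>l'\<le>L - l. incr l (Qdiff G l')) =
     (post_mean Phi' G' - post_mean (Phi L) G') + (\<Sum>l\<le>L. incr l (\<lambda>u. G' u - G (L - l) u))"
    by (simp add: sum_incr_Qdiff)
  have "\<bar>post_mean Phi' G' - post_mean (Phi L) G'\<bar> \<le> 2 * (E * (1/2) ^ L) * B"
  proof (rule post_mean_change_bound[OF pot(2) pot(1) meas(4) bnd(4) _ B_nonneg])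
    fix u assume u: "u \<in> space rho"
    have x: "\<bar>Phi' u - Phi L u\<bar> \<le> c * (1/2) ^ L" using approx(1)[OF u, of L] by (simp add: abs_minus_commute)
    have "\<bar>Phi' u - Phi L u\<bar> \<le> 2 * B" using bnd(1)[OF u, of L] bnd(3)[OF u] by linarith
    then have "\<bar>exp (Phi' u - Phi L u) - 1\<bar> \<le> exp (2 * B) * \<bar>Phi' u - Phi L u\<bar>" by (rule abs_exp_minus_one_le)
    also have "\<dots> \<le> exp (2 * B) * (c * (1/2) ^ L)" using x by (intro mult_left_mono) auto
    also have "\<dots> = (c * exp (2 * B)) * (1/2) ^ L" by simp
    also have "\<dots> \<le> E * (1/2) ^ L" using c_nonneg by (intro mult_right_mono) (auto simp: E_def add_increasing)
    finally show "\<bar>exp (Phi' u - Phi L u) - 1\<bar> \<le> E * (1/2) ^ L" .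
  qed
  moreover have "\<bar>\<Sum>l\<le>L. incr l (\<lambda>u. G' u - G (L - l) u)\<bar> \<le> (\<Sum>l\<le>L. 2 * E * c * (1/2) ^ L)"
  proof (rule order_trans[OF sum_abs sum_mono])
    fix l assume l: "l \<in> {..L}"
    have "\<bar>incr l (\<lambda>u. G' u - G (L - l) u)\<bar> \<le> 2 * (E * (1/2) ^ l) * (c * (1/2) ^ (L - l))"
      using approx(2) c_nonneg by (intro incr_bound) (auto simp: abs_minus_commute)
    also have "\<dots> = 2 * E * c * ((1/2) ^ l * (1/2) ^ (L - l))" by simp
    also have "(1/2) ^ l * (1/2) ^ (L - l) = (1/2::real) ^ L" using l by (simp flip: power_add)
    finally show "\<bar>incr l (\<lambda>u. G' u - G (L - l) u)\<bar> \<le> 2 * E * c * (1/2) ^ L" .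
  qed
  ultimately show ?thesis unfolding eq by (simp add: algebra_simps)
qed

definition K where "K = 2 * sqrt (1 + 2 * exp (4 * B))"

lemma K_nonneg: "0 \<le> K" by (simp add: K_def)

lemma level_error:
  fixes M :: "'w measure"
  assumes M: "prob_space M" and ll: "l + l' \<le> L"
    and su: "\<And>s::nat. s < 3 \<Longrightarrow> isampler_setup M (u0 s) (vw s)"
  defines "X \<equiv> \<lambda>\<omega>. chain_avg (Phi l) (Mlev L l l') (u0 0 \<omega>) (\<lambda>k. vw 0 k \<omega>) (\<lambda>u. (1 - Dfac Phi l u) * Qdiff G l' u)
      + chain_avg (Phi l) (Mlev L l l') (u0 1 \<omega>) (\<lambda>k. vw 1 k \<omega>) (\<lambda>u. Dfac Phi l u - 1)
        * (if l = 0 then 0 else chain_avg (Phi (l - 1)) (Mlev L l l') (u0 2 \<omega>) (\<lambda>k. vw 2 k \<omega>) (Qdiff G l'))"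
  shows "integrable M X" "(\<integral>\<omega>. \<bar>X \<omega> - incr l (Qdiff G l')\<bar> \<partial>M) \<le> 3 * K * E * A * (1/2) ^ L"
proof -
  interpret p: bounded_potential "Phi l" B by (rule pot)
  \<comment> \<open>For \<open>l = 0\<close> truncated subtraction makes this the potential of level
    0 again; the average over this chain is then replaced by zero.\<close>
  interpret q: bounded_potential "Phi (l - 1)" B by (rule pot)
  interpret M: prob_space M by fact
  let ?n = "Mlev L l l'" and ?e = "E * (1/2) ^ l" and ?a = "A * (1/2) ^ l'"
  have n: "?n \<ge> 1" by (simp add: Mlev_def)
  have e0: "?e > 0" and a0: "?a > 0" using E_ge A_ge by auto
  note su0 = su[of 0, simplified] and su1 = su[of 1, simplified] and su2 = su[of 2, simplified]
  let ?f = "\<lambda>u. (1 - Dfac Phi l u) * Qdiff G l' u" and ?g = "\<lambda>u. Dfac Phi l u - 1" and ?h = "Qdiff G l'"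
  have fm: "?f \<in> borel_measurable rho" and gm: "?g \<in> borel_measurable rho" and hm: "?h \<in> borel_measurable rho"
    by measurable
  have fb: "\<bar>?f u\<bar> \<le> ?e * ?a" if "u \<in> space rho" for u
    unfolding abs_mult using Dfac_bound[OF that, of l] Qdiff_bound[OF that, of l'] e0
    by (intro mult_mono) (auto simp: abs_minus_commute)
  note gb = Dfac_bound[of _ l] and hb = Qdiff_bound[of _ l']
  let ?F = "\<lambda>\<omega>. chain_avg (Phi l) ?n (u0 0 \<omega>) (\<lambda>k. vw 0 k \<omega>) ?f"
  let ?G = "\<lambda>\<omega>. chain_avg (Phi l) ?n (u0 1 \<omega>) (\<lambda>k. vw 1 k \<omega>) ?g"
  let ?H = "\<lambda>\<omega>. if l = 0 then 0 else chain_avg (Phi (l - 1)) ?n (u0 2 \<omega>) (\<lambda>k. vw 2 k \<omega>) ?h"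
  let ?pf = "post_mean (Phi l) ?f" and ?pg = "post_mean (Phi l) ?g" and ?ph = "if l = 0 then 0 else post_mean (Phi (l - 1)) ?h"
  have [measurable]: "?F \<in> borel_measurable M" by (rule p.chain_avg_measurable[OF M su0 fm])
  have [measurable]: "?G \<in> borel_measurable M" using p.chain_avg_measurable[OF M su1 gm] by simp
  have [measurable]: "?H \<in> borel_measurable M" using q.chain_avg_measurable[OF M su2 hm] by (cases "l = 0") simp_all
  have Fb: "\<bar>?F \<omega>\<bar> \<le> ?e * ?a" if "\<omega> \<in> space M" for \<omega> by (rule p.chain_avg_bound[OF M su0 fb that n])
  have Gb: "\<bar>?G \<omega>\<bar> \<le> ?e" if "\<omega> \<in> space M" for \<omega> using p.chain_avg_bound[OF M su1 gb that n] by simp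
  have Hb: "\<bar>?H \<omega>\<bar> \<le> ?a" if "\<omega> \<in> space M" for \<omega>
    using q.chain_avg_bound[OF M su2 hb that n] a0 by simp
  have pgb: "\<bar>?pg\<bar> \<le> ?e" by (rule p.post_mean_bound[OF gm gb])
  have iF: "integrable M ?F" by (rule integrable_bounded_prob[OF M _ Fb]) measurable
  have iG: "integrable M ?G" by (rule integrable_bounded_prob[OF M _ Gb]) measurable
  have iH: "integrable M ?H" by (rule integrable_bounded_prob[OF M _ Hb]) measurable
  have iGH: "integrable M (\<lambda>\<omega>. ?G \<omega> * ?H \<omega>)"
  proof (rule integrable_bounded_prob[OF M, where b = "?e * ?a"])
    show "\<bar>?G \<omega> * ?H \<omega>\<bar> \<le> ?e * ?a" if "\<omega> \<in> space M" for \<omega>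
      unfolding abs_mult using Gb[OF that] Hb[OF that] e0 by (intro mult_mono) auto
  qed measurable
  have X: "X = (\<lambda>\<omega>. ?F \<omega> + ?G \<omega> * ?H \<omega>)" by (simp add: X_def)
  show iX: "integrable M X" unfolding X using iF iGH by simp
  define r where "r = 1 / sqrt (real ?n)"
  \<comment> \<open>The sample size is a perfect square, so the statistical rate is exactly the
    power of 1/2 that completes the two decay factors to \<open>(1/2) ^ L\<close>.\<close>
  have "sqrt (real ?n) = 2 ^ (L - l - l')" by (simp add: Mlev_def power_mult real_sqrt_power power_even_eq)
  then have r: "r = (1/2) ^ (L - l - l')" by (simp add: r_def power_divide)
  have rr: "(1/2) ^ l * (1/2) ^ l' * r = (1/2) ^ L" unfolding r using ll by (simp flip: power_add)
  have eF: "(\<integral>\<omega>. \<bar>?F \<omega> - ?pf\<bar> \<partial>M) \<le> K * (?e * ?a) * r"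
    using p.chain_avg_error[OF M su0 fm fb _ n] e0 a0 by (simp add: K_def r_def)
  have eG: "(\<integral>\<omega>. \<bar>?G \<omega> - ?pg\<bar> \<partial>M) \<le> K * ?e * r"
    using p.chain_avg_error[OF M su1 gm gb e0 n] by (simp add: K_def r_def)
  have eH: "(\<integral>\<omega>. \<bar>?H \<omega> - ?ph\<bar> \<partial>M) \<le> K * ?a * r"
  proof (cases "l = 0")
    case True then show ?thesis using K_nonneg a0 by (simp add: r_def)
  next
    case False then show ?thesis using q.chain_avg_error[OF M su2 hm hb a0 n] by (simp add: K_def r_def)
  qed
  have inc: "incr l ?h = ?pf + ?pg * ?ph" by (rule incr_eq[OF hm hb])
  have "(\<integral>\<omega>. \<bar>X \<omega> - incr l ?h\<bar> \<partial>M) \<le> (\<integral>\<omega>. \<bar>?F \<omega> - ?pf\<bar> + (\<bar>?G \<omega> - ?pg\<bar> * ?a + ?e * \<bar>?H \<omega> - ?ph\<bar>) \<partial>M)"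
  proof (rule integral_mono)
    fix \<omega> assume w: "\<omega> \<in> space M"
    \<comment> \<open>Error of a product: one average is bounded by its sup norm and the mean of the
      other likewise, so that each mean error enters linearly and for one chain at a time.\<close>
    have "\<bar>?G \<omega> * ?H \<omega> - ?pg * ?ph\<bar> = \<bar>(?G \<omega> - ?pg) * ?H \<omega> + ?pg * (?H \<omega> - ?ph)\<bar>"
      by (rule arg_cong[where f = abs]) (simp add: algebra_simps)
    also have "\<dots> \<le> \<bar>?G \<omega> - ?pg\<bar> * \<bar>?H \<omega>\<bar> + \<bar>?pg\<bar> * \<bar>?H \<omega> - ?ph\<bar>"
      unfolding abs_mult[symmetric] by (rule abs_triangle_ineq)
    also have "\<dots> \<le> \<bar>?G \<omega> - ?pg\<bar> * ?a + ?e * \<bar>?H \<omega> - ?ph\<bar>"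
      by (intro add_mono mult_left_mono mult_right_mono Hb[OF w] pgb) auto
    finally show "\<bar>X \<omega> - incr l ?h\<bar> \<le> \<bar>?F \<omega> - ?pf\<bar> + (\<bar>?G \<omega> - ?pg\<bar> * ?a + ?e * \<bar>?H \<omega> - ?ph\<bar>)"
      unfolding X inc by linarith
  next
    show "integrable M (\<lambda>\<omega>. \<bar>X \<omega> - incr l ?h\<bar>)" using iX by auto
    show "integrable M (\<lambda>\<omega>. \<bar>?F \<omega> - ?pf\<bar> + (\<bar>?G \<omega> - ?pg\<bar> * ?a + ?e * \<bar>?H \<omega> - ?ph\<bar>))"
      by (intro Bochner_Integration.integrable_add integrable_mult_left integrable_mult_right integrable_abs
          Bochner_Integration.integrable_diff iF iG iH M.integrable_const)
  qed
  also have "\<dots> = (\<integral>\<omega>. \<bar>?F \<omega> - ?pf\<bar> \<partial>M) + ((\<integral>\<omega>. \<bar>?G \<omega> - ?pg\<bar> \<partial>M) * ?a + ?e * (\<integral>\<omega>. \<bar>?H \<omega> - ?ph\<bar> \<partial>M))"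
  proof -
    have 1: "integrable M (\<lambda>\<omega>. \<bar>?F \<omega> - ?pf\<bar>)" "integrable M (\<lambda>\<omega>. \<bar>?G \<omega> - ?pg\<bar>)" "integrable M (\<lambda>\<omega>. \<bar>?H \<omega> - ?ph\<bar>)"
      by (intro integrable_abs Bochner_Integration.integrable_diff iF iG iH M.integrable_const)+
    show ?thesis
      by (subst Bochner_Integration.integral_add, fact 1, intro Bochner_Integration.integrable_add integrable_mult_left integrable_mult_right 1,
          subst Bochner_Integration.integral_add, intro integrable_mult_left 1, intro integrable_mult_right 1,
          simp only: integral_mult_left_zero integral_mult_right_zero)
  qed
  also have "\<dots> \<le> K * (?e * ?a) * r + ((K * ?e * r) * ?a + ?e * (K * ?a * r))"
    using e0 a0 by (intro add_mono mult_left_mono mult_right_mono eF eG eH) auto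
  also have "\<dots> = 3 * K * E * A * ((1/2) ^ l * (1/2) ^ l' * r)" by (simp add: algebra_simps)
  finally show "(\<integral>\<omega>. \<bar>X \<omega> - incr l ?h\<bar> \<partial>M) \<le> 3 * K * E * A * (1/2) ^ L" by (simp only: rr)
qed

theorem mlmcmc_error:
  "\<exists>C>0. \<forall>L\<ge>1. \<forall>(M :: 'w measure) (u0 :: nat \<Rightarrow> nat \<Rightarrow> nat \<Rightarrow> _) vw.
       prob_space M \<and> (\<forall>l\<le>L. \<forall>l'\<le>L - l. \<forall>s<3. isampler_setup M (u0 l l' s) (vw l l' s)) \<longrightarrow>
       (\<integral>\<^sup>+\<omega>. ennreal \<bar>post_mean Phi' G' - mlmcmc_est L Phi G (\<lambda>l l' s. u0 l l' s \<omega>) (\<lambda>l l' s k. vw l l' s k \<omega>)\<bar> \<partial>M)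
       \<le> ennreal (C * real L ^ 2 * 2 powr (- real L))"
proof -
  define C1 where "C1 = 2 * E * B + 4 * E * c"
  define C2 where "C2 = 3 * K * E * A"
  have C1: "0 \<le> C1" using E_ge B_nonneg c_nonneg by (simp add: C1_def)
  have C2: "0 \<le> C2" using E_ge A_ge K_nonneg by (simp add: C2_def)
  show ?thesis
  \<comment> \<open>\<open>C1\<close> carries the bias, using \<open>L + 1 \<le> 2 * L ^ 2\<close>.
    The triangle of level pairs has at most \<open>(2 * L) ^ 2\<close> elements, which yields
    \<open>4 * C2\<close>. The summand 1 makes the constant strictly positive.\<close>
  proof (intro exI[of _ "C1 + 4 * C2 + 1"] conjI allI impI)
    show "0 < C1 + 4 * C2 + 1" using C1 C2 by simp
    fix L :: nat and M :: "'w measure" and u0 :: "nat \<Rightarrow> nat \<Rightarrow> nat \<Rightarrow> _" and vw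
    assume L: "1 \<le> L" and a: "prob_space M \<and> (\<forall>l\<le>L. \<forall>l'\<le>L - l. \<forall>s<3. isampler_setup M (u0 l l' s) (vw l l' s))"
    then have M: "prob_space M" by simp
    interpret M: prob_space M by fact
    define X where "X l l' \<omega> = chain_avg (Phi l) (Mlev L l l') (u0 l l' 0 \<omega>) (\<lambda>k. vw l l' 0 k \<omega>) (\<lambda>u. (1 - Dfac Phi l u) * Qdiff G l' u)
      + chain_avg (Phi l) (Mlev L l l') (u0 l l' 1 \<omega>) (\<lambda>k. vw l l' 1 k \<omega>) (\<lambda>u. Dfac Phi l u - 1)
        * (if l = 0 then 0 else chain_avg (Phi (l - 1)) (Mlev L l l') (u0 l l' 2 \<omega>) (\<lambda>k. vw l l' 2 k \<omega>) (Qdiff G l'))"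
      for l l' \<omega>
    have iX: "integrable M (X l l')" and eX: "(\<integral>\<omega>. \<bar>X l l' \<omega> - incr l (Qdiff G l')\<bar> \<partial>M) \<le> C2 * (1/2) ^ L"
      if "l \<in> {..L}" "l' \<in> {..L - l}" for l l'
    proof -
      have "isampler_setup M (u0 l l' s) (vw l l' s)" if "s < 3" for s using a that \<open>l \<in> _\<close> \<open>l' \<in> _\<close> by simp
      note su = this
      have "l + l' \<le> L" using that by auto
      from level_error[where ?u0.0 = "u0 l l'" and vw = "vw l l'", OF M this su] show "integrable M (X l l')"
        "(\<integral>\<omega>. \<bar>X l l' \<omega> - incr l (Qdiff G l')\<bar> \<partial>M) \<le> C2 * (1/2) ^ L"
        unfolding X_def C2_def by simp_all
    qed
    let ?est = "\<lambda>\<omega>. mlmcmc_est L Phi G (\<lambda>l l' s. u0 l l' s \<omega>) (\<lambda>l l' s k. vw l l' s k \<omega>)"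
    let ?p = "post_mean Phi' G'"
    let ?d = "\<Sum>l\<le>L. \<Sum>l'\<le>L - l. incr l (Qdiff G l')"
    have est: "?est \<omega> = (\<Sum>l\<le>L. \<Sum>l'\<le>L - l. X l l' \<omega>)" for \<omega>
      by (simp add: mlmcmc_est_def X_def)
    have iest: "integrable M ?est" unfolding est by (intro Bochner_Integration.integrable_sum iX)
    have iabs: "integrable M (\<lambda>\<omega>. \<bar>X l l' \<omega> - incr l (Qdiff G l')\<bar>)" if "l \<in> {..L}" "l' \<in> {..L - l}" for l l'
      using iX[OF that] by auto
    have "(\<integral>\<omega>. \<bar>?p - ?est \<omega>\<bar> \<partial>M) \<le> (\<integral>\<omega>. \<bar>?p - ?d\<bar> + (\<Sum>l\<le>L. \<Sum>l'\<le>L - l. \<bar>X l l' \<omega> - incr l (Qdiff G l')\<bar>) \<partial>M)"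
    proof (rule integral_mono)
      show "integrable M (\<lambda>\<omega>. \<bar>?p - ?est \<omega>\<bar>)"
        by (intro integrable_abs Bochner_Integration.integrable_diff iest M.integrable_const)
      show "integrable M (\<lambda>\<omega>. \<bar>?p - ?d\<bar> + (\<Sum>l\<le>L. \<Sum>l'\<le>L - l. \<bar>X l l' \<omega> - incr l (Qdiff G l')\<bar>))"
        by (intro Bochner_Integration.integrable_add M.integrable_const Bochner_Integration.integrable_sum iabs)
      fix \<omega>
      have "\<bar>?est \<omega> - ?d\<bar> = \<bar>\<Sum>l\<le>L. \<Sum>l'\<le>L - l. X l l' \<omega> - incr l (Qdiff G l')\<bar>"
        unfolding est by (simp add: sum_subtractf)
      also have "\<dots> \<le> (\<Sum>l\<le>L. \<Sum>l'\<le>L - l. \<bar>X l l' \<omega> - incr l (Qdiff G l')\<bar>)"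
        by (intro order_trans[OF sum_abs] sum_mono order.refl)
      finally show "\<bar>?p - ?est \<omega>\<bar> \<le> \<bar>?p - ?d\<bar> + (\<Sum>l\<le>L. \<Sum>l'\<le>L - l. \<bar>X l l' \<omega> - incr l (Qdiff G l')\<bar>)"
        by linarith
    qed
    also have "\<dots> = \<bar>?p - ?d\<bar> + (\<Sum>l\<le>L. \<Sum>l'\<le>L - l. (\<integral>\<omega>. \<bar>X l l' \<omega> - incr l (Qdiff G l')\<bar> \<partial>M))"
    proof -
      have "(\<integral>\<omega>. (\<Sum>l\<le>L. \<Sum>l'\<le>L - l. \<bar>X l l' \<omega> - incr l (Qdiff G l')\<bar>) \<partial>M) =
          (\<Sum>l\<le>L. (\<integral>\<omega>. (\<Sum>l'\<le>L - l. \<bar>X l l' \<omega> - incr l (Qdiff G l')\<bar>) \<partial>M))"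
        by (intro Bochner_Integration.integral_sum Bochner_Integration.integrable_sum iabs)
      also have "\<dots> = (\<Sum>l\<le>L. \<Sum>l'\<le>L - l. (\<integral>\<omega>. \<bar>X l l' \<omega> - incr l (Qdiff G l')\<bar> \<partial>M))"
        by (intro sum.cong refl Bochner_Integration.integral_sum iabs)
      finally show ?thesis
        by (subst Bochner_Integration.integral_add, intro M.integrable_const, intro Bochner_Integration.integrable_sum iabs)
          (simp_all add: M.prob_space)
    qed
    also have "\<dots> \<le> \<bar>?p - ?d\<bar> + (\<Sum>l\<le>L. \<Sum>l'\<le>L - l. C2 * (1/2) ^ L)"
      by (intro add_left_mono sum_mono eX)
    also have "\<dots> \<le> C1 * real L ^ 2 * (1/2) ^ L + (2 * real L) ^ 2 * (C2 * (1/2) ^ L)"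
    proof (intro add_mono)
      have L1: "1 \<le> real L" using L by simp
      then have LL: "real L \<le> real L ^ 2" by (simp add: power2_eq_square)
      have "2 * E * B * 1 \<le> 2 * E * B * real L ^ 2"
        using E_ge B_nonneg L1 LL by (intro mult_left_mono) auto
      moreover have "2 * E * c * (real L + 1) \<le> 2 * E * c * (2 * real L ^ 2)"
        using E_ge c_nonneg order_trans[OF L1 LL] LL by (intro mult_left_mono) (linarith | simp)+
      ultimately have "2 * E * B + 2 * E * c * (real L + 1) \<le> C1 * real L ^ 2"
        by (simp add: C1_def algebra_simps)
      then show "\<bar>?p - ?d\<bar> \<le> C1 * real L ^ 2 * (1/2) ^ L"
        by (intro order_trans[OF bias_bound] mult_right_mono) auto
      have "(\<Sum>l\<le>L. \<Sum>l'\<le>L - l. C2 * (1/2) ^ L) \<le> (\<Sum>l\<le>L. (2 * real L) * (C2 * (1/2) ^ L))"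
      proof (intro sum_mono)
        fix l
        have "(\<Sum>l'\<le>L - l. C2 * (1/2) ^ L) = (real (L - l) + 1) * (C2 * (1/2) ^ L)" by (simp add: algebra_simps)
        also have "\<dots> \<le> (2 * real L) * (C2 * (1/2) ^ L)" using L C2 by (intro mult_right_mono) auto
        finally show "(\<Sum>l'\<le>L - l. C2 * (1/2) ^ L) \<le> (2 * real L) * (C2 * (1/2) ^ L)" .
      qed
      also have "\<dots> = (real L + 1) * ((2 * real L) * (C2 * (1/2) ^ L))" by (simp add: algebra_simps)
      also have "\<dots> \<le> (2 * real L) * ((2 * real L) * (C2 * (1/2) ^ L))" using L C2 by (intro mult_right_mono) auto
      also have "\<dots> = (2 * real L) ^ 2 * (C2 * (1/2) ^ L)" by (simp add: power2_eq_square)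
      finally show "(\<Sum>l\<le>L. \<Sum>l'\<le>L - l. C2 * (1/2) ^ L) \<le> (2 * real L) ^ 2 * (C2 * (1/2) ^ L)" .
    qed
    also have "\<dots> = (C1 + 4 * C2) * real L ^ 2 * (1/2) ^ L" by (simp add: algebra_simps power_mult_distrib)
    also have "\<dots> \<le> (C1 + 4 * C2 + 1) * real L ^ 2 * (1/2) ^ L" by (intro mult_right_mono) auto
    also have "(1/2) ^ L = 2 powr (- real L)" by (simp add: powr_minus powr_realpow power_divide inverse_eq_divide)
    finally have fin: "(\<integral>\<omega>. \<bar>?p - ?est \<omega>\<bar> \<partial>M) \<le> (C1 + 4 * C2 + 1) * real L ^ 2 * 2 powr (- real L)" .
    \<comment> \<open>The Bochner integral is 0 by default for a non-integrable function, so its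
      bound alone would say little; integrability of the estimator identifies it with the
      nonnegative integral of the claim.\<close>
    have "(\<integral>\<^sup>+\<omega>. ennreal \<bar>?p - ?est \<omega>\<bar> \<partial>M) = ennreal (\<integral>\<omega>. \<bar>?p - ?est \<omega>\<bar> \<partial>M)"
      by (rule nn_integral_eq_integral)
        (intro integrable_abs Bochner_Integration.integrable_diff iest M.integrable_const, simp)
    also have "\<dots> \<le> ennreal ((C1 + 4 * C2 + 1) * real L ^ 2 * 2 powr (- real L))" by (rule ennreal_leI[OF fin])
    finally show "(\<integral>\<^sup>+\<omega>. ennreal \<bar>?p - ?est \<omega>\<bar> \<partial>M) \<le> ennreal ((C1 + 4 * C2 + 1) * real L ^ 2 * 2 powr (- real L))" .
  qed
qed

end

section \<open>Mollification\<close>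

lemma iter_pd_Cons_eq:
  assumes "\<And>x. (iter_pd \<phi> is has_derivative (\<lambda>h. \<Sum>j\<in>UNIV. f' j x * h $ j)) (at x)"
  shows "iter_pd \<phi> (i # is) = f' i"
proof
  fix x
  have "frechet_derivative (iter_pd \<phi> is) (at x) = (\<lambda>h. \<Sum>j\<in>UNIV. f' j x * h $ j)"
    using frechet_derivative_at[OF assms] by simp
  then show "iter_pd \<phi> (i # is) x = f' i x"
    by (simp add: axis_def if_distrib cong: if_cong)
qed

text \<open>A coinductive criterion for smoothness: in a class closed under first partial
  derivatives, iterated partial derivatives never leave the class, hence all of them are
  differentiable.\<close>

lemma smooth_fun_closed_class:
  fixes S :: "(real^'n \<Rightarrow> real) set"
  assumes "\<phi> \<in> S"
    and S: "\<And>f. f \<in> S \<Longrightarrow> \<exists>f'. (\<forall>i. f' i \<in> S) \<and> (\<forall>x. (f has_derivative (\<lambda>h. \<Sum>j\<in>UNIV. f' j x * h $ j)) (at x))"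
  shows "smooth_fun \<phi>"
proof -
  have "iter_pd \<phi> is \<in> S" for "is"
  proof (induction "is")
    case Nil
    then show ?case using assms by simp
  next
    case (Cons i "is")
    then obtain f' where "\<And>i. f' i \<in> S" "\<And>x. (iter_pd \<phi> is has_derivative (\<lambda>h. \<Sum>j\<in>UNIV. f' j x * h $ j)) (at x)"
      using S by blast
    then show ?case using iter_pd_Cons_eq by metis
  qed
  then show ?thesis
    unfolding smooth_fun_def differentiable_def using S by blast
qed

lemma smooth_fun_has_derivative:
  assumes "smooth_fun \<phi>"
  shows "(iter_pd \<phi> is has_derivative (\<lambda>h. \<Sum>j\<in>UNIV. iter_pd \<phi> (j # is) x * h $ j)) (at x)"
proof -
  have d: "(iter_pd \<phi> is has_derivative frechet_derivative (iter_pd \<phi> is) (at x)) (at x)"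
    using assms by (simp add: smooth_fun_def frechet_derivative_works)
  have "frechet_derivative (iter_pd \<phi> is) (at x) h = (\<Sum>j\<in>UNIV. iter_pd \<phi> (j # is) x * h $ j)" for h
  proof -
    interpret l: bounded_linear "frechet_derivative (iter_pd \<phi> is) (at x)" using d by (rule has_derivative_bounded_linear)
    have "h = (\<Sum>j\<in>UNIV. h $ j *\<^sub>R axis j 1)" by (simp add: vec_eq_iff axis_def if_distrib cong: if_cong)
    then have "frechet_derivative (iter_pd \<phi> is) (at x) h = (\<Sum>j\<in>UNIV. h $ j *\<^sub>R frechet_derivative (iter_pd \<phi> is) (at x) (axis j 1))"
      by (metis (no_types, lifting) l.scaleR l.sum sum.cong)
    then show ?thesis by (simp add: mult.commute)
  qed
  then show ?thesis using d by (metis (no_types, lifting) ext)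
qed

lemma smooth_fun_continuous: "smooth_fun \<phi> \<Longrightarrow> continuous_on A (iter_pd \<phi> is)"
  by (intro continuous_at_imp_continuous_on ballI has_derivative_continuous[OF smooth_fun_has_derivative])

lemma iter_pd_eq_inner:
  assumes "smooth_fun \<phi>" "(\<phi> has_derivative (\<lambda>h. a \<bullet> h)) (at x)"
  shows "iter_pd \<phi> [i] x = a $ i"
  using frechet_derivative_at[OF assms(2), symmetric] by (simp add: inner_axis)

declare iter_pd.simps(2) [simp del]

text \<open>Differentiating \<open>exp (- 1 / s)\<close> repeatedly produces only linear combinations of these functions.\<close>
definition exp_bump :: "nat \<Rightarrow> real \<Rightarrow> real" where
  "exp_bump k s = (if s > 0 then exp (- 1 / s) / s ^ k else 0)"

lemma exp_bump_tendsto_0: "(exp_bump k \<longlongrightarrow> 0) (at 0)"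
proof -
  have "((\<lambda>s. inverse s ^ k / exp (inverse s)) \<longlongrightarrow> 0) (at_right (0::real))"
    by (rule filterlim_compose[OF tendsto_power_div_exp_0 filterlim_inverse_at_top_right])
  then have "(exp_bump k \<longlongrightarrow> 0) (at_right 0)"
    by (rule Lim_transform_eventually)
      (auto simp: eventually_at_filter exp_bump_def exp_minus field_simps)
  moreover have "(exp_bump k \<longlongrightarrow> 0) (at_left 0)"
    by (rule Lim_transform_eventually[OF tendsto_const]) (auto simp: eventually_at_filter exp_bump_def)
  ultimately show ?thesis by (simp add: filterlim_split_at)
qed

lemma exp_bump_deriv:
  "(exp_bump k has_real_derivative (exp_bump (k + 2) s - real k * exp_bump (k + 1) s)) (at s)"
proof -
  consider "s > 0" | "s < 0" | "s = 0" by linarith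
  then show ?thesis
  proof cases
    case 1
    have "((\<lambda>s. exp (- 1 / s) / s ^ k) has_real_derivative (exp_bump (k + 2) s - real k * exp_bump (k + 1) s)) (at s)"
    proof -
      have "((\<lambda>s. exp (- 1 / s)) has_real_derivative exp (- 1 / s) * (1 / s\<^sup>2)) (at s)"
        using 1 by (auto intro!: derivative_eq_intros simp: power2_eq_square)
      from DERIV_divide[OF this DERIV_pow[of k s]] 
      have "((\<lambda>s. exp (- 1 / s) / s ^ k) has_real_derivative
          (exp (- 1 / s) * (1 / s\<^sup>2) * s ^ k - exp (- 1 / s) * (real k * s ^ (k - Suc 0))) / (s ^ k * s ^ k)) (at s)"
        using 1 by simp
      moreover have "(exp (- 1 / s) * (1 / s\<^sup>2) * s ^ k - exp (- 1 / s) * (real k * s ^ (k - Suc 0))) / (s ^ k * s ^ k)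
          = exp_bump (k + 2) s - real k * exp_bump (k + 1) s"
        using 1 by (cases k) (simp_all add: exp_bump_def field_simps power2_eq_square)
      ultimately show ?thesis by simp
    qed
    then show ?thesis
      by (rule has_field_derivative_transform_within_open[where S = "{0<..}"]) (use 1 in \<open>auto simp: exp_bump_def\<close>)
  next
    case 2
    have "((\<lambda>s. 0) has_real_derivative (exp_bump (k + 2) s - real k * exp_bump (k + 1) s)) (at s)"
      using 2 by (simp add: exp_bump_def)
    then show ?thesis
      by (rule has_field_derivative_transform_within_open[where S = "{..<0}"]) (use 2 in \<open>auto simp: exp_bump_def\<close>)
  next
    case 3
    \<comment> \<open>At the origin the difference quotient of \<open>exp_bump k\<close> is
      \<open>exp_bump (Suc k)\<close> itself, whose limit there is already known to be 0.\<close>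
    have "((\<lambda>h. (exp_bump k (0 + h) - exp_bump k 0) / h) \<longlongrightarrow> 0) (at 0)"
      by (rule Lim_transform_eventually[OF exp_bump_tendsto_0[of "Suc k"]])
        (auto simp: eventually_at_filter exp_bump_def field_simps)
    then show ?thesis unfolding 3 DERIV_def by (simp add: exp_bump_def)
  qed
qed

text \<open>An algebra of functions generated by constants, coordinates and radial bumps. It is
  closed under partial derivatives, which turns smoothness of mollifiers into an instance of
  \<open>smooth_fun_closed_class\<close>.\<close>

inductive_set bump_alg :: "(real^'n \<Rightarrow> real) set" where
  const: "(\<lambda>x. c) \<in> bump_alg"
| coord: "(\<lambda>x. x $ i) \<in> bump_alg"
| bump: "(\<lambda>x. exp_bump k (r - x \<bullet> x)) \<in> bump_alg"
| add: "f \<in> bump_alg \<Longrightarrow> g \<in> bump_alg \<Longrightarrow> (\<lambda>x. f x + g x) \<in> bump_alg"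
| mult: "f \<in> bump_alg \<Longrightarrow> g \<in> bump_alg \<Longrightarrow> (\<lambda>x. f x * g x) \<in> bump_alg"

lemma bump_alg_has_derivative:
  fixes f :: "real^'n \<Rightarrow> real"
  shows "f \<in> bump_alg \<Longrightarrow> \<exists>f'. (\<forall>i. f' i \<in> bump_alg) \<and> (\<forall>x. (f has_derivative (\<lambda>h. \<Sum>j\<in>UNIV. f' j x * h $ j)) (at x))"
proof (induction rule: bump_alg.induct)
  case (const c)
  show ?case
    by (rule exI[of _ "\<lambda>i x. 0"]) (auto intro: bump_alg.const)
next
  case (coord i)
  show ?case
  proof (intro exI[of _ "\<lambda>j x. if j = i then 1 else 0"] conjI allI)
    show "(\<lambda>x. if j = i then 1 else 0) \<in> bump_alg" for j by (rule bump_alg.const)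
    have "((\<lambda>x::real^'n. x $ i) has_derivative (\<lambda>h. h $ i)) (at x)" for x
      by (rule bounded_linear_imp_has_derivative[OF bounded_linear_vec_nth])
    moreover have "(\<lambda>h::real^'n. h $ i) = (\<lambda>h. \<Sum>j\<in>UNIV. (if j = i then 1 else 0) * h $ j)"
      by (simp add: if_distrib[where f = "\<lambda>c. c * _"] cong: if_cong)
    ultimately show "((\<lambda>x::real^'n. x $ i) has_derivative (\<lambda>h. \<Sum>j\<in>UNIV. (if j = i then 1 else 0) * h $ j)) (at x)" for x
      by metis
  qed
next
  case (bump k r)
  let ?f' = "\<lambda>i x::real^'n. (exp_bump (k + 2) (r - x \<bullet> x) + (- real k) * exp_bump (k + 1) (r - x \<bullet> x)) * ((- 2) * x $ i)"
  have "?f' i \<in> bump_alg" for i by (intro bump_alg.intros)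
  moreover have "((\<lambda>x. exp_bump k (r - x \<bullet> x)) has_derivative (\<lambda>h. \<Sum>j\<in>UNIV. ?f' j x * h $ j)) (at x)" for x :: "real^'n"
  proof -
    have "((\<lambda>x. exp_bump k (r - x \<bullet> x)) has_derivative
        (\<lambda>h. (exp_bump (k + 2) (r - x \<bullet> x) - real k * exp_bump (k + 1) (r - x \<bullet> x)) * (0 - (x \<bullet> h + h \<bullet> x)))) (at x)"
      by (rule has_derivative_compose[OF _ exp_bump_deriv[unfolded has_field_derivative_def]])
        (auto intro!: derivative_eq_intros)
    then show ?thesis
    proof (rule has_derivative_eq_rhs)
      have "A * (0 - (x \<bullet> h + h \<bullet> x)) = (\<Sum>j\<in>UNIV. A * ((- 2) * x $ j) * h $ j)" for A h
      proof -
        have "x \<bullet> h + h \<bullet> x = 2 * (\<Sum>j\<in>UNIV. x $ j * h $ j)"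
          by (simp add: inner_commute[of h x] inner_vec_def[of x h])
        then show ?thesis by (simp add: sum_distrib_left sum_negf mult_ac)
      qed
      then show "(\<lambda>h. (exp_bump (k + 2) (r - x \<bullet> x) - real k * exp_bump (k + 1) (r - x \<bullet> x)) * (0 - (x \<bullet> h + h \<bullet> x))) =
        (\<lambda>h. \<Sum>j\<in>UNIV. ?f' j x * h $ j)"
        by simp
    qed
  qed
  ultimately show ?case by (intro exI[of _ ?f']) auto
next
  case (add f g)
  then obtain f' g' where "\<And>i. f' i \<in> bump_alg" "\<And>i. g' i \<in> bump_alg"
    "\<And>x. (f has_derivative (\<lambda>h. \<Sum>j\<in>UNIV. f' j x * h $ j)) (at x)"
    "\<And>x. (g has_derivative (\<lambda>h. \<Sum>j\<in>UNIV. g' j x * h $ j)) (at x)" by blast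
  then show ?case
    by (intro exI[of _ "\<lambda>i x. f' i x + g' i x"])
      (auto intro!: bump_alg.add derivative_eq_intros simp: algebra_simps sum.distrib)
next
  case (mult f g)
  then obtain f' g' where *: "\<And>i. f' i \<in> bump_alg" "\<And>i. g' i \<in> bump_alg"
    "\<And>x. (f has_derivative (\<lambda>h. \<Sum>j\<in>UNIV. f' j x * h $ j)) (at x)"
    "\<And>x. (g has_derivative (\<lambda>h. \<Sum>j\<in>UNIV. g' j x * h $ j)) (at x)" by blast
  have "((\<lambda>x. f x * g x) has_derivative (\<lambda>h. \<Sum>j\<in>UNIV. (f x * g' j x + f' j x * g x) * h $ j)) (at x)" for x
    by (rule has_derivative_eq_rhs[OF has_derivative_mult[OF *(3,4)]])
      (auto simp: sum_distrib_left sum_distrib_right sum.distrib[symmetric] algebra_simps intro!: ext sum.cong)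
  then show ?case
    using * mult by (intro exI[of _ "\<lambda>i x. f x * g' i x + f' i x * g x"]) (auto intro!: bump_alg.add bump_alg.mult)
qed

lemma bump_alg_continuous: "f \<in> bump_alg \<Longrightarrow> continuous_on A f"
  by (frule bump_alg_has_derivative, elim exE conjE, intro continuous_at_imp_continuous_on ballI)
    (rule has_derivative_continuous, erule spec)

section \<open>Convolution with compactly supported mollifiers\<close>

lemma lborel_integral_affine_unit:
  fixes f :: "real^'n \<Rightarrow> real"
  assumes [measurable]: "f \<in> borel_measurable borel" and "\<bar>c\<bar> = 1"
  shows "(\<integral>x. f (t + c *\<^sub>R x) \<partial>lborel) = (\<integral>x. f x \<partial>lborel)"
    and "integrable lborel (\<lambda>x. f (t + c *\<^sub>R x)) \<longleftrightarrow> integrable lborel f"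
proof -
  have c: "c \<noteq> 0" using assms by auto
  have eq: "(lborel :: (real^'n) measure) = distr lborel borel (\<lambda>x. t + c *\<^sub>R x)"
    using lborel_affine[OF c, of t] assms(2) by (simp add: density_1)
  show "(\<integral>x. f (t + c *\<^sub>R x) \<partial>lborel) = (\<integral>x. f x \<partial>lborel)"
    by (subst (2) eq) (simp add: integral_distr)
  show "integrable lborel (\<lambda>x. f (t + c *\<^sub>R x)) \<longleftrightarrow> integrable lborel f"
    by (subst (2) eq) (simp add: integrable_distr_eq)
qed

lemmas lborel_integral_reflect = lborel_integral_affine_unit[where c = "-1", simplified]

lemma integrable_continuous_compact_support:
  fixes f :: "real^'n \<Rightarrow> real"
  assumes "continuous_on UNIV f" "\<And>x. x \<notin> cbox a b \<Longrightarrow> f x = 0"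
  shows "integrable lborel f" "(\<integral>x. f x \<partial>lborel) = integral (cbox a b) f"
proof -
  have i: "set_integrable lborel (cbox a b) f"
    unfolding set_integrable_def by (intro borel_integrable_compact compact_cbox continuous_on_subset[OF assms(1)]) auto
  have f: "f = (\<lambda>x. indicator (cbox a b) x *\<^sub>R f x)"
    using assms(2) by (intro ext) (auto simp: indicator_def)
  show "integrable lborel f" using i unfolding set_integrable_def by (subst f)
  show "(\<integral>x. f x \<partial>lborel) = integral (cbox a b) f"
    using set_borel_integral_eq_integral(2)[OF i] unfolding set_lebesgue_integral_def by (subst f)
qed

lemma bump_pos: "exp_bump k s \<ge> 0" "exp_bump k s = 0 \<longleftrightarrow> s \<le> 0"
  by (auto simp: exp_bump_def)

lemma mollifier_exists:
  assumes "r > 0"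
  obtains \<eta> :: "real^'n \<Rightarrow> real" where "\<eta> \<in> bump_alg" "\<And>x. 0 \<le> \<eta> x" "\<And>x. r \<le> norm x \<Longrightarrow> \<eta> x = 0"
    "integrable lborel \<eta>" "(\<integral>x. \<eta> x \<partial>lborel) = 1"
proof -
  define b where "b = (\<lambda>x::real^'n. exp_bump 0 (r\<^sup>2 - x \<bullet> x))"
  have b: "b \<in> bump_alg" unfolding b_def by (rule bump_alg.bump)
  have c: "continuous_on UNIV b" by (rule bump_alg_continuous[OF b])
  have b0: "b x = 0" if "r \<le> norm x" for x
    using that assms by (auto simp: b_def bump_pos power2_norm_eq_inner[symmetric] power_mono)
  have bpos: "b x \<ge> 0" for x by (simp add: b_def bump_pos)
  obtain a a' :: "real^'n" where "cball 0 r \<subseteq> cbox a a'" using bounded_subset_cbox_symmetric[OF bounded_cball] by metis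
  then have box: "b x = 0" if "x \<notin> cbox a a'" for x using that b0[of x] by (force simp: mem_cball)
  have i: "integrable lborel b" by (rule integrable_continuous_compact_support[OF c box])
  \<comment> \<open>With integral zero the nonnegative bump would vanish almost everywhere, so the
    open ball on which it is positive would be negligible.\<close>
  have "(\<integral>x. b x \<partial>lborel) \<noteq> 0"
  proof
    assume "(\<integral>x. b x \<partial>lborel) = 0"
    then have "AE x in lborel. b x = 0" using integral_nonneg_eq_0_iff_AE[OF i] bpos by simp
    then have "AE x in lborel. x \<notin> ball (0::real^'n) r"
    proof (rule AE_mp, intro AE_I2 impI)
      fix x assume "b x = 0"
      then have "r\<^sup>2 \<le> (norm x)\<^sup>2" by (simp add: b_def bump_pos power2_norm_eq_inner)
      then have "r \<le> norm x" using assms by (simp add: power2_le_iff_abs_le)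
      then show "x \<notin> ball 0 r" by simp
    qed
    then have "ball (0::real^'n) r \<in> null_sets lborel" by (subst (asm) AE_iff_null_sets[symmetric]) auto
    then have "negligible (ball (0::real^'n) r)" by (simp add: negligible_iff_null_sets null_sets_completionI)
    then show False using assms open_not_negligible[of "ball (0::real^'n) r"] by simp
  qed
  moreover have "(\<integral>x. b x \<partial>lborel) \<ge> 0" using bpos by simp
  ultimately have I: "(\<integral>x. b x \<partial>lborel) > 0" by simp
  show ?thesis
  proof (rule that[of "\<lambda>x. (1 / (\<integral>x. b x \<partial>lborel)) * b x"])
    show "(\<lambda>x. (1 / (\<integral>x. b x \<partial>lborel)) * b x) \<in> bump_alg" by (intro bump_alg.intros b)
  qed (use I i b0 bpos in auto)
qed

text \<open>Differentiation under the integral sign over a box outside which \<open>w\<close>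
  vanishes. The derivative falls on \<open>f\<close>, so \<open>w\<close> has to be no more than
  continuous. The gradient is encoded as the bounded linear map \<open>blinfun_inner_left\<close>,
  the form in which the Leibniz rule produces it.\<close>

lemma conv_has_derivative:
  fixes w :: "real^'n \<Rightarrow> real"
  assumes w: "continuous_on UNIV w" "\<And>x. x \<notin> cbox a b \<Longrightarrow> w x = 0" and f: "continuous_on UNIV f"
    and f': "\<And>i. continuous_on UNIV (f' i)"
    and d: "\<And>x. (f has_derivative (\<lambda>h. \<Sum>j\<in>UNIV. f' j x * h $ j)) (at x)"
  shows "((\<lambda>x. \<integral>y. w y * f (x - y) \<partial>lborel) has_derivative (\<lambda>h. \<Sum>j\<in>UNIV. (\<integral>y. w y * f' j (x - y) \<partial>lborel) * h $ j)) (at x)"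
proof -
  have eq: "(\<integral>y. w y * g (x - y) \<partial>lborel) = integral (cbox a b) (\<lambda>y. w y * g (x - y))"
    if g: "continuous_on UNIV g" for g x
    by (rule integrable_continuous_compact_support)
      (auto intro!: continuous_intros w continuous_on_compose2[OF g] simp: w)
  have cg: "continuous_on A (\<lambda>y. w y * g (x - y))" if g: "continuous_on UNIV g" for g x A
    by (auto intro!: continuous_intros continuous_on_compose2[OF g] continuous_on_subset[OF w(1)])
  let ?v = "\<lambda>x y. (\<chi> j. w y * f' j (x - y))"
  let ?fx = "\<lambda>x y. blinfun_inner_left (?v x y)"
  have D: "((\<lambda>x. integral (cbox a b) (\<lambda>y. w y * f (x - y))) has_derivative integral (cbox a b) (?fx x)) (at x within UNIV)"
  proof (rule leibniz_rule)
    fix x y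
    have d1: "((\<lambda>x. f (x - y)) has_derivative (\<lambda>h. \<Sum>j\<in>UNIV. f' j (x - y) * h $ j)) (at x)"
      by (rule has_derivative_compose[OF _ d, where f = "\<lambda>x. x - y" and f' = "\<lambda>h. h", simplified])
        (auto intro!: derivative_eq_intros)
    show "((\<lambda>x. w y * f (x - y)) has_derivative blinfun_apply (?fx x y)) (at x within UNIV)"
      by (rule has_derivative_eq_rhs[OF has_derivative_mult_right[OF d1]])
        (auto simp: inner_vec_def sum_distrib_left mult_ac)
  next
    show "(\<lambda>y. w y * f (x - y)) integrable_on cbox a b" for x
      by (rule integrable_continuous[OF cg[OF f]])
  next
    show "continuous_on (UNIV \<times> cbox a b) (\<lambda>(x, y). ?fx x y)"
      unfolding split_beta
      by (intro bounded_linear.continuous_on[OF bounded_linear_blinfun_inner_left] continuous_on_vec_lambda continuous_on_mult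
          continuous_on_compose2[OF w(1)] continuous_on_compose2[OF f'] continuous_intros) auto
  qed auto
  have "blinfun_apply (integral (cbox a b) (?fx x)) h = (\<Sum>j\<in>UNIV. (\<integral>y. w y * f' j (x - y) \<partial>lborel) * h $ j)" for h
  proof -
    have i: "?fx x integrable_on cbox a b"
      by (intro integrable_continuous bounded_linear.continuous_on[OF bounded_linear_blinfun_inner_left] continuous_on_vec_lambda cg[OF f'])
    have "blinfun_apply (integral (cbox a b) (?fx x)) h = integral (cbox a b) (\<lambda>y. blinfun_apply (?fx x y) h)"
      by (rule blinfun_apply_integral[OF i])
    also have "\<dots> = integral (cbox a b) (\<lambda>y. \<Sum>j\<in>UNIV. w y * f' j (x - y) * h $ j)"
      by (simp add: inner_vec_def mult_ac)
    also have "\<dots> = (\<Sum>j\<in>UNIV. integral (cbox a b) (\<lambda>y. w y * f' j (x - y) * h $ j))"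
      by (rule integral_sum) (auto intro!: integrable_continuous continuous_on_mult_right cg[OF f'])
    also have "\<dots> = (\<Sum>j\<in>UNIV. (\<integral>y. w y * f' j (x - y) \<partial>lborel) * h $ j)"
      by (simp add: eq[OF f'])
    finally show ?thesis .
  qed
  then have "blinfun_apply (integral (cbox a b) (?fx x)) = (\<lambda>h. \<Sum>j\<in>UNIV. (\<integral>y. w y * f' j (x - y) \<partial>lborel) * h $ j)" by auto
  then show ?thesis using D by (simp add: eq[OF f])
qed

text \<open>As derivatives fall on the second factor only, the convolutions of \<open>w\<close> with
  members of \<open>bump_alg\<close> form a class closed under differentiation.\<close>

lemma conv_smooth:
  fixes w :: "real^'n \<Rightarrow> real"
  assumes w: "continuous_on UNIV w" "\<And>x. x \<notin> cbox a b \<Longrightarrow> w x = 0" and f: "f \<in> bump_alg"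
  shows "smooth_fun (\<lambda>x. \<integral>y. w y * f (x - y) \<partial>lborel)"
proof (rule smooth_fun_closed_class[where S = "(\<lambda>f x. \<integral>y. w y * f (x - y) \<partial>lborel) ` bump_alg"])
  fix F assume "F \<in> (\<lambda>f x. \<integral>y. w y * f (x - y) \<partial>lborel) ` bump_alg"
  then obtain g where g: "g \<in> bump_alg" "F = (\<lambda>x. \<integral>y. w y * g (x - y) \<partial>lborel)" by blast
  obtain g' where g': "\<And>i. g' i \<in> bump_alg" "\<And>x. (g has_derivative (\<lambda>h. \<Sum>j\<in>UNIV. g' j x * h $ j)) (at x)"
    using bump_alg_has_derivative[OF g(1)] by blast
  show "\<exists>f'. (\<forall>i. f' i \<in> (\<lambda>f x. \<integral>y. w y * f (x - y) \<partial>lborel) ` bump_alg) \<and>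
      (\<forall>x. (F has_derivative (\<lambda>h. \<Sum>j\<in>UNIV. f' j x * h $ j)) (at x))"
    unfolding g(2)
    by (intro exI[of _ "\<lambda>i x. \<integral>y. w y * g' i (x - y) \<partial>lborel"] conjI allI imageI g'
        conv_has_derivative[OF w] bump_alg_continuous g)
qed (use f in auto)

lemma smooth_partial_bound:
  assumes s: "smooth_fun \<phi>" and L: "\<And>x y. \<bar>\<phi> x - \<phi> y\<bar> \<le> L * norm (x - y)"
  shows "\<bar>iter_pd \<phi> [i] x\<bar> \<le> L"
proof -
  have D: "(\<phi> has_derivative (\<lambda>h. \<Sum>j\<in>UNIV. iter_pd \<phi> [j] x * h $ j)) (at (x + 0 *\<^sub>R axis i 1))"
    using smooth_fun_has_derivative[OF s, of "[]" x] by simp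
  have "((\<lambda>t::real. x + t *\<^sub>R axis i 1) has_derivative (\<lambda>t. t *\<^sub>R axis i 1)) (at 0)"
    by (auto intro!: derivative_eq_intros)
  from has_derivative_compose[OF this D]
  have "((\<lambda>t::real. \<phi> (x + t *\<^sub>R axis i 1)) has_derivative (\<lambda>t. \<Sum>j\<in>UNIV. iter_pd \<phi> [j] x * (t *\<^sub>R axis i 1) $ j)) (at 0)" .
  moreover have "(\<lambda>t. \<Sum>j\<in>UNIV. iter_pd \<phi> [j] x * (t *\<^sub>R axis i 1) $ j) = (\<lambda>t. iter_pd \<phi> [i] x * t)"
    by (simp add: axis_def if_distrib cong: if_cong)
  ultimately have "((\<lambda>t::real. \<phi> (x + t *\<^sub>R axis i 1)) has_real_derivative iter_pd \<phi> [i] x) (at 0)"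
    by (simp add: has_field_derivative_def)
  then have "((\<lambda>t::real. (\<phi> (x + t *\<^sub>R axis i 1) - \<phi> x) / t) \<longlongrightarrow> iter_pd \<phi> [i] x) (at 0)"
    by (simp add: DERIV_def)
  then have lim: "((\<lambda>t::real. \<bar>(\<phi> (x + t *\<^sub>R axis i 1) - \<phi> x) / t\<bar>) \<longlongrightarrow> \<bar>iter_pd \<phi> [i] x\<bar>) (at 0)"
    by (rule tendsto_rabs)
  have "\<forall>\<^sub>F t in at 0. \<bar>(\<phi> (x + t *\<^sub>R axis i 1) - \<phi> x) / t\<bar> \<le> L"
    unfolding eventually_at_filter
  proof (intro always_eventually allI impI)
    fix t :: real assume t: "t \<noteq> 0"
    have "\<bar>\<phi> (x + t *\<^sub>R axis i 1) - \<phi> x\<bar> \<le> L * \<bar>t\<bar>"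
      using L[of "x + t *\<^sub>R axis i 1" x] by simp
    then show "\<bar>(\<phi> (x + t *\<^sub>R axis i 1) - \<phi> x) / t\<bar> \<le> L" using t by (simp add: abs_div pos_divide_le_eq)
  qed
  then show ?thesis by (rule tendsto_upperbound[OF lim]) simp
qed

text \<open>The last two clauses serve the finite element argument: averages inherit a Lipschitz
  constant, which bounds all partial derivatives, and averaging an affine function against a kernel
  of mass one changes only its constant term, so the gradient is reproduced exactly.\<close>

lemma mollification:
  fixes w :: "real^'n \<Rightarrow> real"
  assumes r: "r > 0" and w: "continuous_on UNIV w" "\<And>x. x \<notin> cbox a b \<Longrightarrow> w x = 0"
  obtains \<phi> where "smooth_fun \<phi>"
    "\<And>x. \<phi> x \<noteq> 0 \<Longrightarrow> \<exists>z\<in>ball x r. w z \<noteq> 0"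
    "\<And>x e. (\<And>z. z \<in> ball x r \<Longrightarrow> \<bar>w z - w x\<bar> \<le> e) \<Longrightarrow> \<bar>\<phi> x - w x\<bar> \<le> e"
    "\<And>L x i. (\<And>x y. \<bar>w x - w y\<bar> \<le> L * norm (x - y)) \<Longrightarrow> \<bar>iter_pd \<phi> [i] x\<bar> \<le> L"
    "\<And>x c s d i. r < s \<Longrightarrow> (\<And>z. z \<in> ball x s \<Longrightarrow> w z = c \<bullet> z + d) \<Longrightarrow> iter_pd \<phi> [i] x = c $ i"
proof -
  obtain \<eta> :: "real^'n \<Rightarrow> real" where \<eta>: "\<eta> \<in> bump_alg" "\<And>x. 0 \<le> \<eta> x" "\<And>x. r \<le> norm x \<Longrightarrow> \<eta> x = 0"
    "integrable lborel \<eta>" "(\<integral>x. \<eta> x \<partial>lborel) = 1"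
    using mollifier_exists[OF r] by metis
  have [measurable]: "\<eta> \<in> borel_measurable borel" "w \<in> borel_measurable borel"
    using bump_alg_continuous[OF \<eta>(1)] w(1) by (auto intro: borel_measurable_continuous_onI)
  have c\<eta>: "continuous_on A \<eta>" for A by (rule bump_alg_continuous[OF \<eta>(1)])
  define \<phi> where "\<phi> x = (\<integral>y. w y * \<eta> (x - y) \<partial>lborel)" for x
  have i0: "integrable lborel (\<lambda>y. w y * \<eta> (x - y))" for x
    by (rule integrable_continuous_compact_support[of _ a b])
      (auto intro!: continuous_intros w continuous_on_compose2[OF c\<eta>] simp: w)
  have \<phi>: "\<phi> x = (\<integral>y. w (x - y) * \<eta> y \<partial>lborel)" for x
    using lborel_integral_reflect(1)[of "\<lambda>y. w y * \<eta> (x - y)" x] by (simp add: \<phi>_def)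
  have i: "integrable lborel (\<lambda>y. w (x - y) * \<eta> y)" for x
    using lborel_integral_reflect(2)[of "\<lambda>y. w y * \<eta> (x - y)" x] i0[of x] by simp
  have avg: "\<bar>\<integral>y. g y * \<eta> y \<partial>lborel\<bar> \<le> e" if "integrable lborel (\<lambda>y. g y * \<eta> y)" "\<And>y. norm y < r \<Longrightarrow> \<bar>g y\<bar> \<le> e" for g e
  proof -
    have "\<bar>\<integral>y. g y * \<eta> y \<partial>lborel\<bar> \<le> (\<integral>y. \<bar>g y * \<eta> y\<bar> \<partial>lborel)" by (rule integral_abs_bound)
    also have "\<dots> \<le> (\<integral>y. e * \<eta> y \<partial>lborel)"
    proof (rule integral_mono)
      fix y
      show "\<bar>g y * \<eta> y\<bar> \<le> e * \<eta> y"
        using that(2)[of y] \<eta>(2)[of y] \<eta>(3)[of y] by (cases "norm y < r") (auto simp: abs_mult intro!: mult_right_mono)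
    qed (use that \<eta> in auto)
    also have "\<dots> = e" using \<eta>(5) by simp
    finally show ?thesis .
  qed
  have sm: "smooth_fun \<phi>" unfolding \<phi>_def[abs_def] by (rule conv_smooth[OF w \<eta>(1)])
  show ?thesis
  proof (rule that[OF sm])
    fix x assume x: "\<phi> x \<noteq> 0"
    show "\<exists>z\<in>ball x r. w z \<noteq> 0"
    proof (rule ccontr)
      assume "\<not> ?thesis"
      then have "(\<lambda>y. w (x - y) * \<eta> y) = (\<lambda>y. 0)"
        using \<eta>(3) by (intro ext) (auto simp: dist_norm not_less[symmetric])
      then show False using x by (simp add: \<phi>)
    qed
  next
    fix x e assume e: "\<And>z. z \<in> ball x r \<Longrightarrow> \<bar>w z - w x\<bar> \<le> e"
    have "\<phi> x - w x = (\<integral>y. (w (x - y) - w x) * \<eta> y \<partial>lborel)"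
      using i[of x] \<eta>(4,5) by (simp add: \<phi> left_diff_distrib)
    also have "\<bar>\<dots>\<bar> \<le> e"
      using i[of x] \<eta>(4) e by (intro avg) (auto simp: left_diff_distrib dist_norm)
    finally show "\<bar>\<phi> x - w x\<bar> \<le> e" .
  next
    fix L x i' assume L: "\<And>x y. \<bar>w x - w y\<bar> \<le> L * norm (x - y)"
    have "\<bar>\<phi> x - \<phi> y\<bar> \<le> L * norm (x - y)" for x y
    proof -
      have "\<phi> x - \<phi> y = (\<integral>z. (w (x - z) - w (y - z)) * \<eta> z \<partial>lborel)"
        using i[of x] i[of y] by (simp add: \<phi> left_diff_distrib)
      also have "\<bar>\<dots>\<bar> \<le> L * norm (x - y)"
      proof (rule avg)
        show "integrable lborel (\<lambda>z. (w (x - z) - w (y - z)) * \<eta> z)"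
          using i[of x] i[of y] by (simp add: left_diff_distrib)
        show "\<bar>w (x - z) - w (y - z)\<bar> \<le> L * norm (x - y)" for z using L[of "x - z" "y - z"] by simp
      qed
      finally show ?thesis .
    qed
    then show "\<bar>iter_pd \<phi> [i'] x\<bar> \<le> L" by (rule smooth_partial_bound[OF sm])
  next
    fix x c s d i' assume s: "r < s" and aff: "\<And>z. z \<in> ball x s \<Longrightarrow> w z = c \<bullet> z + d"
    \<comment> \<open>For \<open>y\<close> within \<open>s - r\<close> of \<open>x\<close> the
      kernel sees only the region where \<open>w\<close> is affine. The mean of the remaining terms
      does not depend on \<open>y\<close>; it is the constant term \<open>k\<close>, which
      differentiation removes.\<close>
    define k where "k = (\<integral>y. (d - c \<bullet> y) * \<eta> y \<partial>lborel)"
    have eq: "\<phi> y = c \<bullet> y + k" if y: "y \<in> ball x (s - r)" for y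
    proof -
      have *: "w (y - z) * \<eta> z = (c \<bullet> y) * \<eta> z + (d - c \<bullet> z) * \<eta> z" for z
      proof (cases "norm z < r")
        case True
        have "dist x (y - z) \<le> dist x y + norm z" 
          using norm_triangle_ineq[of "x - y" z] by (simp add: dist_norm algebra_simps)
        then have "y - z \<in> ball x s" using y True by simp
        then show ?thesis using aff by (simp add: inner_diff_right algebra_simps)
      qed (simp add: \<eta>(3))
      have "integrable lborel (\<lambda>z. (c \<bullet> y) * \<eta> z + (d - c \<bullet> z) * \<eta> z)" using i[of y] by (simp add: *)
      then have "integrable lborel (\<lambda>z. ((c \<bullet> y) * \<eta> z + (d - c \<bullet> z) * \<eta> z) - (c \<bullet> y) * \<eta> z)"
        using \<eta>(4) by (intro Bochner_Integration.integrable_diff) auto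
      then have "integrable lborel (\<lambda>z. (d - c \<bullet> z) * \<eta> z)" by simp
      then show ?thesis using \<eta>(4,5) by (simp add: \<phi> * k_def)
    qed
    have "((\<lambda>y. c \<bullet> y + k) has_derivative (\<lambda>h. c \<bullet> h)) (at x)" by (auto intro!: derivative_eq_intros)
    then have "(\<phi> has_derivative (\<lambda>h. c \<bullet> h)) (at x)"
      by (rule has_derivative_transform_within_open[OF _ open_ball[of x "s - r"]]) (use s eq in auto)
    then show "iter_pd \<phi> [i'] x = c $ i'" by (rule iter_pd_eq_inner[OF sm])
  qed
qed

text \<open>The integral of \<open>x \<mapsto> g (x - y)\<close> against a cutoff is constant for small \<open>x\<close>; differentiate it at 0.\<close>
lemma integral_partial_eq_0:
  fixes g :: "real^'n \<Rightarrow> real"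
  assumes g: "continuous_on UNIV g" and g': "\<And>i. continuous_on UNIV (g' i)"
    and d: "\<And>x. (g has_derivative (\<lambda>h. \<Sum>j\<in>UNIV. g' j x * h $ j)) (at x)"
    and R: "\<And>x. R < norm x \<Longrightarrow> g x = 0" and R': "\<And>i x. R < norm x \<Longrightarrow> g' i x = 0"
  shows "(\<integral>x. g' i x \<partial>lborel) = 0"
proof -
  \<comment> \<open>The cutoff is 1 on the ball of radius \<open>\<bar>R\<bar> + 1\<close>, which
    contains the support of \<open>\<lambda>y. g (x - y)\<close> whenever \<open>norm x < 1\<close>.
    Its own compact support makes \<open>conv_has_derivative\<close> applicable.\<close>
  define w where "w y = max 0 (min 1 (\<bar>R\<bar> + 2 - norm y))" for y :: "real^'n"
  have w: "continuous_on UNIV w" unfolding w_def by (intro continuous_intros)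
  have w1: "w y = 1" if "norm y \<le> \<bar>R\<bar> + 1" for y using that by (simp add: w_def)
  obtain a b :: "real^'n" where "cball 0 (\<bar>R\<bar> + 2) \<subseteq> cbox a b"
    using bounded_subset_cbox_symmetric[OF bounded_cball] by metis
  then have w0: "w y = 0" if "y \<notin> cbox a b" for y using that by (force simp: w_def)
  have [measurable]: "g \<in> borel_measurable borel" "g' i \<in> borel_measurable borel"
    using g g' by (auto intro: borel_measurable_continuous_onI)
  let ?F = "\<lambda>x. \<integral>y. w y * g (x - y) \<partial>lborel"
  have D: "(?F has_derivative (\<lambda>h. \<Sum>j\<in>UNIV. (\<integral>y. w y * g' j (0 - y) \<partial>lborel) * h $ j)) (at 0)"
    by (rule conv_has_derivative[OF w w0 g g' d])
  have F: "?F x = (\<integral>y. g y \<partial>lborel)" if "x \<in> ball 0 1" for x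
  proof -
    have "w y * g (x - y) = g (x - y)" for y
    proof (cases "R < norm (x - y)")
      case False
      have "norm y \<le> norm x + norm (x - y)" by (metis norm_triangle_sub norm_minus_commute)
      then have "norm y \<le> \<bar>R\<bar> + 1" using False that by simp
      then show ?thesis by (simp add: w1)
    qed (simp add: R)
    then have "(\<lambda>y. w y * g (x - y)) = (\<lambda>y. g (x - y))" by (rule ext)
    then show ?thesis using lborel_integral_reflect(1)[of g x] by simp
  qed
  have "((\<lambda>x. \<integral>y. g y \<partial>lborel) has_derivative (\<lambda>h. 0)) (at 0)" by simp
  then have "(?F has_derivative (\<lambda>h. 0)) (at 0)"
    by (rule has_derivative_transform_within_open[OF _ open_ball[of 0 1]]) (use F in auto)
  then have "(\<lambda>h. \<Sum>j\<in>UNIV. (\<integral>y. w y * g' j (0 - y) \<partial>lborel) * h $ j) = (\<lambda>h. 0)"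
    by (rule has_derivative_unique[OF D])
  from fun_cong[OF this, of "axis i 1"] have 0: "(\<integral>y. w y * g' i (0 - y) \<partial>lborel) = 0"
    by (simp add: axis_def if_distrib cong: if_cong)
  have "w y * g' i (0 - y) = g' i (0 - y)" for y
    using w1[of y] R'[of "0 - y" i] by (cases "R < norm y") auto
  then have "(\<lambda>y. w y * g' i (0 - y)) = (\<lambda>y. g' i (0 - y))" by (rule ext)
  then have "(\<integral>y. g' i (0 - y) \<partial>lborel) = 0" using 0 by simp
  then show ?thesis using lborel_integral_reflect(1)[of "g' i" 0] by simp
qed

section \<open>Integration by parts and smooth approximation of indicators\<close>

lemma lebesgue_on_integral_eq_lborel:
  fixes F :: "real^'n \<Rightarrow> real"
  assumes "open D" and F: "F \<in> borel_measurable borel" and "\<And>x. x \<notin> D \<Longrightarrow> F x = 0"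
  shows "(\<integral>x. F x \<partial>lebesgue_on D) = (\<integral>x. F x \<partial>lborel)"
proof -
  have D: "D \<in> sets lebesgue" using assms(1) by (simp add: lmeasurable_open)
  have "(\<integral>x. F x \<partial>lebesgue_on D) = (\<integral>x. indicator D x *\<^sub>R F x \<partial>lebesgue)"
    using D by (intro integral_restrict_space) auto
  also have "(\<lambda>x. indicator D x *\<^sub>R F x) = F" using assms(3) by (intro ext) (auto simp: indicator_def)
  also have "(\<integral>x. F x \<partial>lebesgue) = (\<integral>x. F x \<partial>lborel)" using F by (intro integral_completion) auto
  finally show ?thesis .
qed

lemma iter_pd_outside_support:
  assumes "smooth_fun \<phi>" "x \<notin> closure {x. \<phi> x \<noteq> 0}"
  shows "iter_pd \<phi> [i] x = 0"
proof -
  have "((\<lambda>x. 0) has_derivative (\<lambda>h. 0 \<bullet> h)) (at x)" by simp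
  moreover have "open (- closure {x. \<phi> x \<noteq> 0})" by (intro open_Compl closed_closure)
  ultimately have "(\<phi> has_derivative (\<lambda>h. 0 \<bullet> h)) (at x)"
    by (rule has_derivative_transform_within_open)
      (use assms closure_subset[of "{x. \<phi> x \<noteq> 0}"] in auto)
  then show ?thesis using iter_pd_eq_inner[OF assms(1)] by fastforce
qed

text \<open>The product rule applied to \<open>u * \<phi>\<close>, whose partial derivative is
  continuous with compact support and so has integral zero. As that support lies in
  \<open>D\<close>, integrals over \<open>D\<close> and over the whole space agree.\<close>

lemma integration_by_parts:
  fixes u \<phi> :: "real^'n \<Rightarrow> real"
  assumes D: "open D" and u: "smooth_fun u" and t: "test_fun D \<phi>"
  shows "(\<integral>x. u x * iter_pd \<phi> [i] x \<partial>lebesgue_on D) = - (\<integral>x. iter_pd u [i] x * \<phi> x \<partial>lebesgue_on D)"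
proof -
  let ?S = "closure {x. \<phi> x \<noteq> 0}"
  have s: "smooth_fun \<phi>" "compact ?S" "?S \<subseteq> D" using t by (auto simp: test_fun_def)
  have z: "\<phi> x = 0" "iter_pd \<phi> [j] x = 0" if "x \<notin> ?S" for x j
    using that iter_pd_outside_support[OF s(1) that] closure_subset[of "{x. \<phi> x \<noteq> 0}"] by auto
  obtain R where R: "\<And>x. x \<in> ?S \<Longrightarrow> norm x \<le> R" using compact_imp_bounded[OF s(2)] by (auto simp: bounded_iff)
  have c: "continuous_on A u" "continuous_on A \<phi>" "continuous_on A (iter_pd u [j])" "continuous_on A (iter_pd \<phi> [j])" for A j
    using smooth_fun_continuous[OF u, of A "[]"] smooth_fun_continuous[OF s(1), of A "[]"]
    by (auto intro: smooth_fun_continuous u s)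
  obtain a b where ab: "?S \<subseteq> cbox a b" using bounded_subset_cbox_symmetric[OF compact_imp_bounded[OF s(2)]] by metis
  let ?g = "\<lambda>x. u x * \<phi> x" and ?g' = "\<lambda>j x. u x * iter_pd \<phi> [j] x + iter_pd u [j] x * \<phi> x"
  have "(\<integral>x. ?g' i x \<partial>lborel) = 0"
  proof (rule integral_partial_eq_0[where g = ?g and R = R])
    show "continuous_on UNIV ?g" "\<And>i. continuous_on UNIV (?g' i)" by (intro continuous_intros c)+
    show "?g x = 0" "?g' j x = 0" if "R < norm x" for x j
      using z[of x] R[of x] that by (cases "x \<in> ?S"; force)+
    fix x
    show "(?g has_derivative (\<lambda>h. \<Sum>j\<in>UNIV. ?g' j x * h $ j)) (at x)"
      by (rule has_derivative_eq_rhs[OF has_derivative_mult[OF smooth_fun_has_derivative[OF u, of "[]", simplified] smooth_fun_has_derivative[OF s(1), of "[]", simplified]]])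
        (auto simp: sum_distrib_left sum_distrib_right sum.distrib[symmetric] algebra_simps intro!: ext sum.cong)
  qed
  moreover have "integrable lborel (\<lambda>x. u x * iter_pd \<phi> [i] x)" "integrable lborel (\<lambda>x. iter_pd u [i] x * \<phi> x)"
  proof -
    have z': "\<phi> x = 0" "iter_pd \<phi> [i] x = 0" if "x \<notin> cbox a b" for x using z[of x] ab that by blast+
    show "integrable lborel (\<lambda>x. u x * iter_pd \<phi> [i] x)" "integrable lborel (\<lambda>x. iter_pd u [i] x * \<phi> x)"
      by (rule integrable_continuous_compact_support(1)[of _ a b]; (intro continuous_intros c | simp add: z'))+
  qed
  ultimately have "(\<integral>x. u x * iter_pd \<phi> [i] x \<partial>lborel) = - (\<integral>x. iter_pd u [i] x * \<phi> x \<partial>lborel)" by simp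
  moreover have "(\<integral>x. u x * iter_pd \<phi> [i] x \<partial>lebesgue_on D) = (\<integral>x. u x * iter_pd \<phi> [i] x \<partial>lborel)"
    "(\<integral>x. iter_pd u [i] x * \<phi> x \<partial>lebesgue_on D) = (\<integral>x. iter_pd u [i] x * \<phi> x \<partial>lborel)"
  proof -
    have z': "\<phi> x = 0" "iter_pd \<phi> [i] x = 0" if "x \<notin> D" for x using z[of x] s(3) that by blast+
    show "(\<integral>x. u x * iter_pd \<phi> [i] x \<partial>lebesgue_on D) = (\<integral>x. u x * iter_pd \<phi> [i] x \<partial>lborel)"
      "(\<integral>x. iter_pd u [i] x * \<phi> x \<partial>lebesgue_on D) = (\<integral>x. iter_pd u [i] x * \<phi> x \<partial>lborel)"
      by (rule lebesgue_on_integral_eq_lborel[OF D];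
          (intro borel_measurable_continuous_onI continuous_intros c | simp add: z'))+
  qed
  ultimately show ?thesis by simp
qed

lemma integrable_restrict_compact:
  fixes h :: "real^'n \<Rightarrow> real"
  assumes D: "D \<in> sets lebesgue" and K: "K \<in> sets lebesgue" "K \<subseteq> D" and h: "integrable (lebesgue_on K) h"
  shows "integrable (lebesgue_on D) (\<lambda>x. indicator K x * h x)"
    "(\<integral>x. indicator K x * h x \<partial>lebesgue_on D) = (\<integral>x. h x \<partial>lebesgue_on K)"
proof -
  have ind: "indicator D x * (indicator K x * h x) = indicator K x * h x" for x
    using K by (auto simp: indicator_def)
  show "integrable (lebesgue_on D) (\<lambda>x. indicator K x * h x)"
    using h D K by (simp add: integrable_restrict_space ind)
  show "(\<integral>x. indicator K x * h x \<partial>lebesgue_on D) = (\<integral>x. h x \<partial>lebesgue_on K)"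
    using D K by (simp add: integral_restrict_space ind)
qed

lemma L1loc_mult_integrable:
  fixes h :: "real^'n \<Rightarrow> real"
  assumes D: "open D" and h: "L1loc D h" and K: "compact K" "K \<subseteq> D"
    and p: "\<phi> \<in> borel_measurable (lebesgue_on D)" and b: "\<And>x. \<bar>\<phi> x\<bar> \<le> b" and z: "\<And>x. x \<notin> K \<Longrightarrow> \<phi> x = 0"
  shows "integrable (lebesgue_on D) (\<lambda>x. h x * \<phi> x)"
proof (rule Bochner_Integration.integrable_bound)
  have [measurable]: "h \<in> borel_measurable (lebesgue_on D)" "\<phi> \<in> borel_measurable (lebesgue_on D)"
    using h p by (auto simp: L1loc_def)
  have hK: "integrable (lebesgue_on K) h" using h K by (auto simp: L1loc_def)
  have sets: "D \<in> sets lebesgue" "K \<in> sets lebesgue" using D K by (auto simp: borel_compact)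
  show "integrable (lebesgue_on D) (\<lambda>x. b * (indicator K x * h x))"
    by (intro integrable_mult_right integrable_restrict_compact(1)[OF sets K(2) hK])
  show "(\<lambda>x. h x * \<phi> x) \<in> borel_measurable (lebesgue_on D)" by measurable
  show "AE x in lebesgue_on D. norm (h x * \<phi> x) \<le> norm (b * (indicator K x * h x))"
  proof (rule AE_I2)
    fix x
    show "norm (h x * \<phi> x) \<le> norm (b * (indicator K x * h x))"
      using b[of x] z[of x] by (cases "x \<in> K") (auto simp: abs_mult mult.commute[of "\<bar>h x\<bar>"] intro!: mult_right_mono)
  qed
qed

text \<open>The tents \<open>w n\<close> of slope \<open>m n\<close> over \<open>A\<close> tend
  pointwise to the indicator. Mollifying them at radius \<open>1 / (m n)^2\<close> costs at most
  \<open>m n * (1 / (m n)^2) = 1 / m n\<close>, which tends to zero. Bounding all supports by one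
  compact \<open>K\<close> prepares for dominated convergence.\<close>

lemma smooth_indicator_approximation:
  fixes A :: "(real^'n) set"
  assumes D: "open D" and A: "compact A" "A \<noteq> {}" "A \<subseteq> D"
  obtains \<phi> K where "compact K" "K \<subseteq> D" "\<And>n. test_fun D (\<phi> n)" "\<And>n x. \<bar>\<phi> n x\<bar> \<le> 2" "\<And>n x. x \<notin> K \<Longrightarrow> \<phi> n x = 0"
    "\<And>x. (\<lambda>n. \<phi> n x) \<longlonglongrightarrow> indicator A x"
proof -
  obtain \<epsilon> where e: "\<epsilon> > 0" "(\<Union>x\<in>A. cball x \<epsilon>) \<subseteq> D"
    using compact_subset_open_imp_cball_epsilon_subset[OF A(1) D A(3)] by metis
  define K where "K = {x. infdist x A \<le> \<epsilon>}"
  have K: "compact K" unfolding K_def by (rule compact_infdist_le[OF A(2,1) e(1)])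
  have KD: "K \<subseteq> D"
  proof
    fix x assume "x \<in> K"
    moreover obtain y where "y \<in> A" "infdist x A = dist x y"
      using infdist_attains_inf[OF compact_imp_closed[OF A(1)] A(2)] by metis
    ultimately have "x \<in> cball y \<epsilon>" "y \<in> A" by (auto simp: K_def dist_commute)
    then show "x \<in> D" using e(2) by blast
  qed
  \<comment> \<open>The summand \<open>2 / \<epsilon>\<close> keeps the tent and its mollification
    within distance \<open>\<epsilon>\<close> of \<open>A\<close>, for every \<open>n\<close>; the
    summand \<open>Suc n\<close> lets the slopes tend to infinity.\<close>
  define m where "m n = real (Suc n) + 2 / \<epsilon>" for n
  have m: "m n \<ge> 1" "2 / m n \<le> \<epsilon>" "m n \<ge> real n" for n
  proof -
    have "2 / \<epsilon> > 0" using e by simp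
    then show "m n \<ge> 1" "m n \<ge> real n" by (auto simp: m_def)
    have "2 / \<epsilon> \<le> m n" by (simp add: m_def)
    then show "2 / m n \<le> \<epsilon>" using e \<open>m n \<ge> 1\<close> by (simp add: field_simps)
  qed
  define w where "w n x = max 0 (1 - m n * infdist x A)" for n x
  have wc: "continuous_on UNIV (w n)" for n unfolding w_def by (intro continuous_intros)
  have wL: "\<bar>w n x - w n y\<bar> \<le> m n * norm (x - y)" for n x y
  proof -
    have "\<bar>w n x - w n y\<bar> \<le> \<bar>m n * infdist x A - m n * infdist y A\<bar>" unfolding w_def by linarith
    also have "\<dots> = m n * \<bar>infdist x A - infdist y A\<bar>" using m(1)[of n] by (simp add: abs_mult flip: right_diff_distrib)
    also have "\<dots> \<le> m n * norm (x - y)"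
      using m(1)[of n] infdist_triangle_abs[of x A y] by (intro mult_left_mono) (auto simp: dist_norm)
    finally show ?thesis .
  qed
  have wz: "infdist z A < 1 / m n" if "w n z \<noteq> 0" for n z
    using that m(1)[of n] by (auto simp: w_def field_simps max_def split: if_splits)
  obtain a b where ab: "K \<subseteq> cbox a b" using bounded_subset_cbox_symmetric[OF compact_imp_bounded[OF K]] by metis
  have inv: "1 / (m n)\<^sup>2 \<le> 1 / m n" for n using m(1)[of n] by (simp add: power2_eq_square field_simps)
  have m2: "1 / m n + 1 / m n \<le> \<epsilon>" for n using m(2)[of n] by simp
  have "\<exists>\<phi>. smooth_fun \<phi> \<and> (\<forall>x. x \<notin> K \<longrightarrow> \<phi> x = 0) \<and> (\<forall>x. \<bar>\<phi> x - w n x\<bar> \<le> 1 / m n)" for n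
  proof -
    have r: "1 / (m n)\<^sup>2 > 0" using m(1)[of n] by simp
    have w0: "w n x = 0" if "x \<notin> cbox a b" for x
    proof (rule ccontr)
      assume "w n x \<noteq> 0"
      then have "infdist x A < 1 / m n" by (rule wz)
      then have "x \<in> K" using m2[of n] m(1)[of n] unfolding K_def by (simp, smt (verit) divide_nonneg_nonneg)
      then show False using ab that by auto
    qed
    obtain \<phi> where \<phi>: "smooth_fun \<phi>" "\<And>x. \<phi> x \<noteq> 0 \<Longrightarrow> \<exists>z\<in>ball x (1 / (m n)\<^sup>2). w n z \<noteq> 0"
      "\<And>x e. (\<And>z. z \<in> ball x (1 / (m n)\<^sup>2) \<Longrightarrow> \<bar>w n z - w n x\<bar> \<le> e) \<Longrightarrow> \<bar>\<phi> x - w n x\<bar> \<le> e"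
      using mollification[OF r wc[of n] w0] by metis
    have "\<phi> x = 0" if "x \<notin> K" for x
    proof (rule ccontr)
      assume "\<phi> x \<noteq> 0"
      then obtain z where z: "z \<in> ball x (1 / (m n)\<^sup>2)" "w n z \<noteq> 0" using \<phi>(2) by blast
      have "infdist x A \<le> infdist z A + dist x z" by (rule infdist_triangle)
      also have "\<dots> \<le> 1 / m n + 1 / m n" using wz[OF z(2)] z(1) inv[of n] by simp
      finally show False using that m2[of n] by (simp add: K_def)
    qed
    moreover have "\<bar>\<phi> x - w n x\<bar> \<le> 1 / m n" for x
    proof (rule \<phi>(3))
      fix z assume z: "z \<in> ball x (1 / (m n)\<^sup>2)"
      have "\<bar>w n z - w n x\<bar> \<le> m n * norm (z - x)" by (rule wL)
      also have "\<dots> \<le> m n * (1 / (m n)\<^sup>2)" using z m(1)[of n] by (intro mult_left_mono) (auto simp: dist_norm norm_minus_commute)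
      also have "\<dots> = 1 / m n" using m(1)[of n] by (simp add: power2_eq_square)
      finally show "\<bar>w n z - w n x\<bar> \<le> 1 / m n" .
    qed
    ultimately show ?thesis using \<phi>(1) by blast
  qed
  then obtain \<phi> where \<phi>: "\<And>n. smooth_fun (\<phi> n)" "\<And>n x. x \<notin> K \<Longrightarrow> \<phi> n x = 0" "\<And>n x. \<bar>\<phi> n x - w n x\<bar> \<le> 1 / m n"
    by metis
  show ?thesis
  proof (rule that[OF K KD])
    fix n x
    have "{x. \<phi> n x \<noteq> 0} \<subseteq> K" using \<phi>(2) by blast
    then have "closure {x. \<phi> n x \<noteq> 0} \<subseteq> K" by (rule closure_minimal) (rule compact_imp_closed[OF K])
    then show "test_fun D (\<phi> n)" unfolding test_fun_def
      using \<phi>(1) KD K compact_Int_closed[OF K closed_closure, of "{x. \<phi> n x \<noteq> 0}"] by (simp add: Int_absorb1)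
    have "0 \<le> w n x" "w n x \<le> 1" using m(1)[of n] infdist_nonneg[of x A] by (auto simp: w_def)
    moreover have "1 / m n \<le> 1" using m(1)[of n] by simp
    ultimately show "\<bar>\<phi> n x\<bar> \<le> 2" using \<phi>(3)[of n x] by linarith
    show "x \<notin> K \<Longrightarrow> \<phi> n x = 0" by (rule \<phi>)
  next
    fix x
    have minf: "filterlim m at_top sequentially"
      by (rule filterlim_at_top_mono[OF filterlim_real_sequentially]) (use m(3) in auto)
    have "(\<lambda>n. 1 / m n) \<longlonglongrightarrow> 0" by (rule tendsto_divide_0[OF tendsto_const filterlim_at_top_imp_at_infinity[OF minf]])
    then have "(\<lambda>n. \<phi> n x - w n x) \<longlonglongrightarrow> 0" by (rule Lim_null_comparison[rotated]) (use \<phi>(3) in auto)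
    moreover have "(\<lambda>n. w n x) \<longlonglongrightarrow> indicator A x"
    proof (cases "x \<in> A")
      case True
      then show ?thesis by (simp add: w_def)
    next
      case False
      then have pos: "infdist x A > 0"
        using A compact_imp_closed[OF A(1)] by (simp add: infdist_pos_not_in_closed)
      have "\<forall>\<^sub>F n in sequentially. m n \<ge> 1 / infdist x A" using minf by (simp add: filterlim_at_top)
      then have "\<forall>\<^sub>F n in sequentially. 0 = w n x"
        by eventually_elim (use pos in \<open>simp add: w_def field_simps\<close>)
      then have "(\<lambda>n. w n x) \<longlonglongrightarrow> 0" by (rule Lim_transform_eventually[OF tendsto_const])
      then show ?thesis using False by simp
    qed
    ultimately have "(\<lambda>n. (\<phi> n x - w n x) + w n x) \<longlonglongrightarrow> 0 + indicator A x" by (rule tendsto_add)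
    then show "(\<lambda>n. \<phi> n x) \<longlonglongrightarrow> indicator A x" by simp
  qed
qed

section \<open>Weak derivatives\<close>

text \<open>The indicator of the box is a bounded pointwise limit of test functions supported in one
  compact set, on which \<open>h\<close> is integrable; dominated convergence carries the hypothesis
  over to the limit.\<close>

lemma box_integral_eq_0:
  fixes h :: "real^'n \<Rightarrow> real"
  assumes D: "open D" and h: "L1loc D h" and ab: "cbox a b \<subseteq> D"
    and zero: "\<And>\<phi>. test_fun D \<phi> \<Longrightarrow> (\<integral>x. h x * \<phi> x \<partial>lebesgue_on D) = 0"
  shows "integral (cbox a b) h = 0"
proof (cases "cbox a b = {}")
  case False
  obtain \<phi> K where K: "compact K" "K \<subseteq> D" and \<phi>: "\<And>n. test_fun D (\<phi> n)" "\<And>n x. \<bar>\<phi> n x\<bar> \<le> 2" "\<And>n x. x \<notin> K \<Longrightarrow> \<phi> n x = 0"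
    "\<And>x. (\<lambda>n. \<phi> n x) \<longlonglongrightarrow> indicator (cbox a b) x"
    using smooth_indicator_approximation[OF D compact_cbox False ab] by metis
  have sets: "D \<in> sets lebesgue" "K \<in> sets lebesgue" "cbox a b \<in> sets lebesgue" using D K by (auto simp: borel_compact)
  have hm [measurable]: "h \<in> borel_measurable (lebesgue_on D)" using h by (simp add: L1loc_def)
  have \<phi>m [measurable]: "\<phi> n \<in> borel_measurable (lebesgue_on D)" for n
    using smooth_fun_continuous[of "\<phi> n" D "[]"] \<phi>(1)[of n] sets by (auto simp: test_fun_def intro: continuous_imp_measurable_on_sets_lebesgue)
  have hK: "integrable (lebesgue_on K) h" and hab: "integrable (lebesgue_on (cbox a b)) h" using h K ab by (auto simp: L1loc_def)
  have ab': "indicator (cbox a b) \<in> borel_measurable (lebesgue_on D)"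
    using sets by (intro borel_measurable_indicator) (auto simp: sets_restrict_space_iff ab)
  have "(\<lambda>n. \<integral>x. h x * \<phi> n x \<partial>lebesgue_on D) \<longlonglongrightarrow> (\<integral>x. h x * indicator (cbox a b) x \<partial>lebesgue_on D)"
  proof (rule integral_dominated_convergence[where w = "\<lambda>x. 2 * \<bar>indicator K x * h x\<bar>"])
    show "integrable (lebesgue_on D) (\<lambda>x. 2 * \<bar>indicator K x * h x\<bar>)"
      by (intro integrable_mult_right integrable_abs integrable_restrict_compact(1)[OF sets(1,2) K(2) hK])
    show "(\<lambda>x. h x * indicator (cbox a b) x) \<in> borel_measurable (lebesgue_on D)" using ab' by measurable
    show "AE x in lebesgue_on D. (\<lambda>n. h x * \<phi> n x) \<longlonglongrightarrow> h x * indicator (cbox a b) x"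
      by (intro AE_I2 tendsto_mult tendsto_const \<phi>)
    show "AE x in lebesgue_on D. norm (h x * \<phi> n x) \<le> 2 * \<bar>indicator K x * h x\<bar>" for n
    proof (rule AE_I2)
      fix x
      show "norm (h x * \<phi> n x) \<le> 2 * \<bar>indicator K x * h x\<bar>"
        using \<phi>(2)[of n x] \<phi>(3)[of x n] by (cases "x \<in> K") (auto simp: abs_mult mult.commute[of "\<bar>h x\<bar>"] intro!: mult_right_mono)
    qed
  qed measurable
  then have "(\<integral>x. indicator (cbox a b) x * h x \<partial>lebesgue_on D) = 0"
    using zero[OF \<phi>(1)] by (simp add: LIMSEQ_const_iff mult.commute)
  then show ?thesis
    using integrable_restrict_compact(2)[OF sets(1,3) ab hab] lebesgue_integral_eq_integral[OF hab sets(3)] by simp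
qed simp

text \<open>Integrals over boxes determine a function almost everywhere: outside a null set its
  averages over cubes shrinking to a corner \<open>x\<close> converge to its value at
  \<open>x\<close>. Countably many closed boxes exhaust \<open>D\<close>, so the exceptional sets
  remain negligible.\<close>

lemma fundamental_lemma:
  fixes h :: "real^'n \<Rightarrow> real"
  assumes D: "open D" and h: "L1loc D h"
    and zero: "\<And>\<phi>. test_fun D \<phi> \<Longrightarrow> (\<integral>x. h x * \<phi> x \<partial>lebesgue_on D) = 0"
  shows "AE x in lebesgue_on D. h x = 0"
proof -
  have neg: "negligible {x \<in> cbox c d. h x \<noteq> 0}" if cd: "cbox c d \<subseteq> D" for c d
  proof -
    \<comment> \<open>Extension by zero yields a function integrable on every box, as the
      differentiation theorem requires; \<open>h\<close> itself is integrable only on compact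
      subsets of \<open>D\<close>.\<close>
    let ?f = "\<lambda>x. if x \<in> cbox c d then h x else 0"
    have "integrable (lebesgue_on (cbox c d)) h" using h cd by (auto simp: L1loc_def)
    then have ih: "h absolutely_integrable_on cbox c d"
      by (simp add: set_integrable_def integrable_restrict_space)
    then have "?f absolutely_integrable_on UNIV"
      by (subst absolutely_integrable_restrict_UNIV)
    then have "?f integrable_on UNIV" by (rule set_lebesgue_integral_eq_integral(1))
    then have fi: "?f integrable_on cbox a b" for a b
      by (rule integrable_on_subcbox) auto
    obtain N where N: "negligible N" "\<And>x e. \<lbrakk>x \<notin> N; 0 < e\<rbrakk> \<Longrightarrow> \<exists>t>0. \<forall>k. 0 < k \<and> k < t \<longrightarrow>
                         norm (integral (cbox x (x + k *\<^sub>R One)) ?f /\<^sub>R k ^ DIM(real^'n) - ?f x) < e"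
      using integrable_ccontinuous_explicit[OF fi] by blast
    have "h x = 0" if x: "x \<in> box c d" "x \<notin> N" for x
    proof (rule ccontr)
      assume "h x \<noteq> 0"
      then obtain t where t: "t > 0" "\<And>k. 0 < k \<Longrightarrow> k < t \<Longrightarrow> 
          norm (integral (cbox x (x + k *\<^sub>R One)) ?f /\<^sub>R k ^ DIM(real^'n) - ?f x) < \<bar>h x\<bar>"
        using N(2)[OF x(2), of "\<bar>h x\<bar>"] by auto
      obtain e where e: "e > 0" "ball x e \<subseteq> box c d" using x(1) open_box open_contains_ball by metis
      define n where "n = norm (One::real^'n)"
      have n: "n \<ge> 0" by (simp add: n_def)
      \<comment> \<open>Half of \<open>t\<close> keeps \<open>k\<close> in the range of the
        differentiation estimate. The second bound keeps the opposite corner of the cube within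
        \<open>e\<close> of \<open>x\<close>; a box that contains both corners contains the
        cube.\<close>
      define k where "k = min (t / 2) (e / (2 * (1 + n)))"
      have k: "0 < k" "k < t" using t e n by (auto simp: k_def)
      have "k * (1 + n) \<le> e / (2 * (1 + n)) * (1 + n)" using n by (intro mult_right_mono) (auto simp: k_def)
      also have "\<dots> = e / 2" using n by (simp add: field_simps)
      finally have "k * n < e" using e k by (simp add: distrib_left)
      then have kn: "norm (k *\<^sub>R (One::real^'n)) < e" using k by (simp add: n_def)
      have sub: "cbox x (x + k *\<^sub>R One) \<subseteq> cbox c d"
      proof -
        have "x + k *\<^sub>R One \<in> ball x e" using kn by (simp only: mem_ball dist_norm) simp
        then have "x + k *\<^sub>R One \<in> cbox c d" "x \<in> cbox c d" using e x box_subset_cbox by blast+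
        then show ?thesis by (simp add: subset_box mem_box)
      qed
      then have "integral (cbox x (x + k *\<^sub>R One)) ?f = integral (cbox x (x + k *\<^sub>R One)) h"
        by (intro Henstock_Kurzweil_Integration.integral_cong) auto
      also have "\<dots> = 0" using sub cd by (intro box_integral_eq_0[OF D h _ zero]) auto
      finally have "\<bar>?f x\<bar> < \<bar>h x\<bar>" using t(2)[OF k(1,2)] by simp
      then show False using x(1) box_subset_cbox[of c d] by (auto split: if_splits)
    qed
    then have "{x \<in> cbox c d. h x \<noteq> 0} \<subseteq> N \<union> (cbox c d - box c d)" by auto
    then show ?thesis
      by (rule negligible_subset[rotated]) (intro negligible_Un N(1) negligible_frontier_interval)
  qed
  obtain \<D> where \<D>: "countable \<D>" "\<D> \<subseteq> Pow D" "\<And>X. X \<in> \<D> \<Longrightarrow> \<exists>a b. X = cbox a b" "\<Union>\<D> = D"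
    using open_countable_Union_open_cbox[OF D] by blast
  have "negligible (\<Union>X\<in>\<D>. {x \<in> X. h x \<noteq> 0})"
  proof (rule negligible_countable_Union)
    show "countable ((\<lambda>X. {x \<in> X. h x \<noteq> 0}) ` \<D>)" using \<D>(1) by simp
    fix S assume "S \<in> (\<lambda>X. {x \<in> X. h x \<noteq> 0}) ` \<D>"
    then obtain X where X: "X \<in> \<D>" "S = {x \<in> X. h x \<noteq> 0}" by blast
    then obtain a b where "X = cbox a b" "X \<subseteq> D" using \<D> by blast
    then show "negligible S" using neg X by simp
  qed
  moreover have "(\<Union>X\<in>\<D>. {x \<in> X. h x \<noteq> 0}) = {x \<in> D. h x \<noteq> 0}" using \<D>(4) by blast
  ultimately have "{x \<in> D. h x \<noteq> 0} \<in> null_sets lebesgue" by (simp add: negligible_iff_null_sets)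
  then have "AE x in lebesgue. x \<in> D \<longrightarrow> h x = 0" by (rule AE_I') auto
  then show ?thesis using D by (subst AE_restrict_space_iff) auto
qed

lemma test_fun_bounds:
  fixes \<phi> :: "real^'n \<Rightarrow> real"
  assumes D: "open D" and t: "test_fun D \<phi>"
  obtains K b where "compact K" "K \<subseteq> D" "\<And>x. x \<notin> K \<Longrightarrow> \<phi> x = 0" "\<And>x i. x \<notin> K \<Longrightarrow> iter_pd \<phi> [i] x = 0"
    "\<And>x. \<bar>\<phi> x\<bar> \<le> b" "\<And>x i. \<bar>iter_pd \<phi> [i] x\<bar> \<le> b"
    "\<phi> \<in> borel_measurable (lebesgue_on D)" "\<And>i. iter_pd \<phi> [i] \<in> borel_measurable (lebesgue_on D)"
proof -
  let ?K = "closure {x. \<phi> x \<noteq> 0}"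
  have s: "smooth_fun \<phi>" "compact ?K" "?K \<subseteq> D" using t by (auto simp: test_fun_def)
  have z: "\<phi> x = 0" "iter_pd \<phi> [i] x = 0" if "x \<notin> ?K" for x i
    using that iter_pd_outside_support[OF s(1) that] closure_subset[of "{x. \<phi> x \<noteq> 0}"] by auto
  have c: "continuous_on A \<phi>" "continuous_on A (iter_pd \<phi> [i])" for A i
    using smooth_fun_continuous[OF s(1), of A "[]"] smooth_fun_continuous[OF s(1), of A "[i]"] by auto
  have bd: "\<exists>b. \<forall>x. \<bar>g x\<bar> \<le> b" if "continuous_on ?K g" "\<And>x. x \<notin> ?K \<Longrightarrow> g x = 0" for g :: "real^'n \<Rightarrow> real"
  proof -
    have "bounded (g ` ?K)" by (intro compact_imp_bounded compact_continuous_image that s)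
    then obtain b where "\<And>x. x \<in> ?K \<Longrightarrow> \<bar>g x\<bar> \<le> b" by (auto simp: bounded_iff)
    then have "\<bar>g x\<bar> \<le> \<bar>b\<bar>" for x using that(2)[of x] by (cases "x \<in> ?K") force+
    then show ?thesis by blast
  qed
  obtain b0 where b0: "\<And>x. \<bar>\<phi> x\<bar> \<le> b0" using bd[OF c(1)] z by blast
  have "\<forall>i. \<exists>b. \<forall>x. \<bar>iter_pd \<phi> [i] x\<bar> \<le> b" using bd[OF c(2)] z by blast
  then obtain b1 where b1: "\<And>i x. \<bar>iter_pd \<phi> [i] x\<bar> \<le> b1 i" by metis
  have b1n: "b1 i \<ge> 0" for i using b1[of i 0] by linarith
  have b0n: "b0 \<ge> 0" using b0[of 0] by linarith
  have sum: "b1 i \<le> b0 + (\<Sum>i\<in>UNIV. b1 i)" for i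
    using member_le_sum[of i UNIV b1] b1n b0n by simp
  show ?thesis
  proof (rule that[OF s(2,3) z])
    show "\<bar>\<phi> x\<bar> \<le> b0 + (\<Sum>i\<in>UNIV. b1 i)" for x using b0[of x] sum_nonneg[of UNIV b1] b1n by fastforce
    show "\<bar>iter_pd \<phi> [i] x\<bar> \<le> b0 + (\<Sum>i\<in>UNIV. b1 i)" for x i using b1[of i x] sum[of i] by linarith
    show "\<phi> \<in> borel_measurable (lebesgue_on D)" "iter_pd \<phi> [i] \<in> borel_measurable (lebesgue_on D)" for i
      using D c by (auto intro: continuous_imp_measurable_on_sets_lebesgue)
  qed auto
qed

lemma L1loc_test_integrable:
  fixes h :: "real^'n \<Rightarrow> real"
  assumes D: "open D" and h: "L1loc D h" and t: "test_fun D \<phi>"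
  shows "integrable (lebesgue_on D) (\<lambda>x. h x * \<phi> x)" "integrable (lebesgue_on D) (\<lambda>x. h x * iter_pd \<phi> [i] x)"
proof -
  obtain K b where K: "compact K" "K \<subseteq> D" "\<And>x. x \<notin> K \<Longrightarrow> \<phi> x = 0" "\<And>x i. x \<notin> K \<Longrightarrow> iter_pd \<phi> [i] x = 0"
    "\<And>x. \<bar>\<phi> x\<bar> \<le> b" "\<And>x i. \<bar>iter_pd \<phi> [i] x\<bar> \<le> b"
    "\<phi> \<in> borel_measurable (lebesgue_on D)" "\<And>i. iter_pd \<phi> [i] \<in> borel_measurable (lebesgue_on D)"
    using test_fun_bounds[OF D t] by metis
  show "integrable (lebesgue_on D) (\<lambda>x. h x * \<phi> x)" by (rule L1loc_mult_integrable[OF D h K(1,2,7,5,3)])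
  show "integrable (lebesgue_on D) (\<lambda>x. h x * iter_pd \<phi> [i] x)" by (rule L1loc_mult_integrable[OF D h K(1,2,8,6,4)])
qed

lemma L1loc_lincomb: "L1loc D g \<Longrightarrow> L1loc D h \<Longrightarrow> L1loc D (\<lambda>x. a * g x + b * h x)"
  by (auto simp: L1loc_def)

lemma has_weak_partial_lincomb:
  assumes D: "open D" and u: "has_weak_partial D u i g" and v: "has_weak_partial D v i h"
  shows "has_weak_partial D (\<lambda>x. a * u x + b * v x) i (\<lambda>x. a * g x + b * h x)"
  unfolding has_weak_partial_def
proof (intro conjI allI impI)
  have l: "L1loc D u" "L1loc D g" "L1loc D v" "L1loc D h" using u v by (auto simp: has_weak_partial_def)
  show "L1loc D (\<lambda>x. a * u x + b * v x)" "L1loc D (\<lambda>x. a * g x + b * h x)" by (intro L1loc_lincomb l)+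
  fix \<phi> assume t: "test_fun D \<phi>"
  note i = L1loc_test_integrable[OF D _ t]
  have "(\<integral>x. (a * u x + b * v x) * iter_pd \<phi> [i] x \<partial>lebesgue_on D) =
      (\<integral>x. a * (u x * iter_pd \<phi> [i] x) + b * (v x * iter_pd \<phi> [i] x) \<partial>lebesgue_on D)"
    by (simp add: algebra_simps)
  also have "\<dots> = a * (\<integral>x. u x * iter_pd \<phi> [i] x \<partial>lebesgue_on D) + b * (\<integral>x. v x * iter_pd \<phi> [i] x \<partial>lebesgue_on D)"
    using i(2)[OF l(1)] i(2)[OF l(3)] by simp
  also have "\<dots> = - (a * (\<integral>x. g x * \<phi> x \<partial>lebesgue_on D) + b * (\<integral>x. h x * \<phi> x \<partial>lebesgue_on D))"
    using u v t by (simp add: has_weak_partial_def)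
  also have "a * (\<integral>x. g x * \<phi> x \<partial>lebesgue_on D) + b * (\<integral>x. h x * \<phi> x \<partial>lebesgue_on D) =
      (\<integral>x. a * (g x * \<phi> x) + b * (h x * \<phi> x) \<partial>lebesgue_on D)"
    using i(1)[OF l(2)] i(1)[OF l(4)] by simp
  also have "\<dots> = (\<integral>x. (a * g x + b * h x) * \<phi> x \<partial>lebesgue_on D)" by (simp add: algebra_simps)
  finally show "(\<integral>x. (a * u x + b * v x) * iter_pd \<phi> [i] x \<partial>lebesgue_on D) = - (\<integral>x. (a * g x + b * h x) * \<phi> x \<partial>lebesgue_on D)" .
qed

lemma has_weak_partial_unique:
  fixes u :: "real^'n \<Rightarrow> real"
  assumes D: "open D" and g: "has_weak_partial D u i g" and h: "has_weak_partial D u i h"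
  shows "AE x in lebesgue_on D. g x = h x"
proof -
  have l: "L1loc D g" "L1loc D h" using g h by (auto simp: has_weak_partial_def)
  have "AE x in lebesgue_on D. 1 * g x + (-1) * h x = 0"
  proof (rule fundamental_lemma[OF D L1loc_lincomb[OF l]])
    fix \<phi> :: "real^'n \<Rightarrow> real" assume t: "test_fun D \<phi>"
    note i = L1loc_test_integrable(1)[OF D _ t]
    have "(\<integral>x. g x * \<phi> x \<partial>lebesgue_on D) = (\<integral>x. h x * \<phi> x \<partial>lebesgue_on D)"
      using g h t unfolding has_weak_partial_def by (metis minus_equation_iff)
    then show "(\<integral>x. (1 * g x + (-1) * h x) * \<phi> x \<partial>lebesgue_on D) = 0"
      using i[OF l(1)] i[OF l(2)] by (simp add: left_diff_distrib)
  qed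
  then show ?thesis by eventually_elim simp
qed

lemma has_weak_partial_wpd: "has_weak_partial D u i g \<Longrightarrow> has_weak_partial D u i (wpd D u i)"
  unfolding wpd_def by (rule someI[where P = "has_weak_partial D u i"])

text \<open>The choice made by \<open>wpd\<close> is harmless: whichever weak derivative is at hand
  may stand for it under an integral.\<close>

lemma wpd_AE_eq: "open D \<Longrightarrow> has_weak_partial D u i g \<Longrightarrow> AE x in lebesgue_on D. wpd D u i x = g x"
  by (rule has_weak_partial_unique[OF _ has_weak_partial_wpd])

section \<open>Square-integrable functions and Sobolev spaces\<close>

lemma L2fun_measurable: "L2fun D f \<Longrightarrow> f \<in> borel_measurable (lebesgue_on D)"
  by (simp add: L2fun_def)

lemma L2fun_mult_integrable:
  assumes "L2fun D f" "L2fun D g"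
  shows "integrable (lebesgue_on D) (\<lambda>x. f x * g x)"
proof (rule Bochner_Integration.integrable_bound)
  show "integrable (lebesgue_on D) (\<lambda>x. (f x)\<^sup>2 + (g x)\<^sup>2)" using assms by (auto simp: L2fun_def)
  show "(\<lambda>x. f x * g x) \<in> borel_measurable (lebesgue_on D)" using assms by (auto simp: L2fun_def)
  have "\<bar>a * b\<bar> \<le> a\<^sup>2 + b\<^sup>2" for a b :: real
  proof -
    have "0 \<le> (\<bar>a\<bar> - \<bar>b\<bar>)\<^sup>2" by simp
    then have "2 * \<bar>a * b\<bar> \<le> a\<^sup>2 + b\<^sup>2" by (simp add: power2_diff abs_mult)
    moreover have "0 \<le> \<bar>a * b\<bar>" by simp
    ultimately show ?thesis by linarith
  qed
  then show "AE x in lebesgue_on D. norm (f x * g x) \<le> norm ((f x)\<^sup>2 + (g x)\<^sup>2)" by simp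
qed

lemma L2fun_lincomb:
  assumes "L2fun D f" "L2fun D g"
  shows "L2fun D (\<lambda>x. a * f x + b * g x)"
proof -
  have "(\<lambda>x. (a * f x + b * g x)\<^sup>2) = (\<lambda>x. a\<^sup>2 * (f x)\<^sup>2 + 2 * a * b * (f x * g x) + b\<^sup>2 * (g x)\<^sup>2)"
    by (auto simp: power2_eq_square algebra_simps)
  then show ?thesis using assms L2fun_mult_integrable[OF assms] by (auto simp: L2fun_def)
qed

lemma integral_sq_lincomb_le:
  assumes "L2fun D f" "L2fun D g"
  shows "(\<integral>x. (a * f x + b * g x)\<^sup>2 \<partial>lebesgue_on D) \<le>
    2 * a\<^sup>2 * (\<integral>x. (f x)\<^sup>2 \<partial>lebesgue_on D) + 2 * b\<^sup>2 * (\<integral>x. (g x)\<^sup>2 \<partial>lebesgue_on D)"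
proof -
  have i: "integrable (lebesgue_on D) (\<lambda>x. (f x)\<^sup>2)" "integrable (lebesgue_on D) (\<lambda>x. (g x)\<^sup>2)"
    using assms by (auto simp: L2fun_def)
  have "(\<integral>x. (a * f x + b * g x)\<^sup>2 \<partial>lebesgue_on D) \<le> (\<integral>x. 2 * a\<^sup>2 * (f x)\<^sup>2 + 2 * b\<^sup>2 * (g x)\<^sup>2 \<partial>lebesgue_on D)"
  proof (rule integral_mono)
    show "integrable (lebesgue_on D) (\<lambda>x. (a * f x + b * g x)\<^sup>2)"
      using L2fun_lincomb[OF assms] by (simp add: L2fun_def)
    show "integrable (lebesgue_on D) (\<lambda>x. 2 * a\<^sup>2 * (f x)\<^sup>2 + 2 * b\<^sup>2 * (g x)\<^sup>2)" using i by simp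
    fix x
    have "0 \<le> (a * f x - b * g x)\<^sup>2" by simp
    then show "(a * f x + b * g x)\<^sup>2 \<le> 2 * a\<^sup>2 * (f x)\<^sup>2 + 2 * b\<^sup>2 * (g x)\<^sup>2"
      by (simp add: power2_eq_square algebra_simps)
  qed
  then show ?thesis using i by simp
qed

lemma L2fun_cong_AE:
  assumes "AE x in lebesgue_on D. f x = g x" "f \<in> borel_measurable (lebesgue_on D)" "L2fun D g"
  shows "L2fun D f"
proof -
  have "integrable (lebesgue_on D) (\<lambda>x. (f x)\<^sup>2) \<longleftrightarrow> integrable (lebesgue_on D) (\<lambda>x. (g x)\<^sup>2)"
    using assms by (intro integrable_cong_AE) (auto simp: L2fun_def)
  then show ?thesis using assms by (auto simp: L2fun_def)
qed

lemma L2fun_L1loc: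
  fixes f :: "real^'n \<Rightarrow> real"
  assumes D: "open D" and f: "L2fun D f"
  shows "L1loc D f"
  unfolding L1loc_def
proof (intro conjI allI impI)
  show [measurable]: "f \<in> borel_measurable (lebesgue_on D)" using f by (simp add: L2fun_def)
  fix K assume K: "compact K \<and> K \<subseteq> D"
  then have sets: "D \<in> sets lebesgue" "K \<in> sets lebesgue" using D by (auto simp: borel_compact)
  have Ksub: "integrable (lebesgue_on K) (\<lambda>x. (f x)\<^sup>2)"
  proof -
    have "integrable lebesgue (\<lambda>x. indicator D x * (f x)\<^sup>2)" using f sets by (simp add: L2fun_def integrable_restrict_space)
    from integrable_real_mult_indicator[OF sets(2) this]
    have "integrable lebesgue (\<lambda>x. indicator K x * (indicator D x * (f x)\<^sup>2))" by (simp add: mult_ac)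
    moreover have "indicator K x * (indicator D x * (f x)\<^sup>2) = indicator K x * (f x)\<^sup>2" for x
      using K by (auto simp: indicator_def)
    ultimately show ?thesis using sets by (simp add: integrable_restrict_space)
  qed
  have [measurable]: "f \<in> borel_measurable (lebesgue_on K)"
    using K by (intro measurable_restrict_mono[OF \<open>f \<in> borel_measurable (lebesgue_on D)\<close>]) auto
  have "finite_measure (lebesgue_on K)"
    using K by (intro finite_measure_lebesgue_on) (auto intro: lmeasurable_compact)
  then interpret finite_measure "lebesgue_on K" .
  show "integrable (lebesgue_on K) f"
  proof (rule Bochner_Integration.integrable_bound)
    show "integrable (lebesgue_on K) (\<lambda>x. 1 + (f x)\<^sup>2)" using Ksub by simp
    have "\<bar>a\<bar> \<le> 1 + a\<^sup>2" for a :: real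
    proof -
      have "0 \<le> (\<bar>a\<bar> - 1)\<^sup>2" by simp
      then have "2 * \<bar>a\<bar> \<le> 1 + a\<^sup>2" by (simp add: power2_diff)
      then show ?thesis using abs_ge_zero[of a] by linarith
    qed
    then show "AE x in lebesgue_on K. norm (f x) \<le> norm (1 + (f x)\<^sup>2)" by simp
  qed measurable
qed

lemma H1_wpd:
  fixes u :: "real^'n \<Rightarrow> real"
  assumes D: "open D" and u: "H1 D u"
  shows "has_weak_partial D u i (wpd D u i)" "L2fun D (wpd D u i)"
proof -
  obtain g where g: "has_weak_partial D u i g" "L2fun D g" using u by (auto simp: H1_def)
  show w: "has_weak_partial D u i (wpd D u i)" by (rule has_weak_partial_wpd[OF g(1)])
  show "L2fun D (wpd D u i)"
    using w by (intro L2fun_cong_AE[OF wpd_AE_eq[OF D g(1)] _ g(2)]) (simp add: has_weak_partial_def L1loc_def)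
qed

lemma H1_lincomb:
  fixes u v :: "real^'n \<Rightarrow> real"
  assumes D: "open D" and u: "H1 D u" and v: "H1 D v"
  shows "H1 D (\<lambda>x. a * u x + b * v x)"
    "AE x in lebesgue_on D. wpd D (\<lambda>x. a * u x + b * v x) i x = a * wpd D u i x + b * wpd D v i x"
proof -
  have p: "has_weak_partial D (\<lambda>x. a * u x + b * v x) i (\<lambda>x. a * wpd D u i x + b * wpd D v i x)" for i
    by (rule has_weak_partial_lincomb[OF D H1_wpd(1)[OF D u] H1_wpd(1)[OF D v]])
  have "L2fun D u" "L2fun D v" using u v by (auto simp: H1_def)
  then show "H1 D (\<lambda>x. a * u x + b * v x)"
    unfolding H1_def using p L2fun_lincomb H1_wpd(2)[OF D u] H1_wpd(2)[OF D v] by blast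
  show "AE x in lebesgue_on D. wpd D (\<lambda>x. a * u x + b * v x) i x = a * wpd D u i x + b * wpd D v i x"
    by (rule wpd_AE_eq[OF D p])
qed

lemma H1_norm_sq:
  "(H1_norm D u)\<^sup>2 = (\<integral>x. (u x)\<^sup>2 \<partial>lebesgue_on D) + (\<Sum>i\<in>UNIV. \<integral>x. (wpd D u i x)\<^sup>2 \<partial>lebesgue_on D)"
  unfolding H1_norm_def by (intro real_sqrt_pow2 add_nonneg_nonneg sum_nonneg) auto

lemma integral_sq_cong_AE:
  fixes f g :: "real^'n \<Rightarrow> real"
  assumes "AE x in lebesgue_on D. f x = g x" "f \<in> borel_measurable (lebesgue_on D)" "g \<in> borel_measurable (lebesgue_on D)"
  shows "(\<integral>x. (f x)\<^sup>2 \<partial>lebesgue_on D) = (\<integral>x. (g x)\<^sup>2 \<partial>lebesgue_on D)"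
  using assms by (intro integral_cong_AE) auto

text \<open>Both the function and its gradient obey
  \<open>(p + q)^2 \<le> 2 * p^2 + 2 * q^2\<close>. The factor 2 does no harm where the bound is
  used, namely to show that a norm tends to zero.\<close>

lemma H1_norm_lincomb_le:
  fixes u v :: "real^'n \<Rightarrow> real"
  assumes D: "open D" and u: "H1 D u" and v: "H1 D v"
  shows "(H1_norm D (\<lambda>x. a * u x + b * v x))\<^sup>2 \<le> 2 * a\<^sup>2 * (H1_norm D u)\<^sup>2 + 2 * b\<^sup>2 * (H1_norm D v)\<^sup>2"
proof -
  have L: "L2fun D u" "L2fun D v" using u v by (auto simp: H1_def)
  note W = H1_wpd(2)[OF D u] H1_wpd(2)[OF D v]
  have "(\<integral>x. (wpd D (\<lambda>x. a * u x + b * v x) i x)\<^sup>2 \<partial>lebesgue_on D) = (\<integral>x. (a * wpd D u i x + b * wpd D v i x)\<^sup>2 \<partial>lebesgue_on D)" for i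
    by (intro integral_sq_cong_AE[OF H1_lincomb(2)[OF D u v]] L2fun_measurable H1_wpd(2)[OF D H1_lincomb(1)[OF D u v]] L2fun_lincomb W)
  also have "\<dots> i \<le> 2 * a\<^sup>2 * (\<integral>x. (wpd D u i x)\<^sup>2 \<partial>lebesgue_on D) + 2 * b\<^sup>2 * (\<integral>x. (wpd D v i x)\<^sup>2 \<partial>lebesgue_on D)" for i
    by (rule integral_sq_lincomb_le[OF W])
  finally have "(\<Sum>i\<in>UNIV. \<integral>x. (wpd D (\<lambda>x. a * u x + b * v x) i x)\<^sup>2 \<partial>lebesgue_on D) \<le>
     (\<Sum>i\<in>UNIV. 2 * a\<^sup>2 * (\<integral>x. (wpd D u i x)\<^sup>2 \<partial>lebesgue_on D) + 2 * b\<^sup>2 * (\<integral>x. (wpd D v i x)\<^sup>2 \<partial>lebesgue_on D))"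
    by (intro sum_mono)
  then show ?thesis
    unfolding H1_norm_sq using integral_sq_lincomb_le[OF L, of a b]
    by (simp add: sum.distrib sum_distrib_left algebra_simps)
qed

text \<open>The combinations of equal iterated derivatives of \<open>f\<close> and \<open>g\<close>,
  taken over all lists of directions, form a class closed under differentiation.\<close>

lemma smooth_fun_lincomb:
  assumes "smooth_fun f" "smooth_fun g"
  shows "smooth_fun (\<lambda>x. a * f x + b * g x)"
proof (rule smooth_fun_closed_class[where S = "range (\<lambda>is x. a * iter_pd f is x + b * iter_pd g is x)"])
  show "(\<lambda>x. a * f x + b * g x) \<in> range (\<lambda>is x. a * iter_pd f is x + b * iter_pd g is x)"
    by (rule range_eqI[of _ _ "[]"]) simp
  fix h assume "h \<in> range (\<lambda>is x. a * iter_pd f is x + b * iter_pd g is x)"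
  then obtain "is" where h: "h = (\<lambda>x. a * iter_pd f is x + b * iter_pd g is x)" by blast
  have "(h has_derivative (\<lambda>k. \<Sum>j\<in>UNIV. (a * iter_pd f (j # is) x + b * iter_pd g (j # is) x) * k $ j)) (at x)" for x
    unfolding h
    by (rule has_derivative_eq_rhs[OF has_derivative_add[OF has_derivative_mult_right[OF smooth_fun_has_derivative[OF assms(1)]]
        has_derivative_mult_right[OF smooth_fun_has_derivative[OF assms(2)]]]])
      (auto simp: sum_distrib_left sum.distrib[symmetric] algebra_simps)
  then show "\<exists>f'. (\<forall>i. f' i \<in> range (\<lambda>is x. a * iter_pd f is x + b * iter_pd g is x)) \<and>
      (\<forall>x. (h has_derivative (\<lambda>h. \<Sum>j\<in>UNIV. f' j x * h $ j)) (at x))"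
    by (intro exI[of _ "\<lambda>j x. a * iter_pd f (j # is) x + b * iter_pd g (j # is) x"]) auto
qed

lemma test_fun_lincomb:
  assumes f: "test_fun D f" and g: "test_fun D g"
  shows "test_fun D (\<lambda>x. a * f x + b * g x)"
proof -
  let ?S = "{x. a * f x + b * g x \<noteq> 0}" and ?K = "closure {x. f x \<noteq> 0} \<union> closure {x. g x \<noteq> 0}"
  have K: "compact ?K" "?K \<subseteq> D" using f g by (auto simp: test_fun_def)
  have "?S \<subseteq> {x. f x \<noteq> 0} \<union> {x. g x \<noteq> 0}" by auto
  also have "\<dots> \<subseteq> ?K" by (intro Un_mono closure_subset)
  finally have "?S \<subseteq> ?K" .
  then have S: "closure ?S \<subseteq> ?K" by (rule closure_minimal) auto
  then have "compact (closure ?S)" using compact_Int_closed[OF K(1) closed_closure, of ?S] by (simp add: Int_absorb1)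
  then show ?thesis using S K f g unfolding test_fun_def by (auto intro: smooth_fun_lincomb)
qed

text \<open>Integration by parts shows that the classical partial derivatives are weak ones; they
  and the function are bounded with compact support, hence square integrable.\<close>

lemma test_fun_H1:
  fixes \<phi> :: "real^'n \<Rightarrow> real"
  assumes D: "open D" and t: "test_fun D \<phi>"
  shows "H1 D \<phi>" "AE x in lebesgue_on D. wpd D \<phi> i x = iter_pd \<phi> [i] x"
proof -
  obtain K b where K: "compact K" "K \<subseteq> D" "\<And>x. x \<notin> K \<Longrightarrow> \<phi> x = 0" "\<And>x i. x \<notin> K \<Longrightarrow> iter_pd \<phi> [i] x = 0"
    "\<And>x. \<bar>\<phi> x\<bar> \<le> b" "\<And>x i. \<bar>iter_pd \<phi> [i] x\<bar> \<le> b"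
    "\<phi> \<in> borel_measurable (lebesgue_on D)" "\<And>i. iter_pd \<phi> [i] \<in> borel_measurable (lebesgue_on D)"
    using test_fun_bounds[OF D t] by metis
  have s: "smooth_fun \<phi>" using t by (simp add: test_fun_def)
  have L2: "L2fun D g" if g: "g \<in> borel_measurable (lebesgue_on D)" "\<And>x. x \<notin> K \<Longrightarrow> g x = 0" "\<And>x. \<bar>g x\<bar> \<le> b" for g
    unfolding L2fun_def
  proof (intro conjI g(1))
    have one: "L1loc D (\<lambda>x. 1)"
      unfolding L1loc_def
    proof (intro conjI allI impI)
      fix K :: "(real^'n) set" assume "compact K \<and> K \<subseteq> D"
      then have "finite_measure (lebesgue_on K)"
        by (intro finite_measure_lebesgue_on) (auto intro: lmeasurable_compact)
      then interpret finite_measure "lebesgue_on K" .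
      show "integrable (lebesgue_on K) (\<lambda>x. 1::real)" by simp
    qed simp
    have "integrable (lebesgue_on D) (\<lambda>x. 1 * (g x)\<^sup>2)"
    proof (rule L1loc_mult_integrable[OF D one K(1,2)])
      show "(\<lambda>x. (g x)\<^sup>2) \<in> borel_measurable (lebesgue_on D)" using g(1) by measurable
      show "\<bar>(g x)\<^sup>2\<bar> \<le> b\<^sup>2" for x using power_mono[OF g(3)[of x], of 2] by simp
      show "(g x)\<^sup>2 = 0" if "x \<notin> K" for x using g(2)[OF that] by simp
    qed
    then show "integrable (lebesgue_on D) (\<lambda>x. (g x)\<^sup>2)" by simp
  qed
  have L2p: "L2fun D \<phi>" "L2fun D (iter_pd \<phi> [i])" for i using K by (auto intro!: L2)
  have w: "has_weak_partial D \<phi> i (iter_pd \<phi> [i])" for i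
    unfolding has_weak_partial_def using L2fun_L1loc[OF D] L2p integration_by_parts[OF D s] by blast
  show "H1 D \<phi>" unfolding H1_def using L2p w by blast
  show "AE x in lebesgue_on D. wpd D \<phi> i x = iter_pd \<phi> [i] x" by (rule wpd_AE_eq[OF D w])
qed

lemma H10_lincomb:
  fixes u v :: "real^'n \<Rightarrow> real"
  assumes D: "open D" and u: "H10 D u" and v: "H10 D v"
  shows "H10 D (\<lambda>x. a * u x + b * v x)"
proof -
  obtain \<phi> where \<phi>: "\<And>k. test_fun D (\<phi> k)" "(\<lambda>k. H1_norm D (\<lambda>x. u x - \<phi> k x)) \<longlonglongrightarrow> 0" and u1: "H1 D u"
    using u by (auto simp: H10_def)
  obtain \<psi> where \<psi>: "\<And>k. test_fun D (\<psi> k)" "(\<lambda>k. H1_norm D (\<lambda>x. v x - \<psi> k x)) \<longlonglongrightarrow> 0" and v1: "H1 D v"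
    using v by (auto simp: H10_def)
  let ?\<chi> = "\<lambda>k x. a * \<phi> k x + b * \<psi> k x"
  let ?n = "\<lambda>k. H1_norm D (\<lambda>x. (a * u x + b * v x) - ?\<chi> k x)"
  have h: "H1 D (\<lambda>x. u x - \<phi> k x)" "H1 D (\<lambda>x. v x - \<psi> k x)" for k
    using H1_lincomb(1)[OF D u1 test_fun_H1(1)[OF D \<phi>(1)], of 1 "-1"] H1_lincomb(1)[OF D v1 test_fun_H1(1)[OF D \<psi>(1)], of 1 "-1"] by simp_all
  have le: "(?n k)\<^sup>2 \<le> 2 * a\<^sup>2 * (H1_norm D (\<lambda>x. u x - \<phi> k x))\<^sup>2 + 2 * b\<^sup>2 * (H1_norm D (\<lambda>x. v x - \<psi> k x))\<^sup>2" for k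
  proof -
    have "(\<lambda>x. (a * u x + b * v x) - ?\<chi> k x) = (\<lambda>x. a * (u x - \<phi> k x) + b * (v x - \<psi> k x))" by (auto simp: algebra_simps)
    then show ?thesis using H1_norm_lincomb_le[OF D h, of a k b k] by simp
  qed
  have "(\<lambda>k. 2 * a\<^sup>2 * (H1_norm D (\<lambda>x. u x - \<phi> k x))\<^sup>2 + 2 * b\<^sup>2 * (H1_norm D (\<lambda>x. v x - \<psi> k x))\<^sup>2) \<longlonglongrightarrow> 2 * a\<^sup>2 * 0\<^sup>2 + 2 * b\<^sup>2 * 0\<^sup>2"
    by (intro tendsto_intros \<phi> \<psi>)
  then have t: "(\<lambda>k. 2 * a\<^sup>2 * (H1_norm D (\<lambda>x. u x - \<phi> k x))\<^sup>2 + 2 * b\<^sup>2 * (H1_norm D (\<lambda>x. v x - \<psi> k x))\<^sup>2) \<longlonglongrightarrow> 0"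
    by simp
  have "(\<lambda>k. (?n k)\<^sup>2) \<longlonglongrightarrow> 0"
    by (rule Lim_null_comparison[OF _ t]) (rule always_eventually, intro allI, subst real_norm_def, subst abs_power2, rule le)
  then have "(\<lambda>k. sqrt ((?n k)\<^sup>2)) \<longlonglongrightarrow> sqrt 0" by (rule tendsto_real_sqrt)
  then have "?n \<longlonglongrightarrow> 0" by (simp add: tendsto_rabs_zero_iff)
  then show ?thesis
    unfolding H10_def using H1_lincomb(1)[OF D u1 v1] test_fun_lincomb[OF \<phi>(1) \<psi>(1)] by (intro conjI exI[of _ ?\<chi>]) auto
qed

section \<open>Finite element functions\<close>

lemma bounded_convergence_lebesgue_on:
  fixes f :: "nat \<Rightarrow> real^'n \<Rightarrow> real"
  assumes D: "open D" "bounded D" and m: "\<And>k. f k \<in> borel_measurable (lebesgue_on D)" "g \<in> borel_measurable (lebesgue_on D)"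
    and b: "\<And>k x. x \<in> D \<Longrightarrow> \<bar>f k x\<bar> \<le> b" and lim: "AE x in lebesgue_on D. (\<lambda>k. f k x) \<longlonglongrightarrow> g x"
  shows "(\<lambda>k. \<integral>x. f k x \<partial>lebesgue_on D) \<longlonglongrightarrow> (\<integral>x. g x \<partial>lebesgue_on D)"
proof -
  have "finite_measure (lebesgue_on D)"
    using D by (intro finite_measure_lebesgue_on) (auto intro: bounded_set_imp_lmeasurable)
  then interpret finite_measure "lebesgue_on D" .
  show ?thesis
    by (rule integral_dominated_convergence[where w = "\<lambda>_. b"]) (use m b lim in auto)
qed

lemma bounded_L2fun:
  fixes f :: "real^'n \<Rightarrow> real"
  assumes D: "open D" "bounded D" and m: "f \<in> borel_measurable (lebesgue_on D)" and b: "AE x in lebesgue_on D. \<bar>f x\<bar> \<le> b"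
  shows "L2fun D f"
proof -
  have "finite_measure (lebesgue_on D)"
    using D by (intro finite_measure_lebesgue_on) (auto intro: bounded_set_imp_lmeasurable)
  then interpret finite_measure "lebesgue_on D" .
  have "AE x in lebesgue_on D. norm ((f x)\<^sup>2) \<le> b\<^sup>2" using b
  proof eventually_elim
    case (elim x)
    from power_mono[OF elim, of 2] show ?case by simp
  qed
  then show ?thesis unfolding L2fun_def using m by (auto intro!: integrable_const_bound)
qed

text \<open>On a bounded domain constants are integrable, so uniformly bounded pointwise convergence
  suffices twice: it passes to the limit in the integration by parts, which makes the limit of the
  gradients a weak gradient of \<open>v\<close>, and it sends the \<open>H1_norm\<close> distances
  to zero.\<close>

lemma H10_bounded_limit:
  fixes v :: "real^'n \<Rightarrow> real"
  assumes D: "open D" "bounded D" and t: "\<And>k. test_fun D (\<phi> k)"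
    and b: "\<And>k x. x \<in> D \<Longrightarrow> \<bar>\<phi> k x\<bar> \<le> b" "\<And>k i x. x \<in> D \<Longrightarrow> \<bar>iter_pd (\<phi> k) [i] x\<bar> \<le> b"
    and lim: "\<And>x. x \<in> D \<Longrightarrow> (\<lambda>k. \<phi> k x) \<longlonglongrightarrow> v x"
    and conv: "\<And>i. AE x in lebesgue_on D. convergent (\<lambda>k. iter_pd (\<phi> k) [i] x)"
  shows "H10 D v"
proof -
  have s: "smooth_fun (\<phi> k)" for k using t[of k] by (simp add: test_fun_def)
  have [measurable]: "\<phi> k \<in> borel_measurable (lebesgue_on D)" "iter_pd (\<phi> k) [i] \<in> borel_measurable (lebesgue_on D)" for k i
    using smooth_fun_continuous[OF s, of D k "[]"] smooth_fun_continuous[OF s, of D k "[i]"] D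
    by (auto intro: continuous_imp_measurable_on_sets_lebesgue)
  \<comment> \<open>\<open>lim\<close> is unspecified where the gradients diverge, which happens
    only on a null set.\<close>
  define g where "g i x = lim (\<lambda>k. iter_pd (\<phi> k) [i] x)" for i x
  have [measurable]: "g i \<in> borel_measurable (lebesgue_on D)" for i
    unfolding g_def by (rule borel_measurable_lim_metric) measurable
  have glim: "AE x in lebesgue_on D. (\<lambda>k. iter_pd (\<phi> k) [i] x) \<longlonglongrightarrow> g i x" for i
    using conv[of i] by eventually_elim (simp add: g_def convergent_LIMSEQ_iff)
  have [measurable]: "v \<in> borel_measurable (lebesgue_on D)"
    by (rule borel_measurable_LIMSEQ_real[of _ \<phi>]) (use lim in auto)
  have inD: "AE x in lebesgue_on D. x \<in> D" by (rule AE_I2) simp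
  have vb: "\<bar>v x\<bar> \<le> b" if "x \<in> D" for x
    using tendsto_rabs[OF lim[OF that]] by (rule Lim_bounded) (use b that in auto)
  have gb: "AE x in lebesgue_on D. \<bar>g i x\<bar> \<le> b" for i
    using glim[of i] inD
  proof eventually_elim
    case (elim x)
    from tendsto_rabs[OF elim(1)] show ?case by (rule Lim_bounded) (use b elim in auto)
  qed
  have Lv: "L2fun D v" by (rule bounded_L2fun[OF D, where b = b], measurable, rule AE_I2) (simp add: vb)
  have Lg: "L2fun D (g i)" for i by (rule bounded_L2fun[OF D _ gb]) measurable
  have wp: "has_weak_partial D v i (g i)" for i
    unfolding has_weak_partial_def
  proof (intro conjI allI impI L2fun_L1loc[OF D(1)] Lv Lg)
    fix \<psi> assume tp: "test_fun D \<psi>"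
    obtain K c where K: "\<And>x. \<bar>\<psi> x\<bar> \<le> c" "\<And>x i. \<bar>iter_pd \<psi> [i] x\<bar> \<le> c"
      and [measurable]: "\<psi> \<in> borel_measurable (lebesgue_on D)" "\<And>i. iter_pd \<psi> [i] \<in> borel_measurable (lebesgue_on D)"
      using test_fun_bounds[OF D(1) tp] by metis
    have 1: "(\<lambda>k. \<integral>x. \<phi> k x * iter_pd \<psi> [i] x \<partial>lebesgue_on D) \<longlonglongrightarrow> (\<integral>x. v x * iter_pd \<psi> [i] x \<partial>lebesgue_on D)"
    proof (rule bounded_convergence_lebesgue_on[OF D, where b = "b * c"])
      show "AE x in lebesgue_on D. (\<lambda>k. \<phi> k x * iter_pd \<psi> [i] x) \<longlonglongrightarrow> v x * iter_pd \<psi> [i] x"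
        using inD by eventually_elim (intro tendsto_mult tendsto_const lim)
      show "\<bar>\<phi> k x * iter_pd \<psi> [i] x\<bar> \<le> b * c" if "x \<in> D" for k x
        unfolding abs_mult using b(1)[OF that, of k] K(2)[of i x] by (intro mult_mono) auto
    qed measurable
    have 2: "(\<lambda>k. \<integral>x. iter_pd (\<phi> k) [i] x * \<psi> x \<partial>lebesgue_on D) \<longlonglongrightarrow> (\<integral>x. g i x * \<psi> x \<partial>lebesgue_on D)"
    proof (rule bounded_convergence_lebesgue_on[OF D, where b = "b * c"])
      show "AE x in lebesgue_on D. (\<lambda>k. iter_pd (\<phi> k) [i] x * \<psi> x) \<longlonglongrightarrow> g i x * \<psi> x"
        using glim[of i] by eventually_elim (intro tendsto_mult tendsto_const)
      show "\<bar>iter_pd (\<phi> k) [i] x * \<psi> x\<bar> \<le> b * c" if "x \<in> D" for k x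
        unfolding abs_mult using b(2)[OF that, of k i] K(1)[of x] by (intro mult_mono) auto
    qed measurable
    have "(\<lambda>k. \<integral>x. \<phi> k x * iter_pd \<psi> [i] x \<partial>lebesgue_on D) \<longlonglongrightarrow> - (\<integral>x. g i x * \<psi> x \<partial>lebesgue_on D)"
      unfolding integration_by_parts[OF D(1) s tp] by (rule tendsto_minus[OF 2])
    with 1 show "(\<integral>x. v x * iter_pd \<psi> [i] x \<partial>lebesgue_on D) = - (\<integral>x. g i x * \<psi> x \<partial>lebesgue_on D)"
      by (rule LIMSEQ_unique)
  qed
  have H1v: "H1 D v" unfolding H1_def using Lv Lg wp by blast
  let ?d = "\<lambda>k x. v x - \<phi> k x"
  have sq: "(H1_norm D (?d k))\<^sup>2 = (\<integral>x. (v x - \<phi> k x)\<^sup>2 \<partial>lebesgue_on D) + (\<Sum>i\<in>UNIV. \<integral>x. (g i x - iter_pd (\<phi> k) [i] x)\<^sup>2 \<partial>lebesgue_on D)" for k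
  proof -
    have "AE x in lebesgue_on D. wpd D (?d k) i x = g i x - iter_pd (\<phi> k) [i] x" for i
      using H1_lincomb(2)[OF D(1) H1v test_fun_H1(1)[OF D(1) t[of k]], of 1 "-1" i] wpd_AE_eq[OF D(1) wp[of i]] test_fun_H1(2)[OF D(1) t[of k], of i]
      by eventually_elim simp
    moreover have "H1 D (?d k)" using H1_lincomb(1)[OF D(1) H1v test_fun_H1(1)[OF D(1) t[of k]], of 1 "-1"] by simp
    ultimately have "(\<integral>x. (wpd D (?d k) i x)\<^sup>2 \<partial>lebesgue_on D) = (\<integral>x. (g i x - iter_pd (\<phi> k) [i] x)\<^sup>2 \<partial>lebesgue_on D)" for i
      by (intro integral_sq_cong_AE L2fun_measurable[OF H1_wpd(2)[OF D(1)]]) auto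
    then show ?thesis unfolding H1_norm_sq by simp
  qed
  have sqle: "\<bar>(p - q)\<^sup>2\<bar> \<le> (2 * b)\<^sup>2" if "\<bar>p\<bar> \<le> b" "\<bar>q\<bar> \<le> b" for p q :: real
    using power_mono[of "\<bar>p - q\<bar>" "2 * b" 2] that by (simp add: power2_abs)
  have 1: "(\<lambda>k. \<integral>x. (v x - \<phi> k x)\<^sup>2 \<partial>lebesgue_on D) \<longlonglongrightarrow> (\<integral>x. 0 \<partial>lebesgue_on D)"
  proof (rule bounded_convergence_lebesgue_on[OF D, where b = "(2 * b)\<^sup>2"])
    show "AE x in lebesgue_on D. (\<lambda>k. (v x - \<phi> k x)\<^sup>2) \<longlonglongrightarrow> 0"
      using inD
    proof eventually_elim
      case (elim x)
      have "(\<lambda>k. (v x - \<phi> k x)\<^sup>2) \<longlonglongrightarrow> (v x - v x)\<^sup>2" by (intro tendsto_intros lim elim)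
      then show ?case by simp
    qed
    show "\<bar>(v x - \<phi> k x)\<^sup>2\<bar> \<le> (2 * b)\<^sup>2" if "x \<in> D" for k x
      by (rule sqle[OF vb[OF that] b(1)[OF that]])
  qed measurable
  have 2: "(\<lambda>k. \<integral>x. (g i x - iter_pd (\<phi> k) [i] x)\<^sup>2 \<partial>lebesgue_on D) \<longlonglongrightarrow> 0" for i
  proof -
    have "finite_measure (lebesgue_on D)"
      using D by (intro finite_measure_lebesgue_on) (auto intro: bounded_set_imp_lmeasurable)
    then interpret finite_measure "lebesgue_on D" .
    have "(\<lambda>k. \<integral>x. (g i x - iter_pd (\<phi> k) [i] x)\<^sup>2 \<partial>lebesgue_on D) \<longlonglongrightarrow> (\<integral>x. 0 \<partial>lebesgue_on D)"
    proof (rule integral_dominated_convergence[where w = "\<lambda>_. (2 * b)\<^sup>2"])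
      show "AE x in lebesgue_on D. (\<lambda>k. (g i x - iter_pd (\<phi> k) [i] x)\<^sup>2) \<longlonglongrightarrow> 0"
        using glim[of i]
      proof eventually_elim
        case (elim x)
        have "(\<lambda>k. (g i x - iter_pd (\<phi> k) [i] x)\<^sup>2) \<longlonglongrightarrow> (g i x - g i x)\<^sup>2" by (intro tendsto_intros elim)
        then show ?case by simp
      qed
      show "AE x in lebesgue_on D. norm ((g i x - iter_pd (\<phi> k) [i] x)\<^sup>2) \<le> (2 * b)\<^sup>2" for k
        using gb[of i] inD by eventually_elim (use sqle b(2) in auto)
      show "(\<lambda>x. (g i x - iter_pd (\<phi> k) [i] x)\<^sup>2) \<in> borel_measurable (lebesgue_on D)" for k by measurable
    qed simp_all
    then show ?thesis by simp
  qed
  have "(\<lambda>k. (H1_norm D (?d k))\<^sup>2) \<longlonglongrightarrow> 0 + (\<Sum>i\<in>(UNIV::'n set). 0)"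
    unfolding sq using 1 by (intro tendsto_add tendsto_sum 2) simp
  then have "(\<lambda>k. sqrt ((H1_norm D (?d k))\<^sup>2)) \<longlonglongrightarrow> sqrt 0" by (intro tendsto_real_sqrt) simp
  then have "(\<lambda>k. H1_norm D (?d k)) \<longlonglongrightarrow> 0" by (simp add: tendsto_rabs_zero_iff)
  then show ?thesis unfolding H10_def using H1v t by blast
qed

text \<open>Along the segment from \<open>x\<close> to \<open>y\<close> the pieces pull back to
  finitely many closed sets covering the unit interval. On each of them the function has slope at
  most \<open>L\<close> times the length of the segment, and Lipschitz bounds on finitely many
  closed pieces of an interval glue together.\<close>

lemma lipschitz_piecewise_affine:
  fixes f :: "real^'n \<Rightarrow> real"
  assumes I: "finite I" and cl: "\<And>i. i \<in> I \<Longrightarrow> closed (U i)" and cov: "(\<Union>i\<in>I. U i) = UNIV"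
    and aff: "\<And>i x. i \<in> I \<Longrightarrow> x \<in> U i \<Longrightarrow> f x = a i \<bullet> x + b i" and L: "\<And>i. i \<in> I \<Longrightarrow> norm (a i) \<le> L" and "0 \<le> L"
  shows "\<bar>f x - f y\<bar> \<le> L * norm (x - y)"
proof -
  define c where "c t = x + t *\<^sub>R (y - x)" for t
  have cc: "continuous_on UNIV c" unfolding c_def by (intro continuous_intros)
  let ?V = "\<lambda>i. c -` U i"
  have "(L * norm (x - y))-lipschitz_on {0..1} (f \<circ> c)"
  proof (rule lipschitz_on_closed_Union[where U = ?V and I = I])
    fix i assume i: "i \<in> I"
    show "(L * norm (x - y))-lipschitz_on (?V i) (f \<circ> c)"
    proof (rule lipschitz_onI)
      fix s t assume st: "s \<in> ?V i" "t \<in> ?V i"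
      have "(f \<circ> c) s - (f \<circ> c) t = a i \<bullet> (c s - c t)"
        using st i aff[OF i] by (simp add: inner_diff_right)
      also have "c s - c t = (s - t) *\<^sub>R (y - x)" by (simp add: c_def scaleR_diff_left)
      finally have "dist ((f \<circ> c) s) ((f \<circ> c) t) \<le> norm (a i) * norm ((s - t) *\<^sub>R (y - x))"
        using Cauchy_Schwarz_ineq2[of "a i" "(s - t) *\<^sub>R (y - x)"] by (simp add: dist_real_def)
      also have "\<dots> \<le> L * norm ((s - t) *\<^sub>R (y - x))" by (intro mult_right_mono L i) auto
      finally show "dist ((f \<circ> c) s) ((f \<circ> c) t) \<le> L * norm (x - y) * dist s t"
        by (simp add: dist_real_def norm_minus_commute mult_ac)
    qed (use assms in auto)
  next
    show "closed (?V i)" if "i \<in> I" for i using cl[OF that] continuous_closed_vimage[of "U i" c] cc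
      by (auto simp: continuous_on_eq_continuous_at)
    show "{0..1} \<subseteq> (\<Union>i\<in>I. ?V i)"
    proof
      fix t have "c t \<in> (\<Union>i\<in>I. U i)" by (simp add: cov)
      then show "t \<in> (\<Union>i\<in>I. ?V i)" by blast
    qed
  qed (use assms in auto)
  from lipschitz_onD[OF this, of 0 1] show ?thesis by (simp add: c_def dist_real_def)
qed

lemma FE_space_extension:
  fixes v :: "real^'n \<Rightarrow> real"
  assumes D: "polyhedral_domain D" and T: "triangulation D T" and v: "v \<in> FE_space D T"
  defines "v0 \<equiv> \<lambda>x. if x \<in> D then v x else 0"
  obtains L N where "0 \<le> L" "\<And>x y. \<bar>v0 x - v0 y\<bar> \<le> L * norm (x - y)" "negligible N"
    "\<And>x. x \<in> D \<Longrightarrow> x \<notin> N \<Longrightarrow> \<exists>s>0. \<exists>a b. \<forall>z\<in>ball x s. v0 z = a \<bullet> z + b"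
proof -
  have oD: "open D" using D by (simp add: polyhedral_domain_def)
  have T1: "finite T" "\<And>S. S \<in> T \<Longrightarrow> card S = CARD('n) + 1" "(\<Union>S\<in>T. convex hull S) = closure D"
    using T by (auto simp: triangulation_def)
  have fin: "finite S" if "S \<in> T" for S using T1(2)[OF that] by (metis add_is_0 card.infinite one_neq_zero)
  \<comment> \<open>The zero boundary values enter here: the extension agrees with \<open>v\<close>
    on the closure too, hence is affine on whole simplices including the faces that lie in the
    frontier of \<open>D\<close>.\<close>
  have vcl: "v0 x = v x" if "x \<in> closure D" for x
    using that v oD by (auto simp: v0_def FE_space_def frontier_def interior_open)
  have "\<forall>S\<in>T. \<exists>ab. \<forall>x\<in>convex hull S. v x = fst ab \<bullet> x + snd ab" using v by (auto simp: FE_space_def)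
  then obtain ab where ab: "\<And>S x. S \<in> T \<Longrightarrow> x \<in> convex hull S \<Longrightarrow> v x = fst (ab S) \<bullet> x + snd (ab S)" by metis
  have ab0: "v0 x = fst (ab S) \<bullet> x + snd (ab S)" if "S \<in> T" "x \<in> convex hull S" for S x
    using ab[OF that] vcl[of x] T1(3) that by auto
  define L where "L = (\<Sum>S\<in>T. norm (fst (ab S)))"
  \<comment> \<open>The complement of \<open>D\<close>, where the extension is zero, counts as one
    further closed piece, indexed by \<open>None\<close>; with it the pieces cover the whole
    space.\<close>
  define U where "U i = (case i of None \<Rightarrow> - D | Some S \<Rightarrow> convex hull S)" for i
  define A where "A i = (case i of None \<Rightarrow> 0 | Some S \<Rightarrow> fst (ab S))" for i
  define B where "B i = (case i of None \<Rightarrow> 0 | Some S \<Rightarrow> snd (ab S))" for i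
  have L0: "0 \<le> L" by (simp add: L_def sum_nonneg)
  have lip: "\<bar>v0 x - v0 y\<bar> \<le> L * norm (x - y)" for x y
  proof (rule lipschitz_piecewise_affine[where I = "insert None (Some ` T)" and U = U and a = A and b = B])
    show "closed (U i)" if "i \<in> insert None (Some ` T)" for i
      using that oD compact_imp_closed[OF compact_convex_hull[OF finite_imp_compact[OF fin]]] by (auto simp: U_def)
    show "(\<Union>i\<in>insert None (Some ` T). U i) = UNIV"
      using T1(3) closure_subset[of D] by (auto simp: U_def)
    show "v0 x = A i \<bullet> x + B i" if "i \<in> insert None (Some ` T)" "x \<in> U i" for i x
    proof (cases i)
      case None
      then show ?thesis using that by (simp add: U_def A_def B_def v0_def)
    next
      case (Some S)
      then show ?thesis using that ab0[of S x] by (simp add: U_def A_def B_def image_iff)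
    qed
    show "norm (A i) \<le> L" if "i \<in> insert None (Some ` T)" for i
      using that L0 member_le_sum[of _ T "\<lambda>S. norm (fst (ab S))"] T1(1) by (auto simp: A_def L_def)
  qed (use T1 L0 in auto)
  \<comment> \<open>Frontiers of convex sets are null sets. A point of \<open>D\<close> off
    \<open>N\<close> lies in the interior of some simplex and therefore has a ball on which
    \<open>v0\<close> is affine.\<close>
  define N where "N = (\<Union>S\<in>T. frontier (convex hull S))"
  have N: "negligible N" unfolding N_def
    using T1(1) by (intro negligible_Union) (auto intro: negligible_convex_frontier)
  have loc: "\<exists>s>0. \<exists>a b. \<forall>z\<in>ball x s. v0 z = a \<bullet> z + b" if x: "x \<in> D" "x \<notin> N" for x
  proof -
    have "x \<in> closure D" using x closure_subset by blast
    then obtain S where S: "S \<in> T" "x \<in> convex hull S" using T1(3) by blast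
    then have "x \<in> interior (convex hull S)" using x(2) closure_subset[of "convex hull S"] by (auto simp: N_def frontier_def)
    then obtain s where "s > 0" "ball x s \<subseteq> convex hull S" by (auto simp: mem_interior)
    then show ?thesis using ab0[OF S(1)] by blast
  qed
  show ?thesis by (rule that[OF L0 lip N loc])
qed

text \<open>Dilating about \<open>c\<close> by \<open>1 + p k\<close> moves the support into a compact subset of \<open>D\<close>, which leaves room to mollify.\<close>
lemma FE_space_H10:
  fixes v :: "real^'n \<Rightarrow> real"
  assumes D: "polyhedral_domain D" and T: "triangulation D T" and v: "v \<in> FE_space D T"
  shows "H10 D v"
proof -
  have oD: "open D" and bD: "bounded D" and cD: "convex D" and "D \<noteq> {}" using D by (auto simp: polyhedral_domain_def)
  then obtain c where c: "c \<in> D" by blast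
  define v0 where "v0 x = (if x \<in> D then v x else 0)" for x
  obtain L N where L0: "0 \<le> L" and L: "\<And>x y. \<bar>v0 x - v0 y\<bar> \<le> L * norm (x - y)" and N: "negligible N"
    and loc: "\<And>x. x \<in> D \<Longrightarrow> x \<notin> N \<Longrightarrow> \<exists>s>0. \<exists>a b. \<forall>z\<in>ball x s. v0 z = a \<bullet> z + b"
    using FE_space_extension[OF assms] unfolding v0_def by metis
  obtain R where R: "\<And>x. x \<in> D \<Longrightarrow> norm (x - c) \<le> R"
    using bD c by (metis bounded_any_center dist_norm norm_minus_commute)
  define p where "p k = 1 / real (Suc k)" for k
  have p: "0 < p k" "p k \<le> 1" for k by (auto simp: p_def)
  have p0: "p \<longlonglongrightarrow> 0" unfolding p_def using LIMSEQ_inverse_real_of_nat by (simp add: inverse_eq_divide)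
  define z where "z k x = c + (1 + p k) *\<^sub>R (x - c)" for k x
  define w where "w k x = v0 (z k x)" for k x
  have zd: "z k x - x = p k *\<^sub>R (x - c)" for k x by (simp add: z_def algebra_simps)
  have zdiff: "z k x - z k y = (1 + p k) *\<^sub>R (x - y)" for k x y by (simp add: z_def algebra_simps)
  have wL: "\<bar>w k x - w k y\<bar> \<le> 2 * L * norm (x - y)" for k x y
  proof -
    have "\<bar>w k x - w k y\<bar> \<le> L * norm (z k x - z k y)" unfolding w_def by (rule L)
    also have "\<dots> = L * ((1 + p k) * norm (x - y))" unfolding zdiff using p(1)[of k] by simp
    also have "\<dots> \<le> L * (2 * norm (x - y))" using p(2)[of k] L0 by (intro mult_left_mono mult_right_mono) auto
    finally show ?thesis by simp
  qed
  have wc: "continuous_on UNIV (w k)" for k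
    by (rule lipschitz_on_continuous_on[of "2 * L"], rule lipschitz_onI) (use wL L0 in \<open>auto simp: dist_norm\<close>)
  have "\<exists>\<phi> r. test_fun D \<phi> \<and> 0 < r \<and> r \<le> p k \<and> (\<forall>x. \<bar>\<phi> x - w k x\<bar> \<le> 2 * L * r) \<and> (\<forall>x i. \<bar>iter_pd \<phi> [i] x\<bar> \<le> 2 * L) \<and>
     (\<forall>x a s b i. r < s \<longrightarrow> (\<forall>z\<in>ball x s. w k z = a \<bullet> z + b) \<longrightarrow> iter_pd \<phi> [i] x = a $ i)" for k
  proof -
    \<comment> \<open>With this \<open>e\<close> the map
      \<open>\<lambda>x. x - e *\<^sub>R (x - c)\<close> is the inverse of the dilation
      \<open>z k\<close>. Convexity makes it send the closure of \<open>D\<close> into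
      \<open>D\<close>, so the support of \<open>w k\<close> lies in the compact set
      \<open>K\<close>.\<close>
    define e where "e = 1 - 1 / (1 + p k)"
    have e: "0 < e" "e \<le> 1" using p(1)[of k] by (auto simp: e_def field_simps)
    define K where "K = (\<lambda>x. x - e *\<^sub>R (x - c)) ` closure D"
    have K: "compact K" unfolding K_def
      using bD by (intro compact_continuous_image continuous_intros) (simp add: compact_closure)
    have KD: "K \<subseteq> D"
      unfolding K_def using mem_interior_closure_convex_shrink[OF cD, of c] c e oD by (auto simp: interior_open)
    have Kne: "K \<noteq> {}" using c by (auto simp: K_def)
    have wK: "x \<in> K" if "w k x \<noteq> 0" for x
    proof -
      have "z k x \<in> D" using that by (auto simp: w_def v0_def split: if_splits)
      moreover have "z k x - e *\<^sub>R (z k x - c) = x"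
      proof -
        have "z k x - e *\<^sub>R (z k x - c) = c + ((1 - e) * (1 + p k)) *\<^sub>R (x - c)"
          by (simp add: z_def algebra_simps)
        also have "(1 - e) * (1 + p k) = 1" using p(1)[of k] by (simp add: e_def)
        finally show ?thesis by simp
      qed
      ultimately show ?thesis
        unfolding K_def using closure_subset[of D] by (intro image_eqI[of _ _ "z k x"]) auto
    qed
    obtain \<epsilon> where \<epsilon>: "\<epsilon> > 0" "(\<Union>x\<in>K. cball x \<epsilon>) \<subseteq> D"
      using compact_subset_open_imp_cball_epsilon_subset[OF K oD KD] by metis
    \<comment> \<open>Radius at most \<open>\<epsilon>\<close> keeps the mollified function
      supported in \<open>D\<close>; radius at most \<open>p k\<close> makes the mollification error
      vanish as \<open>k\<close> grows.\<close>
    define r where "r = min \<epsilon> (p k)"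
    have r: "r > 0" "r \<le> p k" "r \<le> \<epsilon>" using \<epsilon> p(1)[of k] by (auto simp: r_def)
    obtain a b where "K \<subseteq> cbox a b" using bounded_subset_cbox_symmetric[OF compact_imp_bounded[OF K]] by metis
    then have w0: "w k x = 0" if "x \<notin> cbox a b" for x using wK[of x] that by blast
    obtain \<phi> where \<phi>: "smooth_fun \<phi>" "\<And>x. \<phi> x \<noteq> 0 \<Longrightarrow> \<exists>z\<in>ball x r. w k z \<noteq> 0"
      "\<And>x e. (\<And>z. z \<in> ball x r \<Longrightarrow> \<bar>w k z - w k x\<bar> \<le> e) \<Longrightarrow> \<bar>\<phi> x - w k x\<bar> \<le> e"
      "\<And>L x i. (\<And>x y. \<bar>w k x - w k y\<bar> \<le> L * norm (x - y)) \<Longrightarrow> \<bar>iter_pd \<phi> [i] x\<bar> \<le> L"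
      "\<And>x c s d i. r < s \<Longrightarrow> (\<And>z. z \<in> ball x s \<Longrightarrow> w k z = c \<bullet> z + d) \<Longrightarrow> iter_pd \<phi> [i] x = c $ i"
      using mollification[OF r(1) wc[of k] w0] by blast
    let ?K = "{x. infdist x K \<le> \<epsilon>}"
    have "compact ?K" by (rule compact_infdist_le[OF Kne K \<epsilon>(1)])
    have "?K \<subseteq> D"
    proof
      fix x assume "x \<in> ?K"
      moreover obtain y where "y \<in> K" "infdist x K = dist x y"
        using infdist_attains_inf[OF compact_imp_closed[OF K] Kne] by metis
      ultimately have "x \<in> cball y \<epsilon>" "y \<in> K" by (auto simp: dist_commute)
      then show "x \<in> D" using \<epsilon>(2) by blast
    qed
    have "{x. \<phi> x \<noteq> 0} \<subseteq> ?K"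
    proof clarify
      fix x assume "\<phi> x \<noteq> 0"
      then obtain y where y: "y \<in> ball x r" "w k y \<noteq> 0" using \<phi>(2) by blast
      have "infdist x K \<le> dist x y" by (rule infdist_le[OF wK[OF y(2)]])
      then show "infdist x K \<le> \<epsilon>" using y(1) r(3) by simp
    qed
    then have "closure {x. \<phi> x \<noteq> 0} \<subseteq> ?K" by (rule closure_minimal) (rule compact_imp_closed[OF \<open>compact ?K\<close>])
    then have "test_fun D \<phi>"
      unfolding test_fun_def using \<phi>(1) \<open>?K \<subseteq> D\<close> compact_Int_closed[OF \<open>compact ?K\<close> closed_closure, of "{x. \<phi> x \<noteq> 0}"]
      by (auto simp: Int_absorb1)
    moreover have "\<bar>\<phi> x - w k x\<bar> \<le> 2 * L * r" for x
    proof (rule \<phi>(3))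
      fix y assume "y \<in> ball x r"
      then have "2 * L * norm (y - x) \<le> 2 * L * r" using L0 by (intro mult_left_mono) (auto simp: dist_norm norm_minus_commute)
      then show "\<bar>w k y - w k x\<bar> \<le> 2 * L * r" using wL[of k y x] by linarith
    qed
    moreover have "\<bar>iter_pd \<phi> [i] x\<bar> \<le> 2 * L" for x i by (rule \<phi>(4)[OF wL])
    ultimately show ?thesis using r \<phi>(5) by (intro exI[of _ \<phi>] exI[of _ r]) blast
  qed
  then obtain \<phi> r where t: "\<And>k. test_fun D (\<phi> k)" and r: "\<And>k. 0 < r k" "\<And>k. r k \<le> p k"
    and close: "\<And>k x. \<bar>\<phi> k x - w k x\<bar> \<le> 2 * L * r k" and pd: "\<And>k x i. \<bar>iter_pd (\<phi> k) [i] x\<bar> \<le> 2 * L"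
    and aff: "\<And>k x a s b i. r k < s \<Longrightarrow> \<forall>z\<in>ball x s. w k z = a \<bullet> z + b \<Longrightarrow> iter_pd (\<phi> k) [i] x = a $ i"
    by metis
  have err: "\<bar>\<phi> k x - v0 x\<bar> \<le> (2 * L + L * norm (x - c)) * p k" for k x
  proof -
    have "\<bar>w k x - v0 x\<bar> \<le> L * norm (z k x - x)" unfolding w_def by (rule L)
    also have "\<dots> = L * norm (x - c) * p k" unfolding zd using p(1)[of k] by simp
    finally have "\<bar>w k x - v0 x\<bar> \<le> L * norm (x - c) * p k" .
    moreover have "2 * L * r k \<le> 2 * L * p k" using r L0 by (intro mult_left_mono) auto
    ultimately show ?thesis using close[of k x] by (simp add: algebra_simps)
  qed
  have v0b: "\<bar>v0 x\<bar> \<le> \<bar>v0 c\<bar> + L * R" if "x \<in> D" for x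
  proof -
    have "L * norm (x - c) \<le> L * R" using R[OF that] L0 by (intro mult_left_mono) auto
    then show ?thesis using L[of x c] by linarith
  qed
  define b where "b = \<bar>v0 c\<bar> + L * R + (2 * L + L * R) + 2 * L"
  have R0: "0 \<le> R" using R[OF c] by simp
  show ?thesis
  proof (rule H10_bounded_limit[OF oD bD t, where b = b])
    fix k x assume x: "x \<in> D"
    have "(2 * L + L * norm (x - c)) * p k \<le> (2 * L + L * R) * 1"
      using L0 R0 R[OF x] p(1)[of k] p(2)[of k] by (intro mult_mono add_left_mono mult_left_mono) auto
    then have "\<bar>\<phi> k x - v0 x\<bar> \<le> 2 * L + L * R" using err[of k x] by simp
    then show "\<bar>\<phi> k x\<bar> \<le> b" using v0b[OF x] L0 unfolding b_def by linarith
    show "\<bar>iter_pd (\<phi> k) [i] x\<bar> \<le> b" for i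
      using pd[of k i x] L0 R0 mult_nonneg_nonneg[OF L0 R0] unfolding b_def by linarith
  next
    fix x assume x: "x \<in> D"
    have "(\<lambda>k. (2 * L + L * norm (x - c)) * p k) \<longlonglongrightarrow> (2 * L + L * norm (x - c)) * 0" by (intro tendsto_intros p0)
    then have "(\<lambda>k. (2 * L + L * norm (x - c)) * p k) \<longlonglongrightarrow> 0" by simp
    then have "(\<lambda>k. \<phi> k x - v0 x) \<longlonglongrightarrow> 0"
      by (rule Lim_null_comparison[rotated]) (simp add: err)
    then show "(\<lambda>k. \<phi> k x) \<longlonglongrightarrow> v x" using x by (simp add: LIM_zero_iff v0_def)
  next
    fix i
    \<comment> \<open>Near a point off \<open>N\<close>, \<open>v0\<close> is affine with gradient
      \<open>a\<close>. For large \<open>k\<close> the dilation maps the ball of radius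
      \<open>s / 2\<close> into the ball of radius \<open>s\<close>, and \<open>r k < s / 2\<close>,
      so the mollified gradient equals \<open>(1 + p k) *\<^sub>R a\<close> exactly and converges to
      \<open>a\<close>.\<close>
    have cv: "convergent (\<lambda>k. iter_pd (\<phi> k) [i] x)" if x: "x \<in> D" "x \<notin> N" for x
    proof -
      obtain s a b where s: "s > 0" "\<And>y. y \<in> ball x s \<Longrightarrow> v0 y = a \<bullet> y + b" using loc[OF x] by blast
      have "(\<lambda>k. p k * (norm (x - c) + s)) \<longlonglongrightarrow> 0 * (norm (x - c) + s)" by (intro tendsto_intros p0)
      then have "\<forall>\<^sub>F k in sequentially. p k * (norm (x - c) + s) < s / 2" using s(1) by (intro order_tendstoD) auto
      moreover have "\<forall>\<^sub>F k in sequentially. p k < s / 2" using p0 s(1) by (intro order_tendstoD) auto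
      ultimately have "\<forall>\<^sub>F k in sequentially. (1 + p k) * a $ i = iter_pd (\<phi> k) [i] x"
      proof eventually_elim
        case (elim k)
        have "w k y = ((1 + p k) *\<^sub>R a) \<bullet> y + (a \<bullet> c - (1 + p k) * (a \<bullet> c) + b)" if y: "y \<in> ball x (s / 2)" for y
        proof -
          have "norm (y - c) \<le> norm (x - c) + s"
            using y s(1) norm_triangle_ineq[of "y - x" "x - c"] by (simp add: dist_norm norm_minus_commute)
          then have "p k * norm (y - c) \<le> p k * (norm (x - c) + s)" using p(1)[of k] by (intro mult_left_mono) auto
          then have "p k * norm (y - c) < s / 2" using elim(1) by linarith
          then have "norm (z k y - y) < s / 2" using p(1)[of k] by (simp add: zd)
          then have "z k y \<in> ball x s" using y dist_triangle[of x "z k y" y] by (simp add: dist_norm norm_minus_commute)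
          then have "w k y = a \<bullet> z k y + b" using s(2) by (simp add: w_def)
          then show ?thesis by (simp add: z_def algebra_simps inner_add_right inner_diff_right)
        qed
        moreover have "r k < s / 2" using r(2)[of k] elim(2) by linarith
        ultimately have "iter_pd (\<phi> k) [i] x = ((1 + p k) *\<^sub>R a) $ i" using aff by blast
        then show ?case by simp
      qed
      moreover have "(\<lambda>k. (1 + p k) * a $ i) \<longlonglongrightarrow> (1 + 0) * a $ i" by (intro tendsto_intros p0)
      ultimately have "(\<lambda>k. iter_pd (\<phi> k) [i] x) \<longlonglongrightarrow> (1 + 0) * a $ i" by (rule Lim_transform_eventually[rotated])
      then show ?thesis by (rule convergentI)
    qed
    have "AE x in lebesgue. x \<notin> N" using N by (simp add: negligible_iff_null_sets AE_not_in)
    then have "AE x in lebesgue. x \<in> D \<longrightarrow> convergent (\<lambda>k. iter_pd (\<phi> k) [i] x)" by eventually_elim (use cv in blast)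
    then show "AE x in lebesgue_on D. convergent (\<lambda>k. iter_pd (\<phi> k) [i] x)"
      using oD by (subst AE_restrict_space_iff) auto
  qed
qed

section \<open>Perturbation of the coefficient\<close>

lemma V_norm_sq:
  fixes u :: "real^'n \<Rightarrow> real"
  assumes "open D" "H1 D u"
  shows "(V_norm D u)\<^sup>2 = (\<Sum>i\<in>UNIV. \<integral>x. (wpd D u i x)\<^sup>2 \<partial>lebesgue_on D)"
proof -
  have "(\<integral>x. (\<Sum>i\<in>UNIV. (wpd D u i x)\<^sup>2) \<partial>lebesgue_on D) = (\<Sum>i\<in>UNIV. \<integral>x. (wpd D u i x)\<^sup>2 \<partial>lebesgue_on D)"
    using H1_wpd(2)[OF assms] by (intro Bochner_Integration.integral_sum) (auto simp: L2fun_def)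
  moreover have "0 \<le> (\<integral>x. (\<Sum>i\<in>UNIV. (wpd D u i x)\<^sup>2) \<partial>lebesgue_on D)" by (intro Bochner_Integration.integral_nonneg) (auto intro: sum_nonneg)
  ultimately show ?thesis unfolding V_norm_def by simp
qed

lemma V_norm_nonneg: "0 \<le> V_norm D u"
  unfolding V_norm_def by (intro real_sqrt_ge_zero Bochner_Integration.integral_nonneg) (auto intro: sum_nonneg)

text \<open>Converts the uniform \<open>W_norm\<close> bound on the truncated solutions into the
  energy bound that the perturbation estimate asks for.\<close>

lemma V_norm_le_W_norm:
  fixes u :: "real^'n \<Rightarrow> real"
  assumes "open D" "H1 D u"
  shows "V_norm D u \<le> W_norm D u"
proof -
  have "(V_norm D u)\<^sup>2 \<le> (H1_norm D u)\<^sup>2" unfolding V_norm_sq[OF assms] H1_norm_sq by simp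
  also have "\<dots> \<le> (H1_norm D u)\<^sup>2 + (\<Sum>i\<in>UNIV. \<Sum>j\<in>UNIV. \<integral>x. (wpd D (wpd D u i) j x)^2 \<partial>lebesgue_on D)"
    by (simp add: sum_nonneg)
  finally have "sqrt ((V_norm D u)\<^sup>2) \<le> H2_norm D u" unfolding H2_norm_def by (rule real_sqrt_le_mono)
  then show ?thesis using V_norm_nonneg[of D u] by simp
qed

lemma bounded_mult_integrable:
  fixes K f :: "'a \<Rightarrow> real"
  assumes "K \<in> borel_measurable M" "AE x in M. \<bar>K x\<bar> \<le> C" "integrable M f"
  shows "integrable M (\<lambda>x. K x * f x)"
proof (rule Bochner_Integration.integrable_bound)
  show "integrable M (\<lambda>x. C * f x)" using assms by simp
  show "(\<lambda>x. K x * f x) \<in> borel_measurable M" using assms by auto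
  show "AE x in M. norm (K x * f x) \<le> norm (C * f x)"
    using assms(2) by eventually_elim (auto simp: abs_mult intro!: mult_right_mono)
qed

text \<open>Strang-type perturbation bound: subtract the two identities and apply Young's inequality.\<close>
lemma coefficient_stability:
  fixes p1 p2 :: "real^'n \<Rightarrow> real"
  assumes D: "open D" and p: "H1 D p1" "H1 D p2"
    and K: "K1 \<in> borel_measurable (lebesgue_on D)" "K2 \<in> borel_measurable (lebesgue_on D)"
    and C: "AE x in lebesgue_on D. \<bar>K1 x\<bar> \<le> C" "AE x in lebesgue_on D. \<bar>K2 x\<bar> \<le> C"
    and m: "0 < m" "AE x in lebesgue_on D. m \<le> K1 x"
    and t: "0 \<le> t" "AE x in lebesgue_on D. \<bar>K1 x - K2 x\<bar> \<le> t"
    and eq: "a_form D K1 p1 (\<lambda>x. p1 x - p2 x) = a_form D K2 p2 (\<lambda>x. p1 x - p2 x)"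
  shows "V_norm D (\<lambda>x. p1 x - p2 x) \<le> t / m * V_norm D p2"
proof -
  let ?e = "\<lambda>x. p1 x - p2 x"
  have He: "H1 D ?e" and we: "\<And>i. AE x in lebesgue_on D. wpd D ?e i x = wpd D p1 i x - wpd D p2 i x"
    using H1_lincomb[OF D p, of 1 "-1"] by auto
  let ?G = "wpd D ?e" and ?A = "wpd D p1" and ?B = "wpd D p2"
  have L: "L2fun D (?G i)" "L2fun D (?A i)" "L2fun D (?B i)" for i by (intro H1_wpd(2)[OF D] He p)+
  have iAG: "integrable (lebesgue_on D) (\<lambda>x. \<Sum>i\<in>UNIV. ?A i x * ?G i x)"
    and iBG: "integrable (lebesgue_on D) (\<lambda>x. \<Sum>i\<in>UNIV. ?B i x * ?G i x)"
    and iGG: "integrable (lebesgue_on D) (\<lambda>x. \<Sum>i\<in>UNIV. (?G i x)\<^sup>2)"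
    and iBB: "integrable (lebesgue_on D) (\<lambda>x. \<Sum>i\<in>UNIV. (?B i x)\<^sup>2)"
    using L by (auto intro!: Bochner_Integration.integrable_sum L2fun_mult_integrable simp: L2fun_def)
  note iK = bounded_mult_integrable[OF K(1) C(1)] bounded_mult_integrable[OF K(2) C(2)]
  let ?EG = "\<integral>x. (\<Sum>i\<in>UNIV. (?G i x)\<^sup>2) \<partial>lebesgue_on D" and ?EB = "\<integral>x. (\<Sum>i\<in>UNIV. (?B i x)\<^sup>2) \<partial>lebesgue_on D"
  have we': "AE x in lebesgue_on D. \<forall>i. ?G i x = ?A i x - ?B i x" using we by (intro AE_all_countable[THEN iffD2]) auto
  have "m * ?EG = (\<integral>x. m * (\<Sum>i\<in>UNIV. (?G i x)\<^sup>2) \<partial>lebesgue_on D)" by simp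
  also have "\<dots> \<le> (\<integral>x. K1 x * (\<Sum>i\<in>UNIV. (?G i x)\<^sup>2) \<partial>lebesgue_on D)"
  proof (rule integral_mono_AE)
    show "AE x in lebesgue_on D. m * (\<Sum>i\<in>UNIV. (?G i x)\<^sup>2) \<le> K1 x * (\<Sum>i\<in>UNIV. (?G i x)\<^sup>2)"
      using m(2) by eventually_elim (auto intro!: mult_right_mono sum_nonneg)
  qed (use iGG iK in auto)
  also have "\<dots> = (\<integral>x. K1 x * (\<Sum>i\<in>UNIV. ?A i x * ?G i x) - K1 x * (\<Sum>i\<in>UNIV. ?B i x * ?G i x) \<partial>lebesgue_on D)"
  proof (rule integral_cong_AE)
    show "AE x in lebesgue_on D. K1 x * (\<Sum>i\<in>UNIV. (?G i x)\<^sup>2) = K1 x * (\<Sum>i\<in>UNIV. ?A i x * ?G i x) - K1 x * (\<Sum>i\<in>UNIV. ?B i x * ?G i x)"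
      using we'
    proof eventually_elim
      case (elim x)
      have "(\<Sum>i\<in>UNIV. (?G i x)\<^sup>2) = (\<Sum>i\<in>UNIV. ?A i x * ?G i x - ?B i x * ?G i x)"
        using elim by (intro sum.cong) (auto simp: power2_eq_square left_diff_distrib)
      then show ?case by (simp add: sum_subtractf right_diff_distrib)
    qed
  qed (use iK[OF iGG] iK[OF iAG] iK[OF iBG] in \<open>auto dest: borel_measurable_integrable\<close>)
  also have "\<dots> = (\<integral>x. K1 x * (\<Sum>i\<in>UNIV. ?A i x * ?G i x) \<partial>lebesgue_on D) - (\<integral>x. K1 x * (\<Sum>i\<in>UNIV. ?B i x * ?G i x) \<partial>lebesgue_on D)"
    by (rule Bochner_Integration.integral_diff[OF iK(1)[OF iAG] iK(1)[OF iBG]])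
  also have "\<dots> = (\<integral>x. K2 x * (\<Sum>i\<in>UNIV. ?B i x * ?G i x) \<partial>lebesgue_on D) - (\<integral>x. K1 x * (\<Sum>i\<in>UNIV. ?B i x * ?G i x) \<partial>lebesgue_on D)"
    using eq by (simp add: a_form_def)
  also have "\<dots> = (\<integral>x. K2 x * (\<Sum>i\<in>UNIV. ?B i x * ?G i x) - K1 x * (\<Sum>i\<in>UNIV. ?B i x * ?G i x) \<partial>lebesgue_on D)"
    by (rule Bochner_Integration.integral_diff[symmetric, OF iK(2)[OF iBG] iK(1)[OF iBG]])
  also have "\<dots> \<le> (\<integral>x. t\<^sup>2 / (2 * m) * (\<Sum>i\<in>UNIV. (?B i x)\<^sup>2) + m / 2 * (\<Sum>i\<in>UNIV. (?G i x)\<^sup>2) \<partial>lebesgue_on D)"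
  proof (rule integral_mono_AE)
    show "AE x in lebesgue_on D. K2 x * (\<Sum>i\<in>UNIV. ?B i x * ?G i x) - K1 x * (\<Sum>i\<in>UNIV. ?B i x * ?G i x) \<le>
        t\<^sup>2 / (2 * m) * (\<Sum>i\<in>UNIV. (?B i x)\<^sup>2) + m / 2 * (\<Sum>i\<in>UNIV. (?G i x)\<^sup>2)"
      using t(2)
    proof eventually_elim
      case (elim x)
      \<comment> \<open>The weights are chosen so that the gradient of the difference enters with
        factor \<open>m / 2\<close>, half of what coercivity provides, and is absorbed by the left
        side; the rest gives the factor \<open>(t / m)^2\<close>.\<close>
      have young: "(K2 x - K1 x) * (b * g) \<le> t\<^sup>2 / (2 * m) * b\<^sup>2 + m / 2 * g\<^sup>2" for b g
      proof -
        have "(K2 x - K1 x) * (b * g) \<le> \<bar>K1 x - K2 x\<bar> * \<bar>b * g\<bar>" by (metis abs_ge_self abs_minus_commute abs_mult)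
        also have "\<dots> \<le> t * \<bar>b * g\<bar>" using elim by (intro mult_right_mono) auto
        also have "\<dots> \<le> t\<^sup>2 / (2 * m) * b\<^sup>2 + m / 2 * g\<^sup>2"
        proof -
          have "0 \<le> (t * \<bar>b\<bar> - m * \<bar>g\<bar>)\<^sup>2 / (2 * m)" using m by simp
          then show ?thesis using m by (simp add: power2_diff field_simps abs_mult power2_eq_square)
        qed
        finally show ?thesis .
      qed
      have "K2 x * (\<Sum>i\<in>UNIV. ?B i x * ?G i x) - K1 x * (\<Sum>i\<in>UNIV. ?B i x * ?G i x) = (\<Sum>i\<in>UNIV. (K2 x - K1 x) * (?B i x * ?G i x))"
        by (simp add: sum_distrib_left left_diff_distrib sum_subtractf)
      also have "\<dots> \<le> (\<Sum>i\<in>UNIV. t\<^sup>2 / (2 * m) * (?B i x)\<^sup>2 + m / 2 * (?G i x)\<^sup>2)" by (intro sum_mono young)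
      finally show ?case by (simp add: sum.distrib sum_distrib_left)
    qed
  qed (intro Bochner_Integration.integrable_diff Bochner_Integration.integrable_add integrable_mult_right iK iBG iBB iGG)+
  also have "\<dots> = t\<^sup>2 / (2 * m) * ?EB + m / 2 * ?EG" using iBB iGG by simp
  finally have "m / 2 * ?EG \<le> t\<^sup>2 / (2 * m) * ?EB" by linarith
  then have "?EG \<le> (t / m)\<^sup>2 * ?EB" using m by (simp add: field_simps power2_eq_square)
  then have "sqrt ?EG \<le> sqrt ((t / m)\<^sup>2 * ?EB)" by (rule real_sqrt_le_mono)
  also have "\<dots> = t / m * sqrt ?EB" using t m by (simp add: real_sqrt_mult)
  finally show ?thesis by (simp add: V_norm_def)
qed

text \<open>\<open>F\<close> is additive and homogeneous only on \<open>H10\<close>, so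
  \<open>F u - F v\<close> becomes the value at the difference only when \<open>u\<close>,
  \<open>v\<close>, \<open>(-1) * v\<close> and the difference all lie there. Passing to
  \<open>\<bar>C\<bar>\<close> makes the constant nonnegative.\<close>

lemma V_dual_bounds:
  assumes F: "V_dual D F"
  obtains C where "0 \<le> C" "\<And>u. H10 D u \<Longrightarrow> \<bar>F u\<bar> \<le> C * V_norm D u"
    "\<And>u v. H10 D u \<Longrightarrow> H10 D v \<Longrightarrow> H10 D (\<lambda>x. u x - v x) \<Longrightarrow> H10 D (\<lambda>x. (-1) * v x) \<Longrightarrow> \<bar>F u - F v\<bar> \<le> C * V_norm D (\<lambda>x. u x - v x)"
proof -
  obtain C where C: "\<And>v. H10 D v \<Longrightarrow> \<bar>F v\<bar> \<le> C * V_norm D v" using F by (auto simp: V_dual_def)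
  have C': "\<bar>F v\<bar> \<le> \<bar>C\<bar> * V_norm D v" if "H10 D v" for v
    using C[OF that] mult_right_mono[OF abs_ge_self[of C] V_norm_nonneg[of D v]] by linarith
  show ?thesis
  proof (rule that[of "\<bar>C\<bar>"])
    fix u v assume h: "H10 D u" "H10 D v" "H10 D (\<lambda>x. u x - v x)" "H10 D (\<lambda>x. (-1) * v x)"
    have "F (\<lambda>x. u x + (-1) * v x) = F u + F (\<lambda>x. (-1) * v x)" using F h unfolding V_dual_def by blast
    also have "F (\<lambda>x. (-1) * v x) = (-1) * F v" using F h unfolding V_dual_def by blast
    finally have "F (\<lambda>x. u x - v x) = F u - F v" by simp
    then show "\<bar>F u - F v\<bar> \<le> \<bar>C\<bar> * V_norm D (\<lambda>x. u x - v x)" using C'[OF h(3)] by simp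
  qed (use C' in auto)
qed

lemma Linf_norm_AE:
  assumes "Linf D g"
  shows "AE x in lebesgue_on D. \<bar>g x\<bar> \<le> Linf_norm D g"
proof -
  let ?s = "esssup (lebesgue_on D) (\<lambda>x. ereal \<bar>g x\<bar>)"
  have [measurable]: "g \<in> borel_measurable (lebesgue_on D)" using assms by (simp add: Linf_def)
  obtain C where "AE x in lebesgue_on D. \<bar>g x\<bar> \<le> C" using assms by (auto simp: Linf_def)
  then have "?s \<le> ereal C" by (intro esssup_I) auto
  \<comment> \<open>\<open>real_of_ereal\<close> sends infinity to 0, so the essential supremum must
    be known to stay below infinity before \<open>Linf_norm\<close> can serve as a bound.\<close>
  then have fin: "?s \<noteq> \<infinity>" by auto
  have "AE x in lebesgue_on D. ereal \<bar>g x\<bar> \<le> ?s" by (rule esssup_AE)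
  then show ?thesis
    by eventually_elim (use fin in \<open>cases ?s; auto simp: Linf_norm_def\<close>)
qed

lemma ess_inf_AE: "AE x in lebesgue_on D. ess_inf D g \<le> ereal (g x)"
proof -
  have "AE x in lebesgue_on D. - ereal (g x) \<le> esssup (lebesgue_on D) (\<lambda>x. - ereal (g x))" by (rule esssup_AE)
  then show ?thesis unfolding ess_inf_def by eventually_elim (simp add: ereal_uminus_le_reorder)
qed

text \<open>For countably many real coordinates the product sigma-algebra is the Borel algebra of
  the product topology, so continuity in that topology gives measurability.\<close>

lemma continuous_on_Ucube_measurable:
  assumes "continuous_on Ucube g"
  shows "g \<in> borel_measurable rho"
proof -
  have "(\<lambda>u. u) \<in> measurable rho (PiM UNIV (\<lambda>_. borel))"
    unfolding rho_def
  proof (rule measurable_PiM_single')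
    fix j :: nat
    have "(\<lambda>u. u j) \<in> measurable (PiM UNIV (\<lambda>_. rho1)) rho1" by simp
    moreover have "(\<lambda>x. x) \<in> measurable rho1 borel"
      unfolding measurable_cong_sets[OF sets_rho1 refl] by (simp add: measurable_restrict_space1)
    ultimately show "(\<lambda>u. u j) \<in> borel_measurable (PiM UNIV (\<lambda>_. rho1))" by (rule measurable_compose)
  qed auto
  then have "(\<lambda>u. u) \<in> measurable rho borel" by (simp add: sets_PiM_equal_borel cong: measurable_cong_sets)
  then have "(\<lambda>u. u) \<in> measurable rho (restrict_space borel Ucube)"
    by (rule measurable_restrict_space2[rotated]) (simp add: space_rho)
  from measurable_compose[OF this borel_measurable_continuous_on_restrict[OF assms]] show ?thesis .
qed

section \<open>The parametric family of diffusion problems\<close>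

locale parametric_diffusion =
  fixes D :: "(real^'n) set" and T :: "nat \<Rightarrow> (real^'n) set set"
    and Kbar :: "real^'n \<Rightarrow> real" and \<psi> :: "nat \<Rightarrow> real^'n \<Rightarrow> real"
    and f :: "real^'n \<Rightarrow> real" and \<kappa> q :: real
    and P :: "(nat \<Rightarrow> real) \<Rightarrow> real^'n \<Rightarrow> real"
    and PJ :: "nat \<Rightarrow> (nat \<Rightarrow> real) \<Rightarrow> real^'n \<Rightarrow> real"
    and PJl :: "nat \<Rightarrow> nat \<Rightarrow> (nat \<Rightarrow> real) \<Rightarrow> real^'n \<Rightarrow> real"
  assumes domain: "polyhedral_domain D"
    and mesh: "mesh_hierarchy D T"
    and A1: "0 < ess_inf D Kbar" "0 < \<kappa>" "summable (\<lambda>j. Linf_norm D (\<psi> j))"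
            "ereal (\<Sum>j. Linf_norm D (\<psi> j)) \<le> ereal (\<kappa> / (1 + \<kappa>)) * ess_inf D Kbar"
    and A2: "W1inf D Kbar" "\<forall>j. W1inf D (\<psi> j)"
            "0 < q" "\<exists>C. \<forall>J\<ge>1. (\<Sum>j. Linf_norm D (\<psi> (j + J))) \<le> C * real J powr (- q)"
    and A3: "\<exists>B. \<forall>J. \<forall>u\<in>Ucube. W_space D (PJ J u) \<and> W_norm D (PJ J u) \<le> B"
            "\<exists>C. \<forall>J l. \<forall>u\<in>Ucube.
                 V_norm D (\<lambda>x. PJ J u x - PJl J l u x) \<le> C * 2 powr (- real l) * W_norm D (PJ J u)"
    and sol: "\<forall>u\<in>Ucube. weak_solution D (Kfield Kbar \<psi> u) f (P u)"
    and solJ: "\<forall>J. \<forall>u\<in>Ucube. weak_solution D (KJ Kbar \<psi> J u) f (PJ J u)"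
    and solJl: "\<forall>J l. \<forall>u\<in>Ucube. galerkin_solution D (T l) (KJ Kbar \<psi> J u) f (PJl J l u)"
begin

abbreviation nrm :: "nat \<Rightarrow> real" where "nrm j \<equiv> Linf_norm D (\<psi> j)"

lemma open_D: "open D" using domain by (simp add: polyhedral_domain_def)

lemma coefficient_bounds:
  obtains m C where "0 < m"
    "AE x in lebesgue_on D. \<bar>Kbar x\<bar> \<le> C \<and> (\<forall>j. \<bar>\<psi> j x\<bar> \<le> nrm j) \<and> m + (\<Sum>j. nrm j) \<le> Kbar x"
proof -
  obtain C where C: "AE x in lebesgue_on D. \<bar>Kbar x\<bar> \<le> C" using A2(1) by (auto simp: W1inf_def Linf_def)
  have psi: "AE x in lebesgue_on D. \<forall>j. \<bar>\<psi> j x\<bar> \<le> nrm j"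
    using A2(2) by (intro AE_all_countable[THEN iffD2] allI Linf_norm_AE) (auto simp: W1inf_def)
  define \<theta> where "\<theta> = \<kappa> / (1 + \<kappa>)"
  let ?S = "\<Sum>j. nrm j"
  have th: "0 < \<theta>" "\<theta> < 1" using A1(2) by (auto simp: \<theta>_def)
  note A1' = A1(4)[folded \<theta>_def]
  \<comment> \<open>A real lower bound has to be extracted from the extended real
    \<open>ess_inf\<close>. If that is infinite, every real number is a lower bound, and one with
    \<open>?S \<le> \<theta> * k\<close> is taken.\<close>
  have "\<exists>k>0. ?S \<le> \<theta> * k \<and> (AE x in lebesgue_on D. k \<le> Kbar x)"
  proof (cases "ess_inf D Kbar")
    case (real k)
    have "AE x in lebesgue_on D. k \<le> Kbar x" using ess_inf_AE[of D Kbar] by eventually_elim (simp add: real)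
    then show ?thesis using A1(1) A1' by (intro exI[of _ k]) (simp add: real)
  next
    case PInf
    have "AE x in lebesgue_on D. max 1 (?S / \<theta>) \<le> Kbar x" using ess_inf_AE[of D Kbar] by eventually_elim (simp add: PInf)
    moreover have "?S \<le> \<theta> * max 1 (?S / \<theta>)"
    proof -
      have "?S = \<theta> * (?S / \<theta>)" using th by simp
      also have "\<dots> \<le> \<theta> * max 1 (?S / \<theta>)" using th by (intro mult_left_mono) auto
      finally show ?thesis .
    qed
    ultimately show ?thesis by (intro exI[of _ "max 1 (?S / \<theta>)"]) auto
  next
    case MInf
    then show ?thesis using A1(1) by simp
  qed
  then obtain k where k: "0 < k" "?S \<le> \<theta> * k" "AE x in lebesgue_on D. k \<le> Kbar x" by blast
  \<comment> \<open>The ellipticity constant \<open>(1 - \<theta>) * k\<close>, that is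
    \<open>k / (1 + \<kappa>)\<close>, is what remains of the lower bound on \<open>Kbar\<close>
    after the largest possible fluctuation.\<close>
  have le: "(1 - \<theta>) * k + ?S \<le> k" using k(2) by (simp add: left_diff_distrib)
  have "0 < (1 - \<theta>) * k" using th k by simp
  moreover have "AE x in lebesgue_on D. \<bar>Kbar x\<bar> \<le> C \<and> (\<forall>j. \<bar>\<psi> j x\<bar> \<le> nrm j) \<and> (1 - \<theta>) * k + ?S \<le> Kbar x"
    using C psi k(3) by eventually_elim (use le in auto)
  ultimately show ?thesis by (rule that)
qed

lemma coefficient_measurable:
  "KJ Kbar \<psi> J u \<in> borel_measurable (lebesgue_on D)" "Kfield Kbar \<psi> u \<in> borel_measurable (lebesgue_on D)"
proof -
  have [measurable]: "Kbar \<in> borel_measurable (lebesgue_on D)" "\<And>j. \<psi> j \<in> borel_measurable (lebesgue_on D)"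
    using A2(1,2) by (auto simp: W1inf_def Linf_def)
  show "KJ Kbar \<psi> J u \<in> borel_measurable (lebesgue_on D)" unfolding KJ_def by measurable
  show "Kfield Kbar \<psi> u \<in> borel_measurable (lebesgue_on D)" unfolding Kfield_def by measurable
qed

lemma series_bounds:
  assumes u: "u \<in> Ucube" and p: "\<And>j. \<bar>\<psi> j x\<bar> \<le> nrm j"
  shows "\<bar>\<Sum>j<J. u j * \<psi> j x\<bar> \<le> (\<Sum>j. nrm j)" "\<bar>\<Sum>j. u j * \<psi> j x\<bar> \<le> (\<Sum>j. nrm j)"
    "\<bar>Kfield Kbar \<psi> u x - KJ Kbar \<psi> J u x\<bar> \<le> (\<Sum>j. nrm (j + J))"
proof -
  have n0: "0 \<le> nrm j" for j using p[of j] by linarith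
  have t: "\<bar>u j * \<psi> j x\<bar> \<le> nrm j" for j
  proof -
    have "\<bar>u j\<bar> \<le> 1" using u by (auto simp: Ucube_def abs_le_iff)
    then have "\<bar>u j\<bar> * \<bar>\<psi> j x\<bar> \<le> 1 * nrm j" using p[of j] by (intro mult_mono) auto
    then show ?thesis by (simp add: abs_mult)
  qed
  have sa: "summable (\<lambda>j. \<bar>u j * \<psi> j x\<bar>)"
    by (rule summable_comparison_test'[OF A1(3), of 0]) (use t in auto)
  then have s: "summable (\<lambda>j. u j * \<psi> j x)" by (rule summable_rabs_cancel)
  have bound: "\<bar>\<Sum>j. u (j + k) * \<psi> (j + k) x\<bar> \<le> (\<Sum>j. nrm (j + k))" for k
  proof -
    have "\<bar>\<Sum>j. u (j + k) * \<psi> (j + k) x\<bar> \<le> (\<Sum>j. \<bar>u (j + k) * \<psi> (j + k) x\<bar>)"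
      using summable_ignore_initial_segment[OF sa, of k] by (rule summable_rabs)
    also have "\<dots> \<le> (\<Sum>j. nrm (j + k))"
      by (intro suminf_le t summable_ignore_initial_segment[OF sa] summable_ignore_initial_segment[OF A1(3)])
    finally show ?thesis .
  qed
  have "\<bar>\<Sum>j<J. u j * \<psi> j x\<bar> \<le> (\<Sum>j<J. \<bar>u j * \<psi> j x\<bar>)" by (rule sum_abs)
  also have "\<dots> \<le> (\<Sum>j<J. nrm j)" by (intro sum_mono t)
  also have "\<dots> \<le> (\<Sum>j. nrm j)" using n0 by (intro sum_le_suminf A1(3)) auto
  finally show "\<bar>\<Sum>j<J. u j * \<psi> j x\<bar> \<le> (\<Sum>j. nrm j)" .
  show "\<bar>\<Sum>j. u j * \<psi> j x\<bar> \<le> (\<Sum>j. nrm j)" using bound[of 0] by simp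
  have "Kfield Kbar \<psi> u x - KJ Kbar \<psi> J u x = (\<Sum>j. u (j + J) * \<psi> (j + J) x)"
    unfolding Kfield_def KJ_def using suminf_split_initial_segment[OF s, of J] by simp
  then show "\<bar>Kfield Kbar \<psi> u x - KJ Kbar \<psi> J u x\<bar> \<le> (\<Sum>j. nrm (j + J))" using bound[of J] by simp
qed

text \<open>One \<open>m\<close> and one \<open>C\<close> serve all parameters and all truncations,
  which makes the later error constants independent of the level. The last bound compares two
  parameters coordinatewise and is the source of continuity in \<open>u\<close>; the absolute value
  around \<open>nrm j\<close> makes it manifestly nonnegative.\<close>

lemma coefficients:
  obtains m C where "0 < m"
    "\<And>u J. u \<in> Ucube \<Longrightarrow> AE x in lebesgue_on D. m \<le> KJ Kbar \<psi> J u x"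
    "\<And>u. u \<in> Ucube \<Longrightarrow> AE x in lebesgue_on D. m \<le> Kfield Kbar \<psi> u x"
    "\<And>u J. u \<in> Ucube \<Longrightarrow> AE x in lebesgue_on D. \<bar>KJ Kbar \<psi> J u x\<bar> \<le> C"
    "\<And>u. u \<in> Ucube \<Longrightarrow> AE x in lebesgue_on D. \<bar>Kfield Kbar \<psi> u x\<bar> \<le> C"
    "\<And>u J. u \<in> Ucube \<Longrightarrow> AE x in lebesgue_on D. \<bar>Kfield Kbar \<psi> u x - KJ Kbar \<psi> J u x\<bar> \<le> (\<Sum>j. nrm (j + J))"
    "\<And>u u' J. AE x in lebesgue_on D. \<bar>KJ Kbar \<psi> J u x - KJ Kbar \<psi> J u' x\<bar> \<le> (\<Sum>j<J. \<bar>u j - u' j\<bar> * \<bar>nrm j\<bar>)"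
proof -
  obtain m C where m: "0 < m" and
    AE: "AE x in lebesgue_on D. \<bar>Kbar x\<bar> \<le> C \<and> (\<forall>j. \<bar>\<psi> j x\<bar> \<le> nrm j) \<and> m + (\<Sum>j. nrm j) \<le> Kbar x"
    by (rule coefficient_bounds)
  show ?thesis
  proof (rule that[OF m, where C = "C + (\<Sum>j. nrm j)"])
    fix u J assume u: "u \<in> Ucube"
    show "AE x in lebesgue_on D. m \<le> KJ Kbar \<psi> J u x"
      using AE
    proof eventually_elim
      case (elim x)
      then show ?case using series_bounds(1)[OF u, of x J] by (auto simp: KJ_def)
    qed
    show "AE x in lebesgue_on D. \<bar>KJ Kbar \<psi> J u x\<bar> \<le> C + (\<Sum>j. nrm j)"
      using AE
    proof eventually_elim
      case (elim x)
      then show ?case using series_bounds(1)[OF u, of x J] by (auto simp: KJ_def)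
    qed
    show "AE x in lebesgue_on D. \<bar>Kfield Kbar \<psi> u x - KJ Kbar \<psi> J u x\<bar> \<le> (\<Sum>j. nrm (j + J))"
      using AE
    proof eventually_elim
      case (elim x)
      then show ?case using series_bounds(3)[OF u, of x J] by blast
    qed
  next
    fix u assume u: "u \<in> Ucube"
    show "AE x in lebesgue_on D. m \<le> Kfield Kbar \<psi> u x"
      using AE
    proof eventually_elim
      case (elim x)
      then show ?case using series_bounds(2)[OF u, of x] by (auto simp: Kfield_def)
    qed
    show "AE x in lebesgue_on D. \<bar>Kfield Kbar \<psi> u x\<bar> \<le> C + (\<Sum>j. nrm j)"
      using AE
    proof eventually_elim
      case (elim x)
      then show ?case using series_bounds(2)[OF u, of x] by (auto simp: Kfield_def)
    qed
  next
    fix u u' :: "nat \<Rightarrow> real" and J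
    show "AE x in lebesgue_on D. \<bar>KJ Kbar \<psi> J u x - KJ Kbar \<psi> J u' x\<bar> \<le> (\<Sum>j<J. \<bar>u j - u' j\<bar> * \<bar>nrm j\<bar>)"
      using AE
    proof eventually_elim
      case (elim x)
      have "KJ Kbar \<psi> J u x - KJ Kbar \<psi> J u' x = (\<Sum>j<J. (u j - u' j) * \<psi> j x)"
        by (simp add: KJ_def left_diff_distrib sum_subtractf)
      also have "\<bar>\<dots>\<bar> \<le> (\<Sum>j<J. \<bar>(u j - u' j) * \<psi> j x\<bar>)" by (rule sum_abs)
      also have "\<dots> \<le> (\<Sum>j<J. \<bar>u j - u' j\<bar> * \<bar>nrm j\<bar>)"
        unfolding abs_mult using elim by (intro sum_mono mult_left_mono) (auto intro: order_trans[OF _ abs_ge_self])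
      finally show ?case .
    qed
  qed
qed

lemma H10_P: "u \<in> Ucube \<Longrightarrow> H10 D (P u)" and H10_PJ: "u \<in> Ucube \<Longrightarrow> H10 D (PJ J u)"
  using sol solJ by (auto simp: weak_solution_def)

lemma PJl_FE: "u \<in> Ucube \<Longrightarrow> PJl J l u \<in> FE_space D (T l)"
  using solJl by (auto simp: galerkin_solution_def)

lemma H10_PJl: "u \<in> Ucube \<Longrightarrow> H10 D (PJl J l u)"
  using mesh by (intro FE_space_H10[OF domain _ PJl_FE]) (auto simp: mesh_hierarchy_def)

lemma H10_diff: "H10 D u \<Longrightarrow> H10 D v \<Longrightarrow> H10 D (\<lambda>x. u x - v x)"
  using H10_lincomb[OF open_D, of u v 1 "-1"] by simp

lemma H10_uminus: "H10 D v \<Longrightarrow> H10 D (\<lambda>x. (-1) * v x)"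
  using H10_lincomb[OF open_D, of v v 0 "-1"] by simp

lemma H10_H1: "H10 D v \<Longrightarrow> H1 D v" by (simp add: H10_def)

text \<open>Exact and truncated solutions satisfy their equations against the same test function,
  their difference, so \<open>coefficient_stability\<close> applies with the tail of the series as
  \<open>t\<close>. The decay of the tail is available from \<open>J = 1\<close> on.\<close>

lemma truncation_error:
  obtains C where "0 \<le> C" "\<And>J u. 1 \<le> J \<Longrightarrow> u \<in> Ucube \<Longrightarrow> V_norm D (\<lambda>x. P u x - PJ J u x) \<le> C * real J powr (- q)"
proof -
  obtain m C where m: "0 < m"
    "\<And>u J. u \<in> Ucube \<Longrightarrow> AE x in lebesgue_on D. m \<le> KJ Kbar \<psi> J u x"
    "\<And>u. u \<in> Ucube \<Longrightarrow> AE x in lebesgue_on D. m \<le> Kfield Kbar \<psi> u x"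
    "\<And>u J. u \<in> Ucube \<Longrightarrow> AE x in lebesgue_on D. \<bar>KJ Kbar \<psi> J u x\<bar> \<le> C"
    "\<And>u. u \<in> Ucube \<Longrightarrow> AE x in lebesgue_on D. \<bar>Kfield Kbar \<psi> u x\<bar> \<le> C"
    "\<And>u J. u \<in> Ucube \<Longrightarrow> AE x in lebesgue_on D. \<bar>Kfield Kbar \<psi> u x - KJ Kbar \<psi> J u x\<bar> \<le> (\<Sum>j. nrm (j + J))"
    "\<And>u u' J. AE x in lebesgue_on D. \<bar>KJ Kbar \<psi> J u x - KJ Kbar \<psi> J u' x\<bar> \<le> (\<Sum>j<J. \<bar>u j - u' j\<bar> * \<bar>nrm j\<bar>)"
    by (rule coefficients) (rule that; blast)
  obtain Ct where Ct: "\<And>J. J \<ge> 1 \<Longrightarrow> (\<Sum>j. nrm (j + J)) \<le> Ct * real J powr (- q)" using A2(4) by blast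
  obtain B where B: "\<And>J u. u \<in> Ucube \<Longrightarrow> W_norm D (PJ J u) \<le> B" using A3(1) by blast
  show ?thesis
  proof (rule that[of "\<bar>Ct\<bar> / m * \<bar>B\<bar>"])
    show "0 \<le> \<bar>Ct\<bar> / m * \<bar>B\<bar>" using m by simp
    fix J :: nat and u assume J: "1 \<le> J" and u: "u \<in> Ucube"
    let ?t = "\<bar>Ct\<bar> * real J powr (- q)"
    have tt: "(\<Sum>j. nrm (j + J)) \<le> ?t"
      using Ct[OF J] mult_right_mono[OF abs_ge_self[of Ct], of "real J powr (- q)"] by simp
    have e: "H10 D (\<lambda>x. P u x - PJ J u x)" by (intro H10_diff H10_P H10_PJ u)
    have "V_norm D (\<lambda>x. P u x - PJ J u x) \<le> ?t / m * V_norm D (PJ J u)"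
    proof (rule coefficient_stability[OF open_D H10_H1[OF H10_P[OF u]] H10_H1[OF H10_PJ[OF u]] coefficient_measurable(2,1) m(5)[OF u] m(4)[OF u] m(1) m(3)[OF u]])
      show "AE x in lebesgue_on D. \<bar>Kfield Kbar \<psi> u x - KJ Kbar \<psi> J u x\<bar> \<le> ?t"
        using m(6)[OF u, of J] by eventually_elim (use tt in linarith)
      show "a_form D (Kfield Kbar \<psi> u) (P u) (\<lambda>x. P u x - PJ J u x) = a_form D (KJ Kbar \<psi> J u) (PJ J u) (\<lambda>x. P u x - PJ J u x)"
        using sol solJ u e by (simp add: weak_solution_def)
    qed auto
    also have "\<dots> \<le> ?t / m * \<bar>B\<bar>"
      using V_norm_le_W_norm[OF open_D H10_H1[OF H10_PJ[OF u, of J]]] B[OF u, of J] m(1) by (intro mult_left_mono) auto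
    finally show "V_norm D (\<lambda>x. P u x - PJ J u x) \<le> \<bar>Ct\<bar> / m * \<bar>B\<bar> * real J powr (- q)" by (simp add: mult_ac)
  qed
qed

text \<open>The Galerkin solutions for two parameters lie in the same finite element space, so their
  difference is an admissible test function for both. Stability then gives continuity in the
  finitely many coordinates on which \<open>KJ\<close> depends.\<close>

lemma functional_PJl_measurable:
  assumes F: "V_dual D F"
  shows "(\<lambda>u. F (PJl J l u)) \<in> borel_measurable rho"
proof (rule continuous_on_Ucube_measurable)
  obtain CF where CF: "0 \<le> CF" "\<And>u v. H10 D u \<Longrightarrow> H10 D v \<Longrightarrow> H10 D (\<lambda>x. u x - v x) \<Longrightarrow> H10 D (\<lambda>x. (-1) * v x) \<Longrightarrow> \<bar>F u - F v\<bar> \<le> CF * V_norm D (\<lambda>x. u x - v x)"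
    using V_dual_bounds[OF F] by metis
  obtain m C where m: "0 < m"
    "\<And>u J. u \<in> Ucube \<Longrightarrow> AE x in lebesgue_on D. m \<le> KJ Kbar \<psi> J u x"
    "\<And>u. u \<in> Ucube \<Longrightarrow> AE x in lebesgue_on D. m \<le> Kfield Kbar \<psi> u x"
    "\<And>u J. u \<in> Ucube \<Longrightarrow> AE x in lebesgue_on D. \<bar>KJ Kbar \<psi> J u x\<bar> \<le> C"
    "\<And>u. u \<in> Ucube \<Longrightarrow> AE x in lebesgue_on D. \<bar>Kfield Kbar \<psi> u x\<bar> \<le> C"
    "\<And>u J. u \<in> Ucube \<Longrightarrow> AE x in lebesgue_on D. \<bar>Kfield Kbar \<psi> u x - KJ Kbar \<psi> J u x\<bar> \<le> (\<Sum>j. nrm (j + J))"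
    "\<And>u u' J. AE x in lebesgue_on D. \<bar>KJ Kbar \<psi> J u x - KJ Kbar \<psi> J u' x\<bar> \<le> (\<Sum>j<J. \<bar>u j - u' j\<bar> * \<bar>nrm j\<bar>)"
    by (rule coefficients) (rule that; blast)
  let ?p = "PJl J l"
  have bound: "\<bar>F (?p v) - F (?p u)\<bar> \<le> CF * ((\<Sum>j<J. \<bar>v j - u j\<bar> * \<bar>nrm j\<bar>) / m * V_norm D (?p u))" if u: "u \<in> Ucube" and v: "v \<in> Ucube" for u v
  proof -
    have "(\<lambda>x. ?p v x - ?p u x) \<in> FE_space D (T l)"
    proof -
      have 1: "continuous_on (closure D) (\<lambda>x. ?p v x - ?p u x)" "\<forall>x\<in>frontier D. ?p v x - ?p u x = 0"
        using PJl_FE[OF u, of J l] PJl_FE[OF v, of J l] by (auto simp: FE_space_def intro!: continuous_intros)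
      have "\<exists>a b. \<forall>x\<in>convex hull S. ?p v x - ?p u x = a \<bullet> x + b" if S: "S \<in> T l" for S
      proof -
        obtain a b a' b' where "\<forall>x\<in>convex hull S. ?p v x = a \<bullet> x + b" "\<forall>x\<in>convex hull S. ?p u x = a' \<bullet> x + b'"
          using PJl_FE[OF u, of J l] PJl_FE[OF v, of J l] S by (simp add: FE_space_def) metis
        then show ?thesis by (intro exI[of _ "a - a'"] exI[of _ "b - b'"]) (simp add: inner_diff_left)
      qed
      with 1 show ?thesis by (simp add: FE_space_def)
    qed
    then have eq: "a_form D (KJ Kbar \<psi> J v) (?p v) (\<lambda>x. ?p v x - ?p u x) = a_form D (KJ Kbar \<psi> J u) (?p u) (\<lambda>x. ?p v x - ?p u x)"
      using solJl u v by (simp add: galerkin_solution_def)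
    have "V_norm D (\<lambda>x. ?p v x - ?p u x) \<le> (\<Sum>j<J. \<bar>v j - u j\<bar> * \<bar>nrm j\<bar>) / m * V_norm D (?p u)"
      by (rule coefficient_stability[OF open_D H10_H1[OF H10_PJl[OF v]] H10_H1[OF H10_PJl[OF u]] coefficient_measurable(1,1) m(4)[OF v] m(4)[OF u] m(1) m(2)[OF v] _ m(7) eq])
        (auto intro: sum_nonneg)
    then have "CF * V_norm D (\<lambda>x. ?p v x - ?p u x) \<le> CF * ((\<Sum>j<J. \<bar>v j - u j\<bar> * \<bar>nrm j\<bar>) / m * V_norm D (?p u))"
      using CF(1) by (rule mult_left_mono)
    then show ?thesis
      using CF(2)[OF H10_PJl[OF v, of J l] H10_PJl[OF u, of J l] H10_diff[OF H10_PJl[OF v] H10_PJl[OF u]] H10_uminus[OF H10_PJl[OF u]]] by linarith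
  qed
  show "continuous_on Ucube (\<lambda>u. F (?p u))"
    unfolding continuous_on_def
  proof
    fix u assume u: "u \<in> Ucube"
    let ?h = "\<lambda>v. CF * ((\<Sum>j<J. \<bar>v j - u j\<bar> * \<bar>nrm j\<bar>) / m * V_norm D (?p u))"
    have "continuous_on UNIV ?h" using m(1) by (intro continuous_intros continuous_on_product_coordinates) auto
    then have "continuous_on Ucube ?h" by (rule continuous_on_subset) auto
    then have "(?h \<longlongrightarrow> ?h u) (at u within Ucube)" using u unfolding continuous_on_def by (rule bspec)
    then have h0: "(?h \<longlongrightarrow> 0) (at u within Ucube)" by simp
    have "((\<lambda>v. F (?p v) - F (?p u)) \<longlongrightarrow> 0) (at u within Ucube)"
      by (rule Lim_null_comparison[OF _ h0]) (use bound[OF u] in \<open>auto simp: eventually_at_filter\<close>)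
    then show "((\<lambda>u. F (?p u)) \<longlongrightarrow> F (?p u)) (at u within Ucube)" by (simp add: LIM_zero_iff)
  qed
qed

text \<open>The path from \<open>P\<close> to \<open>PJl\<close> passes through \<open>PJ\<close>:
  truncation costs a negative power of \<open>Jlev q l\<close>, at most \<open>(1/2) ^ l\<close> by
  the choice of that number, and the discretisation error has the same order. Since \<open>F\<close>
  is controlled only on \<open>H10\<close>, the second step relies on
  \<open>H10_PJl\<close>.\<close>

lemma functional_approximation:
  assumes F: "V_dual D F"
  obtains C where "0 \<le> C" "\<And>u. u \<in> Ucube \<Longrightarrow> \<bar>F (P u)\<bar> \<le> C"
    "\<And>u l. u \<in> Ucube \<Longrightarrow> \<bar>F (PJl (Jlev q l) l u) - F (P u)\<bar> \<le> C * (1/2) ^ l"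
proof -
  obtain CF where CF: "0 \<le> CF" "\<And>u. H10 D u \<Longrightarrow> \<bar>F u\<bar> \<le> CF * V_norm D u" 
    "\<And>u v. H10 D u \<Longrightarrow> H10 D v \<Longrightarrow> H10 D (\<lambda>x. u x - v x) \<Longrightarrow> H10 D (\<lambda>x. (-1) * v x) \<Longrightarrow> \<bar>F u - F v\<bar> \<le> CF * V_norm D (\<lambda>x. u x - v x)"
    by (rule V_dual_bounds[OF F]) (rule that; blast)
  have Fd: "\<bar>F u - F v\<bar> \<le> CF * V_norm D (\<lambda>x. u x - v x)" if "H10 D u" "H10 D v" for u v
    by (intro CF(3) that H10_diff H10_uminus)
  obtain Ct where Ct: "0 \<le> Ct" "\<And>J u. 1 \<le> J \<Longrightarrow> u \<in> Ucube \<Longrightarrow> V_norm D (\<lambda>x. P u x - PJ J u x) \<le> Ct * real J powr (- q)"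
    using truncation_error by metis
  obtain B where B: "\<And>J u. u \<in> Ucube \<Longrightarrow> W_norm D (PJ J u) \<le> B" using A3(1) by blast
  obtain Cd where Cd: "\<And>J l u. u \<in> Ucube \<Longrightarrow> V_norm D (\<lambda>x. PJ J u x - PJl J l u x) \<le> Cd * 2 powr (- real l) * W_norm D (PJ J u)"
    using A3(2) by blast
  have half: "2 powr (- real l) = (1/2) ^ l" for l by (simp add: powr_minus powr_realpow power_divide inverse_eq_divide)
  have VJ: "V_norm D (PJ J u) \<le> \<bar>B\<bar>" "0 \<le> W_norm D (PJ J u)" if "u \<in> Ucube" for J u
    using V_norm_le_W_norm[OF open_D H10_H1[OF H10_PJ[OF that, of J]]] B[OF that, of J] V_norm_nonneg[of D "PJ J u"] by linarith+
  define C where "C = CF * (Ct + \<bar>B\<bar> + \<bar>Cd\<bar> * \<bar>B\<bar>)"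
  show ?thesis
  proof (rule that[of C])
    show "0 \<le> C" using CF(1) Ct(1) by (simp add: C_def)
    fix u assume u: "u \<in> Ucube"
    \<comment> \<open>The uniform \<open>W_norm\<close> bound concerns the truncated solutions, so
      the exact one is reached from a truncation; \<open>J = 1\<close> is the first to which the
      tail bound applies.\<close>
    have "\<bar>F (P u) - F (PJ 1 u)\<bar> \<le> CF * V_norm D (\<lambda>x. P u x - PJ 1 u x)" by (rule Fd[OF H10_P[OF u] H10_PJ[OF u]])
    also have "\<dots> \<le> CF * Ct" using Ct(2)[OF _ u, of 1] CF(1) by (intro mult_left_mono) auto
    finally have "\<bar>F (P u)\<bar> \<le> CF * Ct + \<bar>F (PJ 1 u)\<bar>" by linarith
    also have "\<bar>F (PJ 1 u)\<bar> \<le> CF * V_norm D (PJ 1 u)" by (rule CF(2)[OF H10_PJ[OF u]])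
    also have "CF * V_norm D (PJ 1 u) \<le> CF * \<bar>B\<bar>" using VJ(1)[OF u, of 1] CF(1) by (rule mult_left_mono)
    finally have "\<bar>F (P u)\<bar> \<le> CF * (Ct + \<bar>B\<bar>)" by (simp add: distrib_left)
    also have "\<dots> \<le> C" unfolding C_def using CF(1) by (intro mult_left_mono) auto
    finally show "\<bar>F (P u)\<bar> \<le> C" .
    fix l
    let ?J = "Jlev q l"
    have J1: "1 \<le> ?J" by (simp add: Jlev_def)
    have "real ?J powr (- q) \<le> (2 powr (real l / q)) powr (- q)"
      using Jlev_ge[OF A2(3), of l] A2(3) by (intro powr_mono2') auto
    also have "\<dots> = 2 powr (- real l)" using A2(3) by (simp add: powr_powr)
    finally have Jq: "real ?J powr (- q) \<le> (1/2) ^ l" by (simp add: half)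
    have "V_norm D (\<lambda>x. P u x - PJ ?J u x) \<le> Ct * (1/2) ^ l"
      using Ct(2)[OF J1 u] mult_left_mono[OF Jq Ct(1)] by linarith
    then have 1: "\<bar>F (P u) - F (PJ ?J u)\<bar> \<le> CF * (Ct * (1/2) ^ l)"
      using Fd[OF H10_P[OF u] H10_PJ[OF u], of ?J] CF(1) by (meson mult_left_mono order_trans)
    have "Cd * (1/2) ^ l * W_norm D (PJ ?J u) \<le> \<bar>Cd\<bar> * (1/2) ^ l * \<bar>B\<bar>"
      using VJ(2)[OF u, of ?J] B[OF u, of ?J] by (intro mult_mono) auto
    then have "V_norm D (\<lambda>x. PJ ?J u x - PJl ?J l u x) \<le> \<bar>Cd\<bar> * (1/2) ^ l * \<bar>B\<bar>"
      using Cd[OF u, of ?J l] unfolding half by (rule order_trans[rotated])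
    then have "V_norm D (\<lambda>x. PJ ?J u x - PJl ?J l u x) \<le> \<bar>Cd\<bar> * \<bar>B\<bar> * (1/2) ^ l"
      by (simp only: mult.assoc mult.commute[of "\<bar>B\<bar>"])
    then have 2: "\<bar>F (PJ ?J u) - F (PJl ?J l u)\<bar> \<le> CF * (\<bar>Cd\<bar> * \<bar>B\<bar> * (1/2) ^ l)"
      using Fd[OF H10_PJ[OF u, of ?J] H10_PJl[OF u, of ?J l]] CF(1) by (meson mult_left_mono order_trans)
    have "\<bar>F (PJl ?J l u) - F (P u)\<bar> \<le> CF * (Ct * (1/2) ^ l) + CF * (\<bar>Cd\<bar> * \<bar>B\<bar> * (1/2) ^ l)" using 1 2 by linarith
    also have "\<dots> = CF * (Ct + \<bar>Cd\<bar> * \<bar>B\<bar>) * (1/2) ^ l" by (simp add: algebra_simps)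
    also have "\<dots> \<le> C * (1/2) ^ l" unfolding C_def using CF(1) by (intro mult_right_mono mult_left_mono) auto
    finally show "\<bar>F (PJl ?J l u) - F (P u)\<bar> \<le> C * (1/2) ^ l" .
  qed
qed

text \<open>The convergence of Galerkin values along the diagonal \<open>J = Jlev q l\<close>
  exhibits the map as a pointwise limit of measurable functions.\<close>

lemma functional_P_measurable:
  assumes F: "V_dual D F"
  shows "(\<lambda>u. F (P u)) \<in> borel_measurable rho"
proof (rule borel_measurable_LIMSEQ_real)
  show "(\<lambda>u. F (PJl (Jlev q l) l u)) \<in> borel_measurable rho" for l by (rule functional_PJl_measurable[OF F])
  fix u assume "u \<in> space rho"
  then have u: "u \<in> Ucube" by (simp add: space_rho)
  obtain C where C: "\<And>u l. u \<in> Ucube \<Longrightarrow> \<bar>F (PJl (Jlev q l) l u) - F (P u)\<bar> \<le> C * (1/2) ^ l"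
    using functional_approximation[OF F] by metis
  have "(\<lambda>l. C * (1/2) ^ l) \<longlonglongrightarrow> C * 0" by (intro tendsto_mult tendsto_const LIMSEQ_power_zero) auto
  then have c0: "(\<lambda>l. C * (1/2) ^ l) \<longlonglongrightarrow> 0" by simp
  have "(\<lambda>l. F (PJl (Jlev q l) l u) - F (P u)) \<longlonglongrightarrow> 0"
    by (rule Lim_null_comparison[OF _ c0]) (use C[OF u] in auto)
  then show "(\<lambda>l. F (PJl (Jlev q l) l u)) \<longlonglongrightarrow> F (P u)" by (simp add: LIM_zero_iff)
qed

end

section \<open>The posterior expectation\<close>

lemma misfit_eq:
  "misfit S \<delta> y = (\<Sum>i\<in>UNIV. \<Sum>j\<in>UNIV. matrix_inv S $ i $ j / 2 * ((\<delta> $ i - y $ i) * (\<delta> $ j - y $ j)))"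
  by (simp add: misfit_def inner_vec_def matrix_vector_mult_def sum_distrib_left mult_ac)

text \<open>For bounded observations every residual component is at most \<open>a\<close>, and a
  quadratic form is bounded and Lipschitz on a bounded set. The entries of
  \<open>matrix_inv S\<close> enter only through the sum \<open>A\<close> of their halved absolute
  values, which fits the componentwise hypotheses.\<close>

lemma misfit_bounds:
  fixes S :: "real^'k^'k"
  obtains K where "0 \<le> K" "\<And>y. (\<And>i. \<bar>y $ i\<bar> \<le> c) \<Longrightarrow> \<bar>misfit S \<delta> y\<bar> \<le> K"
    "\<And>y z d. (\<And>i. \<bar>y $ i\<bar> \<le> c) \<Longrightarrow> (\<And>i. \<bar>z $ i\<bar> \<le> c) \<Longrightarrow> (\<And>i. \<bar>y $ i - z $ i\<bar> \<le> d) \<Longrightarrow> \<bar>misfit S \<delta> y - misfit S \<delta> z\<bar> \<le> K * d"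
proof -
  define a where "a = \<bar>c\<bar> + (\<Sum>i\<in>UNIV. \<bar>\<delta> $ i\<bar>)"
  define A where "A = (\<Sum>i\<in>UNIV. \<Sum>j\<in>UNIV. \<bar>matrix_inv S $ i $ j / 2\<bar>)"
  have a0: "0 \<le> a" by (simp add: a_def sum_nonneg)
  have A0: "0 \<le> A" by (simp add: A_def sum_nonneg)
  have ab: "\<bar>\<delta> $ i - y $ i\<bar> \<le> a" if "\<And>i. \<bar>y $ i\<bar> \<le> c" for y i
    using that[of i] member_le_sum[of i UNIV "\<lambda>i. \<bar>\<delta> $ i\<bar>"] unfolding a_def by simp
  have weighted: "\<bar>\<Sum>i\<in>UNIV. \<Sum>j\<in>UNIV. matrix_inv S $ i $ j / 2 * f i j\<bar> \<le> A * b" if "\<And>i j. \<bar>f i j\<bar> \<le> b" for f b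
  proof -
    have "\<bar>\<Sum>i\<in>UNIV. \<Sum>j\<in>UNIV. matrix_inv S $ i $ j / 2 * f i j\<bar> \<le> (\<Sum>i\<in>UNIV. \<Sum>j\<in>UNIV. \<bar>matrix_inv S $ i $ j / 2 * f i j\<bar>)"
      by (intro order_trans[OF sum_abs] sum_mono order.refl)
    also have "\<dots> \<le> (\<Sum>i\<in>UNIV. \<Sum>j\<in>UNIV. \<bar>matrix_inv S $ i $ j / 2\<bar> * b)"
      unfolding abs_mult[of "matrix_inv S $ _ $ _ / 2"] by (intro sum_mono mult_left_mono that) auto
    finally show ?thesis by (simp add: A_def sum_distrib_right)
  qed
  show ?thesis
  \<comment> \<open>The first summand bounds the value of the misfit and the second its Lipschitz
    constant; their sum serves as a common constant.\<close>
  proof (rule that[of "A * (a * a) + A * (2 * a)"])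
    show "0 \<le> A * (a * a) + A * (2 * a)" using a0 A0 by simp
    fix y :: "real^'k" assume y: "\<And>i. \<bar>y $ i\<bar> \<le> c"
    have "\<bar>misfit S \<delta> y\<bar> \<le> A * (a * a)" unfolding misfit_eq
      by (rule weighted) (use ab[OF y] a0 in \<open>auto simp: abs_mult intro!: mult_mono\<close>)
    moreover have "0 \<le> A * (2 * a)" using a0 A0 by simp
    ultimately show "\<bar>misfit S \<delta> y\<bar> \<le> A * (a * a) + A * (2 * a)" by linarith
    fix z :: "real^'k" and d assume z: "\<And>i. \<bar>z $ i\<bar> \<le> c" and d: "\<And>i. \<bar>y $ i - z $ i\<bar> \<le> d"
    have d0: "0 \<le> d" using d order_trans[OF abs_ge_zero] by blast
    have "misfit S \<delta> y - misfit S \<delta> z = (\<Sum>i\<in>UNIV. \<Sum>j\<in>UNIV. matrix_inv S $ i $ j / 2 *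
       ((\<delta> $ i - y $ i) * (\<delta> $ j - y $ j) - (\<delta> $ i - z $ i) * (\<delta> $ j - z $ j)))"
      unfolding misfit_eq by (simp add: sum_subtractf right_diff_distrib)
    also have "\<bar>\<dots>\<bar> \<le> A * (2 * a * d)"
    proof (rule weighted)
      fix i j
      have "(\<delta> $ i - y $ i) * (\<delta> $ j - y $ j) - (\<delta> $ i - z $ i) * (\<delta> $ j - z $ j) =
          (z $ i - y $ i) * (\<delta> $ j - y $ j) + (\<delta> $ i - z $ i) * (z $ j - y $ j)" by (simp add: algebra_simps)
      also have "\<bar>\<dots>\<bar> \<le> d * a + a * d"
      proof (rule order_trans[OF abs_triangle_ineq add_mono])
        show "\<bar>(z $ i - y $ i) * (\<delta> $ j - y $ j)\<bar> \<le> d * a"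
          unfolding abs_mult using d[of i] ab[OF y, of j] d0 by (intro mult_mono) (auto simp: abs_minus_commute)
        show "\<bar>(\<delta> $ i - z $ i) * (z $ j - y $ j)\<bar> \<le> a * d"
          unfolding abs_mult using d[of j] ab[OF z, of i] a0 by (intro mult_mono) (auto simp: abs_minus_commute)
      qed
      finally show "\<bar>(\<delta> $ i - y $ i) * (\<delta> $ j - y $ j) - (\<delta> $ i - z $ i) * (\<delta> $ j - z $ j)\<bar> \<le> 2 * a * d" by simp
    qed
    also have "\<dots> \<le> (A * (a * a) + A * (2 * a)) * d" using a0 A0 d0 by (simp add: algebra_simps)
    finally show "\<bar>misfit S \<delta> y - misfit S \<delta> z\<bar> \<le> (A * (a * a) + A * (2 * a)) * d" .
  qed
qed

lemma misfit_measurable: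
  fixes g :: "'k::finite \<Rightarrow> 'a \<Rightarrow> real"
  assumes [measurable]: "\<And>i. g i \<in> borel_measurable M"
  shows "(\<lambda>u. misfit S \<delta> (\<chi> i. g i u)) \<in> borel_measurable M"
  unfolding misfit_eq by simp

context parametric_diffusion
begin

theorem mlmcmc_posterior_error:
  fixes Obs :: "'k::finite \<Rightarrow> (real^'n \<Rightarrow> real) \<Rightarrow> real" and \<Sigma> :: "real^'k^'k" and \<delta> :: "real^'k"
  assumes obs: "\<And>i. V_dual D (Obs i)" and ell: "V_dual D ell"
  shows "\<exists>C>0. \<forall>L\<ge>1. \<forall>(M :: 'w measure) u0 vw.
       prob_space M \<and> (\<forall>l\<le>L. \<forall>l'\<le>L - l. \<forall>s<3. isampler_setup M (u0 l l' s) (vw l l' s)) \<longrightarrow>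
       (\<integral>\<^sup>+\<omega>. ennreal \<bar>post_mean (\<lambda>u. misfit \<Sigma> \<delta> (\<chi> i. Obs i (P u))) (\<lambda>u. ell (P u))
            - mlmcmc_est L
                (\<lambda>l u. misfit \<Sigma> \<delta> (\<chi> i. Obs i (PJl (Jlev q l) l u)))
                (\<lambda>l u. ell (PJl (Jlev q l) l u))
                (\<lambda>l l' s. u0 l l' s \<omega>) (\<lambda>l l' s k. vw l l' s k \<omega>)\<bar> \<partial>M)
       \<le> ennreal (C * real L ^ 2 * 2 powr (- real L))"
proof -
  have "\<forall>i. \<exists>C\<ge>0. (\<forall>u\<in>Ucube. \<bar>Obs i (P u)\<bar> \<le> C) \<and> (\<forall>u\<in>Ucube. \<forall>l. \<bar>Obs i (PJl (Jlev q l) l u) - Obs i (P u)\<bar> \<le> C * (1/2) ^ l)"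
    using functional_approximation[OF obs] by metis
  then obtain Co where Co: "\<And>i. 0 \<le> Co i" "\<And>i u. u \<in> Ucube \<Longrightarrow> \<bar>Obs i (P u)\<bar> \<le> Co i"
    "\<And>i u l. u \<in> Ucube \<Longrightarrow> \<bar>Obs i (PJl (Jlev q l) l u) - Obs i (P u)\<bar> \<le> Co i * (1/2) ^ l" by metis
  \<comment> \<open>There are finitely many observation functionals, so the sum of their constants
    is a bound common to all.\<close>
  define c where "c = (\<Sum>i\<in>UNIV. Co i)"
  have c: "Co i \<le> c" for i unfolding c_def using Co(1) by (intro member_le_sum) auto
  obtain Ce where Ce: "0 \<le> Ce" "\<And>u. u \<in> Ucube \<Longrightarrow> \<bar>ell (P u)\<bar> \<le> Ce"
    "\<And>u l. u \<in> Ucube \<Longrightarrow> \<bar>ell (PJl (Jlev q l) l u) - ell (P u)\<bar> \<le> Ce * (1/2) ^ l"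
    using functional_approximation[OF ell] by metis
  have half: "b * (1/2) ^ l \<le> b" if "0 \<le> b" for b :: real and l
    using that power_le_one[of "1/2::real" l] mult_left_le[of "(1/2) ^ l" b] by simp
  \<comment> \<open>Exact observations are at most \<open>c\<close> and approximate ones differ from
    them by at most another \<open>c\<close>; hence \<open>2 * c\<close> is a common range on which
    the misfit is Lipschitz.\<close>
  have ob: "\<bar>Obs i (P u)\<bar> \<le> 2 * c" "\<bar>Obs i (PJl (Jlev q l) l u)\<bar> \<le> 2 * c"
    "\<bar>Obs i (PJl (Jlev q l) l u) - Obs i (P u)\<bar> \<le> c * (1/2) ^ l" if "u \<in> Ucube" for u i l
  proof -
    show d: "\<bar>Obs i (PJl (Jlev q l) l u) - Obs i (P u)\<bar> \<le> c * (1/2) ^ l"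
      using c[of i] by (intro order_trans[OF Co(3)[OF that]] mult_right_mono) auto
    have "0 \<le> c" using Co(1)[of i] c[of i] by linarith
    then show "\<bar>Obs i (P u)\<bar> \<le> 2 * c" "\<bar>Obs i (PJl (Jlev q l) l u)\<bar> \<le> 2 * c"
      using Co(2)[OF that, of i] c[of i] d half[of c l] by linarith+
  qed
  obtain K where K: "0 \<le> K" "\<And>y. (\<And>i. \<bar>y $ i\<bar> \<le> 2 * c) \<Longrightarrow> \<bar>misfit \<Sigma> \<delta> y\<bar> \<le> K"
    "\<And>y z d. (\<And>i. \<bar>y $ i\<bar> \<le> 2 * c) \<Longrightarrow> (\<And>i. \<bar>z $ i\<bar> \<le> 2 * c) \<Longrightarrow> (\<And>i. \<bar>y $ i - z $ i\<bar> \<le> d) \<Longrightarrow> \<bar>misfit \<Sigma> \<delta> y - misfit \<Sigma> \<delta> z\<bar> \<le> K * d"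
    by (rule misfit_bounds[of "2 * c" \<Sigma> \<delta>]) (rule that; blast)
  let ?Phi = "\<lambda>l u. misfit \<Sigma> \<delta> (\<chi> i. Obs i (PJl (Jlev q l) l u))" and ?Phi' = "\<lambda>u. misfit \<Sigma> \<delta> (\<chi> i. Obs i (P u))"
  let ?G = "\<lambda>l u. ell (PJl (Jlev q l) l u)" and ?G' = "\<lambda>u. ell (P u)"
  have c0: "0 \<le> c" using Co(1) by (simp add: c_def sum_nonneg)
  \<comment> \<open>\<open>K\<close> bounds the potentials, while \<open>2 * Ce\<close> bounds the
    quantities of interest, one \<open>Ce\<close> for the exact value and one for the approximation
    error. The rate constant likewise adds \<open>K * c\<close> for the potentials and
    \<open>Ce\<close> for the quantities of interest.\<close>
  interpret multilevel_approximation ?Phi ?G ?Phi' ?G' "K + 2 * Ce" "K * c + Ce"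
  proof
    show "?Phi l \<in> borel_measurable rho" "?G l \<in> borel_measurable rho" for l
      by (intro misfit_measurable functional_PJl_measurable obs ell)+
    show "?Phi' \<in> borel_measurable rho" "?G' \<in> borel_measurable rho"
      by (intro misfit_measurable functional_P_measurable obs ell)+
    fix l u assume "u \<in> space rho"
    then have u: "u \<in> Ucube" by (simp add: space_rho)
    have "\<bar>?Phi l u\<bar> \<le> K" "\<bar>?Phi' u\<bar> \<le> K" by (rule K(2); simp add: ob[OF u])+
    then show "\<bar>?Phi l u\<bar> \<le> K + 2 * Ce" "\<bar>?Phi' u\<bar> \<le> K + 2 * Ce" using Ce(1) by linarith+
    show "\<bar>?G' u\<bar> \<le> K + 2 * Ce" using Ce(1) Ce(2)[OF u] K(1) by linarith
    show "\<bar>?G l u\<bar> \<le> K + 2 * Ce" using Ce(1) Ce(2)[OF u] Ce(3)[OF u, of l] half[OF Ce(1), of l] K(1) by linarith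
    have "\<bar>?Phi l u - ?Phi' u\<bar> \<le> K * (c * (1/2) ^ l)" by (rule K(3); simp add: ob[OF u])
    also have "\<dots> \<le> (K * c + Ce) * (1/2) ^ l" using Ce(1) by (simp add: distrib_right)
    finally show "\<bar>?Phi l u - ?Phi' u\<bar> \<le> (K * c + Ce) * (1/2) ^ l" .
    have "Ce * (1/2) ^ l \<le> (K * c + Ce) * (1/2) ^ l" using K(1) c0 by (intro mult_right_mono) auto
    then show "\<bar>?G l u - ?G' u\<bar> \<le> (K * c + Ce) * (1/2) ^ l" using Ce(3)[OF u, of l] by linarith
  qed
  show ?thesis by (rule mlmcmc_error)
qed

end

theorem mainTheorem12:
  fixes D :: "(real^'n) set" and T :: "nat \<Rightarrow> (real^'n) set set"
    and Kbar :: "real^'n \<Rightarrow> real" and \<psi> :: "nat \<Rightarrow> real^'n \<Rightarrow> real"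
    and f :: "real^'n \<Rightarrow> real" and \<kappa> q :: real
    and P :: "(nat \<Rightarrow> real) \<Rightarrow> real^'n \<Rightarrow> real"
    and PJ :: "nat \<Rightarrow> (nat \<Rightarrow> real) \<Rightarrow> real^'n \<Rightarrow> real"
    and PJl :: "nat \<Rightarrow> nat \<Rightarrow> (nat \<Rightarrow> real) \<Rightarrow> real^'n \<Rightarrow> real"
    and Obs :: "'k::finite \<Rightarrow> (real^'n \<Rightarrow> real) \<Rightarrow> real"
    and \<Sigma> :: "real^'k^'k" and \<delta> :: "real^'k"
    and ell :: "(real^'n \<Rightarrow> real) \<Rightarrow> real"
  assumes dim: "CARD('n) \<in> {2, 3}"
    and domain: "polyhedral_domain D"
    and mesh: "mesh_hierarchy D T"
    and A1: "0 < ess_inf D Kbar" "0 < \<kappa>" "summable (\<lambda>j. Linf_norm D (\<psi> j))"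
            "ereal (\<Sum>j. Linf_norm D (\<psi> j)) \<le> ereal (\<kappa> / (1 + \<kappa>)) * ess_inf D Kbar"
    and A2: "W1inf D Kbar" "\<forall>j. W1inf D (\<psi> j)" "summable (\<lambda>j. W1inf_norm D (\<psi> j))"
            "0 < q" "\<exists>C. \<forall>J\<ge>1. (\<Sum>j. Linf_norm D (\<psi> (j + J))) \<le> C * real J powr (- q)"
    and A3: "\<exists>B. \<forall>J. \<forall>u\<in>Ucube. W_space D (PJ J u) \<and> W_norm D (PJ J u) \<le> B"
            "\<exists>C. \<forall>J l. \<forall>u\<in>Ucube.
                 V_norm D (\<lambda>x. PJ J u x - PJl J l u x) \<le> C * 2 powr (- real l) * W_norm D (PJ J u)"
    and f: "L2fun D f"
    and sol: "\<forall>u\<in>Ucube. weak_solution D (Kfield Kbar \<psi> u) f (P u)"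
    and solJ: "\<forall>J. \<forall>u\<in>Ucube. weak_solution D (KJ Kbar \<psi> J u) f (PJ J u)"
    and solJl: "\<forall>J l. \<forall>u\<in>Ucube. galerkin_solution D (T l) (KJ Kbar \<psi> J u) f (PJl J l u)"
    and obs: "\<forall>i. V_dual D (Obs i)"
    and cov: "SPD \<Sigma>"
    and ellV: "V_dual D ell"
  shows
   "(\<exists>C>0. \<forall>L\<ge>1. \<forall>(M :: 'w measure) u0 vw.
       prob_space M \<and> (\<forall>l\<le>L. \<forall>l'\<le>L - l. \<forall>s<3. isampler_setup M (u0 l l' s) (vw l l' s)) \<longrightarrow>
       (\<integral>\<^sup>+\<omega>. ennreal \<bar>post_mean (\<lambda>u. misfit \<Sigma> \<delta> (\<chi> i. Obs i (P u))) (\<lambda>u. ell (P u))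
            - mlmcmc_est L
                (\<lambda>l u. misfit \<Sigma> \<delta> (\<chi> i. Obs i (PJl (Jlev q l) l u)))
                (\<lambda>l u. ell (PJl (Jlev q l) l u))
                (\<lambda>l l' s. u0 l l' s \<omega>) (\<lambda>l l' s k. vw l l' s k \<omega>)\<bar> \<partial>M)
       \<le> ennreal (C * real L ^ 2 * 2 powr (- real L)))
    \<and> (CARD('n) = 2 \<longrightarrow>
        (\<lambda>L. real (\<Sum>l\<le>L. \<Sum>l'\<le>L - l. Mlev L l l' * (2 ^ (CARD('n) * l) + 2 ^ (CARD('n) * l'))))
          \<in> O(\<lambda>L. real L * 2 ^ (2 * L)))
    \<and> (CARD('n) = 3 \<longrightarrow>
        (\<lambda>L. real (\<Sum>l\<le>L. \<Sum>l'\<le>L - l. Mlev L l l' * (2 ^ (CARD('n) * l) + 2 ^ (CARD('n) * l'))))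
          \<in> O(\<lambda>L. 2 ^ (3 * L)))
    \<and> (\<lambda>L. real (\<Sum>l\<le>L. \<Sum>l'\<le>L - l. Mlev L l l' *
            (l ^ (CARD('n) - 1) * 2 ^ (CARD('n) * l) * Jlev q l
             + l' ^ (CARD('n) - 1) * 2 ^ (CARD('n) * l') * Jlev q l')))
        \<in> O(\<lambda>L. real L ^ (CARD('n) - 1) * 2 powr ((real CARD('n) + 1 / q) * real L))"
proof -
  have work: "(\<lambda>L. real (\<Sum>l\<le>L. \<Sum>l'\<le>L - l. Mlev L l l' *
            (l ^ (CARD('n) - 1) * 2 ^ (CARD('n) * l) * Jlev q l
             + l' ^ (CARD('n) - 1) * 2 ^ (CARD('n) * l') * Jlev q l')))
        \<in> O(\<lambda>L. real L ^ (CARD('n) - 1) * 2 powr ((real CARD('n) + 1 / q) * real L))"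
    using dim by (intro work_bigo[OF A2(4)]) auto
  interpret parametric_diffusion D T Kbar \<psi> f \<kappa> q P PJ PJl
    by unfold_locales (fact domain mesh A1 A2 A3 sol solJ solJl)+
  show ?thesis
  proof (intro conjI impI)
    assume d: "CARD('n) = 2"
    show "(\<lambda>L. real (\<Sum>l\<le>L. \<Sum>l'\<le>L - l. Mlev L l l' * (2 ^ (CARD('n) * l) + 2 ^ (CARD('n) * l')))) \<in> O(\<lambda>L. real L * 2 ^ (2 * L))"
      unfolding d by (rule dof_bigo_2)
  next
    assume d: "CARD('n) = 3"
    show "(\<lambda>L. real (\<Sum>l\<le>L. \<Sum>l'\<le>L - l. Mlev L l l' * (2 ^ (CARD('n) * l) + 2 ^ (CARD('n) * l')))) \<in> O(\<lambda>L. 2 ^ (3 * L))"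
      unfolding d by (rule dof_bigo_3)
  qed (rule mlmcmc_posterior_error[OF spec[OF obs] ellV], rule work)
qed

end
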